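(* Consider the TASEP on $\mathbb Z$ with the step initial condition, and for $t\ge 0$ let $a_t$ be the number of active particles at time $t$, i.e. $a_t=\sum_{k\in\mathbb Z}X(k,t)\bigl(1-X(k+1,t)\bigr)$, where $X(k,t)$ is the indicator that there is a particle at site $k$ at time $t$. Then $$\lim_{t\to\infty}\frac{\mathbb E\,a_t}{t}=\frac13 .$$
   Context: TASEP (totally asymmetric simple exclusion process) on $\mathbb Z$ with the step initial condition: at time $0$ there is exactly one particle at each of the sites $0,-1,-2,\dots$ and the sites $1,2,3,\dots$ are empty. At any time each site holds at most one particle. Each particle waits an Exponential(1) time (its clock) and then, if the site immediately to its right is empty, jumps to that site; if that site is occupied, the particle does not move; in either case its clock then restarts. All clocks (successive clocks of the same particle and clocks of different particles) are mutually independent. Equivalently, particles are numbered $r=1,2,\dots$ from right to left (particle $r$ starts at site $1-r$), particle $r$ carries a rate-1 Poisson process of clock rings, these Poisson processes are independent for different $r$, and at each ring of its clock particle $r$ moves one step right if and only if the site to its right is not occupied (for $r\ge 2$, not occupied by particle $r-1$; particle $1$ is never blocked). A particle is active at time $t$ if the site immediately to its right is empty at time $t$. *)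

theory Defs
  imports "HOL-Probability.Probability"
begin

text \<open>
  TASEP with step initial condition, built path by path from the clocks. Throughout,
  \<open>w r 0, w r 1, \<dots>\<close> are the successive waiting times of the clock of particle \<open>r\<close>, and
  its rings are indexed by \<open>n = 0, 1, \<dots>\<close> as well. Particles are numbered \<open>r = 1, 2, \<dots>\<close>
  from right to left; the index \<open>0\<close> is not a particle and does not influence the others.
\<close>

definition ring_time :: "(nat \<Rightarrow> nat \<Rightarrow> real) \<Rightarrow> nat \<Rightarrow> nat \<Rightarrow> real" where
  "ring_time w r n = (\<Sum>i\<le>n. w r i)"

text \<open>
  \<open>site_after w r n\<close> is the site of particle \<open>r\<close> after its first \<open>n\<close> rings. The motion of
  particle \<open>r\<close> depends only on that of particle \<open>r - 1\<close>, so the recursion is well-founded.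
  At the ring with index \<open>n\<close>, particle \<open>r - 1\<close> has had as many rings as fall strictly
  before that instant. Simultaneous rings, and infinitely many rings in a bounded time
  (where \<open>card\<close> yields \<open>0\<close>), occur with probability \<open>0\<close>.
\<close>

fun site_after :: "(nat \<Rightarrow> nat \<Rightarrow> real) \<Rightarrow> nat \<Rightarrow> nat \<Rightarrow> int" where
  "site_after w r 0 = 1 - int r"
| "site_after w r (Suc n) =
     (if r \<le> 1 then site_after w r n + 1
      else if site_after w (r - 1) (card {m. ring_time w (r - 1) m < ring_time w r n})
                = site_after w r n + 1
           then site_after w r n
           else site_after w r n + 1)"

definition particle_site :: "(nat \<Rightarrow> nat \<Rightarrow> real) \<Rightarrow> nat \<Rightarrow> real \<Rightarrow> int" where
  "particle_site w r t = site_after w r (card {n. ring_time w r n \<le> t})"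

definition occupied :: "(nat \<Rightarrow> nat \<Rightarrow> real) \<Rightarrow> int \<Rightarrow> real \<Rightarrow> real" where
  "occupied w k t = of_bool (\<exists>r\<ge>1. particle_site w r t = k)"

text \<open>Almost surely only finitely many summands are nonzero.\<close>

definition active_count :: "(nat \<Rightarrow> nat \<Rightarrow> real) \<Rightarrow> real \<Rightarrow> real" where
  "active_count w t = (\<Sum>\<^sub>\<infinity>k. occupied w k t * (1 - occupied w (k + 1) t))"

end

theory Submission
  imports Defs "HOL-Library.Nat_Bijection"
begin

text \<open>
  Particle \<open>r\<close> is a server in a tandem of queues, the queue being the gap in front of it, and the
  step initial condition means that all queues start empty. Restarting the system empty at time \<open>h\<close>
  with the same clocks can only shorten the queues, and the restarted clocks have the law of the
  original ones; hence the probability that a given particle is active is nondecreasing in time, and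
  so is \<open>\<bbbE> a\<^sub>t\<close>. It therefore suffices to know \<open>\<integral>\<^sub>0\<^sup>t \<bbbE> a\<^sub>s ds\<close>, the expected number of jumps up to time
  \<open>t\<close>, up to \<open>o(t\<^sup>2)\<close>.

  By memorylessness the jump times are the last passage times \<open>G(r, j)\<close> of exponential last passage
  percolation, so that number is the expected area of \<open>{(r, j). G(r, j) \<le> t}\<close>. Comparison with the
  stationary models, whose increments along a row are independent exponentials by the Burke property,
  gives \<open>G(xt, yt) / t \<longrightarrow> (\<surd>x + \<surd>y)\<^sup>2\<close> in probability. The area is thus asymptotic to \<open>t\<^sup>2\<close> times the
  area \<open>1 / 6\<close> of \<open>{(x, y). \<surd>x + \<surd>y \<le> 1}\<close>, and \<open>\<bbbE> a\<^sub>t / t \<longrightarrow> 2 / 6\<close>.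
\<close>

section \<open>Independent identically distributed sequences\<close>

text \<open>Convergence in probability of \<open>G(xt, yt) / t\<close> says nothing direct about
  corners, which are a microscopic feature; it only controls how many cells are filled. Monotonicity
  in time is what allows this integrated statement to be differentiated. The obstacle is that the
  two ingredients live on different randomness: restarting is an operation on the clocks, whereas
  the limit shape belongs to independent weights on the cells. The weights are residual waiting
  times of the clocks, and only equality in law is carried over. Since the activity of a particle
  depends on it and on the one in front, the joint law of two consecutive rows is enough. The value
  \<open>(\<surd>x + \<surd>y)\<^sup>2\<close> is the minimum over \<open>\<rho>\<close> of
  \<open>x / \<rho> + y / (1 - \<rho>)\<close>, the growth of the stationary model with boundary
  rates \<open>\<rho>\<close> and \<open>1 - \<rho>\<close>. Each such model lies above the original
  one; the matching lower bound holds because at the minimising \<open>\<rho>\<close> following the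
  boundary for a macroscopic distance is strictly suboptimal.\<close>

abbreviation iid :: "'a measure \<Rightarrow> (nat \<Rightarrow> 'a) measure" where
  "iid N \<equiv> (\<Pi>\<^sub>M i\<in>UNIV. N)"

lemma measurable_seq_nth:
  assumes "f \<in> measurable M (iid N)"
  shows "(\<lambda>x. f x i) \<in> measurable M N"
  using measurable_compose[OF assms measurable_component_singleton[of i UNIV "\<lambda>_. N"]] by simp

lemma measurable_seqI:
  assumes "\<And>i. (\<lambda>x. f x i) \<in> measurable M N"
  shows "f \<in> measurable M (iid N)"
proof -
  have "(\<lambda>x i. f x i) \<in> measurable M (iid N)"
  proof (rule measurable_PiM_single')
    show "(\<lambda>\<omega> i. f \<omega> i) \<in> space M \<rightarrow> (\<Pi>\<^sub>E i\<in>UNIV. space N)"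
    proof
      fix x assume "x \<in> space M"
      then have "f x i \<in> space N" for i by (rule measurable_space[OF assms])
      then show "(\<lambda>i. f x i) \<in> (\<Pi>\<^sub>E i\<in>UNIV. space N)" by blast
    qed
  qed (rule assms)
  then show ?thesis .
qed

lemma measurable_seq_reindex:
  assumes "g \<in> measurable M (iid N)"
  shows "(\<lambda>x i. g x (\<tau> i)) \<in> measurable M (iid N)"
  by (rule measurable_seqI) (rule measurable_seq_nth[OF assms])

lemma measurable_seq_tl[measurable (raw)]:
  "g \<in> measurable M (iid N) \<Longrightarrow> (\<lambda>x i. g x (Suc i)) \<in> measurable M (iid N)"
  by (rule measurable_seq_reindex)

lemma prob_space_iid: "prob_space N \<Longrightarrow> prob_space (iid N)"
  by (intro prob_space_PiM)

text \<open>Fubini for the head of the sequence against its tail. The inductions on laws below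
  condition on the head in this way.\<close>

lemma nn_integral_iid_peel:
  assumes N: "prob_space N" and f[measurable]: "f \<in> borel_measurable (iid N)"
  shows "(\<integral>\<^sup>+\<omega>. f \<omega> \<partial>iid N) = (\<integral>\<^sup>+x. \<integral>\<^sup>+\<omega>. f (case_nat x \<omega>) \<partial>iid N \<partial>N)"
proof -
  interpret N: prob_space N by fact
  interpret sequence_space N
    by (intro sequence_space.intro product_prob_spaceI) fact
  have "(\<integral>\<^sup>+\<omega>. f \<omega> \<partial>iid N) = (\<integral>\<^sup>+\<omega>. f \<omega> \<partial>distr (N \<Otimes>\<^sub>M iid N) (iid N) (\<lambda>(s, \<omega>). case_nat s \<omega>))"
    by (simp add: PiM_iter)
  also have "\<dots> = (\<integral>\<^sup>+x. f (case_nat (fst x) (snd x)) \<partial>(N \<Otimes>\<^sub>M iid N))"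
    by (subst nn_integral_distr) (auto simp: split_beta')
  also have "\<dots> = (\<integral>\<^sup>+x. \<integral>\<^sup>+\<omega>. f (case_nat x \<omega>) \<partial>iid N \<partial>N)"
    by (subst P.nn_integral_fst[symmetric]) auto
  finally show ?thesis .
qed

lemma nn_integral_iid_tl:
  assumes N: "prob_space N" and f[measurable]: "f \<in> borel_measurable (iid N)"
  shows "(\<integral>\<^sup>+\<omega>. f (\<lambda>i. \<omega> (Suc i)) \<partial>iid N) = (\<integral>\<^sup>+\<omega>. f \<omega> \<partial>iid N)"
proof -
  interpret N: prob_space N by fact
  show ?thesis
    by (subst nn_integral_iid_peel[OF N]) (auto simp: N.emeasure_space_1)
qed

lemma nn_integral_iid_hd:
  assumes N: "prob_space N" and f[measurable]: "f \<in> borel_measurable N"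
  shows "(\<integral>\<^sup>+\<omega>. f (\<omega> 0) \<partial>iid N) = (\<integral>\<^sup>+x. f x \<partial>N)"
proof -
  interpret prob_space "iid N" using prob_space_iid[OF N] .
  show ?thesis
    by (subst nn_integral_iid_peel[OF N]) (auto simp: emeasure_space_1)
qed

text \<open>Products over initial segments suffice: a finite index set is enlarged to an initial
  segment by allowing the whole space at the added coordinates. In this form a law can be identified
  by induction on \<open>m\<close>.\<close>

lemma iid_eqI:
  assumes N: "prob_space N" and sets: "sets M' = sets (iid N)"
  assumes eq: "\<And>m A. (\<And>i. A i \<in> sets N) \<Longrightarrow>
    (\<integral>\<^sup>+\<omega>. (\<Prod>i<m. indicator (A i) (\<omega> i)) \<partial>M') = (\<Prod>i<m. emeasure N (A i))"
  shows "M' = iid N"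
proof -
  interpret N: prob_space N by fact
  interpret sequence_space N
    by (intro sequence_space.intro product_prob_spaceI) fact
  show ?thesis
  proof (rule PiM_eq)
    fix J :: "nat set" and F assume J: "finite J" and F: "\<And>j. j \<in> J \<Longrightarrow> F j \<in> sets N"
    define A where "A i = (if i \<in> J then F i else space N)" for i
    have A: "A i \<in> sets N" for i using F by (auto simp: A_def)
    obtain m where m: "J \<subseteq> {..<m}" using finite_nat_bounded[OF J] by auto
    have sp: "space M' = space (iid N)" using sets by (rule sets_eq_imp_space_eq)
    have meas: "prod_emb UNIV (\<lambda>_. N) J (Pi\<^sub>E J F) \<in> sets M'"
      unfolding sets by (rule sets_PiM_I) (use J F in auto)
    have "emeasure M' (prod_emb UNIV (\<lambda>_. N) J (Pi\<^sub>E J F)) =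
        (\<integral>\<^sup>+\<omega>. indicator (prod_emb UNIV (\<lambda>_. N) J (Pi\<^sub>E J F)) \<omega> \<partial>M')"
      using meas by simp
    also have "\<dots> = (\<integral>\<^sup>+\<omega>. (\<Prod>i<m. indicator (A i) (\<omega> i)) \<partial>M')"
    proof (rule nn_integral_cong)
      fix \<omega> assume "\<omega> \<in> space M'"
      then have \<omega>: "\<omega> i \<in> space N" for i by (auto simp: sp space_PiM)
      show "indicator (prod_emb UNIV (\<lambda>_. N) J (Pi\<^sub>E J F)) \<omega> =
          (\<Prod>i<m. indicator (A i) (\<omega> i) :: ennreal)"
      proof (cases "\<forall>i\<in>J. \<omega> i \<in> F i")
        case True
        then have "\<omega> \<in> prod_emb UNIV (\<lambda>_. N) J (Pi\<^sub>E J F)" using \<omega> by (auto simp: prod_emb_def)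
        moreover have "(\<Prod>i<m. indicator (A i) (\<omega> i) :: ennreal) = 1"
          using True \<omega> by (intro prod.neutral) (auto simp: A_def)
        ultimately show ?thesis by simp
      next
        case False
        then obtain i where i: "i \<in> J" "\<omega> i \<notin> F i" by auto
        then have "\<omega> \<notin> prod_emb UNIV (\<lambda>_. N) J (Pi\<^sub>E J F)" by (auto simp: prod_emb_def PiE_iff)
        moreover have "(\<Prod>i<m. indicator (A i) (\<omega> i) :: ennreal) = 0"
          using i m by (intro prod_zero) (auto simp: A_def intro!: bexI[of _ i])
        ultimately show ?thesis by simp
      qed
    qed
    also have "\<dots> = (\<Prod>i<m. emeasure N (A i))" by (rule eq) (rule A)
    also have "\<dots> = (\<Prod>i\<in>J. emeasure N (A i))"
      using m by (intro prod.mono_neutral_right) (auto simp: A_def N.emeasure_space_1)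
    also have "\<dots> = (\<Prod>i\<in>J. emeasure N (F i))" by (intro prod.cong) (auto simp: A_def)
    finally show "emeasure M' (prod_emb UNIV (\<lambda>_. N) J (Pi\<^sub>E J F)) = (\<Prod>j\<in>J. emeasure N (F j))" .
  qed (use sets in simp)
qed

lemma nn_integral_iid_prod_indicator:
  assumes N: "prob_space N" and A[measurable]: "\<And>i. A i \<in> sets N"
  shows "(\<integral>\<^sup>+\<omega>. (\<Prod>i<m. indicator (A i) (\<omega> i)) \<partial>iid N) = (\<Prod>i<m. emeasure N (A i))"
  using A
proof (induction m arbitrary: A)
  case 0
  interpret prob_space "iid N" using prob_space_iid[OF N] .
  show ?case by (simp add: emeasure_space_1)
next
  case (Suc m)
  note [measurable] = Suc.prems
  show ?case
    by (subst nn_integral_iid_peel[OF N])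
       (auto simp: prod.lessThan_Suc_shift nn_integral_cmult nn_integral_multc Suc.IH simp del: prod.lessThan_Suc)
qed

lemma distr_iid_map:
  assumes N: "prob_space N" and f[measurable]: "f \<in> measurable N N'" and N': "distr N N' f = N'"
  shows "distr (iid N) (iid N') (\<lambda>\<omega> i. f (\<omega> i)) = iid N'"
proof (rule iid_eqI)
  have [measurable]: "(\<lambda>\<omega> i. f (\<omega> i)) \<in> measurable (iid N) (iid N')"
    by (rule measurable_seqI) simp
  show N'p: "prob_space N'" using prob_space.prob_space_distr[OF N f] N' by simp
  fix m and A :: "nat \<Rightarrow> _ set" assume A[measurable]: "\<And>i. A i \<in> sets N'"
  have 1: "indicator (A i) (f x) = (indicator (f -` A i \<inter> space N) x :: ennreal)" if "x \<in> space N" for i x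
    using that by (auto simp: indicator_def)
  have "(\<integral>\<^sup>+\<omega>. (\<Prod>i<m. indicator (A i) (\<omega> i)) \<partial>distr (iid N) (iid N') (\<lambda>\<omega> i. f (\<omega> i))) =
     (\<integral>\<^sup>+\<omega>. (\<Prod>i<m. indicator (A i) (f (\<omega> i))) \<partial>iid N)"
    by (subst nn_integral_distr) auto
  also have "\<dots> = (\<integral>\<^sup>+\<omega>. (\<Prod>i<m. indicator (f -` A i \<inter> space N) (\<omega> i)) \<partial>iid N)"
    by (intro nn_integral_cong prod.cong refl 1) (auto simp: space_PiM)
  also have "\<dots> = (\<Prod>i<m. emeasure N (f -` A i \<inter> space N))"
    by (rule nn_integral_iid_prod_indicator[OF N]) simp
  also have "\<dots> = (\<Prod>i<m. emeasure (distr N N' f) (A i))"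
    by (intro prod.cong refl) (simp add: emeasure_distr)
  finally show "(\<integral>\<^sup>+\<omega>. (\<Prod>i<m. indicator (A i) (\<omega> i)) \<partial>distr (iid N) (iid N') (\<lambda>\<omega> i. f (\<omega> i))) =
    (\<Prod>i<m. emeasure N' (A i))" by (simp add: N')
qed simp

lemma nn_integral_iid_map:
  assumes N: "prob_space N" and f[measurable]: "f \<in> measurable N N'" and N': "distr N N' f = N'"
    and g[measurable]: "g \<in> borel_measurable (iid N')"
  shows "(\<integral>\<^sup>+\<omega>. g (\<lambda>i. f (\<omega> i)) \<partial>iid N) = (\<integral>\<^sup>+\<omega>. g \<omega> \<partial>iid N')"
proof -
  have [measurable]: "(\<lambda>\<omega> i. f (\<omega> i)) \<in> measurable (iid N) (iid N')"
    by (rule measurable_seqI) simp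
  have "(\<integral>\<^sup>+\<omega>. g \<omega> \<partial>distr (iid N) (iid N') (\<lambda>\<omega> i. f (\<omega> i))) = (\<integral>\<^sup>+\<omega>. g (\<lambda>i. f (\<omega> i)) \<partial>iid N)"
    by (rule nn_integral_distr) auto
  then show ?thesis by (simp add: distr_iid_map[OF N f N'])
qed

lemma AE_iid_nth:
  assumes N: "prob_space N" and "AE x in N. P x"
  shows "AE \<omega> in iid N. \<forall>i. P (\<omega> i)"
  unfolding AE_all_countable using assms by (intro allI AE_PiM_component) auto

section \<open>The exponential distribution\<close>

definition expm :: "real \<Rightarrow> real measure" where
  "expm a = density lborel (exponential_density a)"

lemma sets_expm[simp, measurable_cong]: "sets (expm a) = sets borel"
  by (simp add: expm_def)

lemma space_expm[simp]: "space (expm a) = UNIV"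
  by (simp add: expm_def)

lemma prob_space_expm: "0 < a \<Longrightarrow> prob_space (expm a)"
  unfolding expm_def by (rule prob_space_exponential_density)

lemma distributed_expm: "0 < a \<Longrightarrow> distributed (expm a) lborel (\<lambda>x. x) (exponential_density a)"
  unfolding distributed_def
  by (auto simp: expm_def exponential_density_nonneg intro!: measure_eqI simp: emeasure_distr)

lemma nn_integral_expm:
  "f \<in> borel_measurable borel \<Longrightarrow> (\<integral>\<^sup>+x. f x \<partial>expm a) = (\<integral>\<^sup>+x. ennreal (exponential_density a x) * f x \<partial>lborel)"
  unfolding expm_def by (subst nn_integral_density) auto

lemma AE_expm_pos: "AE x in expm a. 0 < x"
proof -
  have "AE x in lborel. x \<noteq> (0::real)" by (rule AE_lborel_singleton)
  then have "AE x in lborel. 0 < ennreal (exponential_density a x) \<longrightarrow> 0 < x"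
    by eventually_elim (auto simp: exponential_density_def)
  then show ?thesis unfolding expm_def by (subst AE_density) auto
qed

lemma emeasure_expm_greater:
  assumes "0 < a" "0 \<le> x" shows "emeasure (expm a) {x<..} = ennreal (exp (- x * a))"
proof -
  interpret prob_space "expm a" by (rule prob_space_expm) fact
  have "prob {y \<in> space (expm a). x < y} = exp (- x * a)"
    by (rule exponential_distributedD_gt[OF distributed_expm]) (use assms in auto)
  moreover have "{y \<in> space (expm a). x < y} = {x<..}" by auto
  ultimately show ?thesis by (simp add: emeasure_eq_measure)
qed

lemma distr_expm_scale:
  assumes "0 < a" shows "distr (expm 1) (expm a) (\<lambda>x. x / a) = expm a"
proof -
  have "distributed (expm 1) lborel (\<lambda>x. 0 + (1/a) * x)
      (\<lambda>x. ennreal (exponential_density 1 ((x - 0) / (1/a))) / ennreal \<bar>1/a\<bar>)"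
    using assms by (intro prob_space.distributed_affine[OF prob_space_expm distributed_expm]) auto
  then have "distr (expm 1) lborel (\<lambda>x. x / a) =
      density lborel (\<lambda>x. ennreal (exponential_density 1 (x * a)) / ennreal (1 / a))"
    using assms by (auto simp: distributed_def)
  also have "(\<lambda>x. ennreal (exponential_density 1 (x * a)) / ennreal (1 / a)) =
      (\<lambda>x. ennreal (exponential_density a x))"
    using assms by (auto simp: exponential_density_def fun_eq_iff mult_less_0_iff divide_ennreal mult.commute)
  finally have "distr (expm 1) lborel (\<lambda>x. x / a) = expm a" by (simp add: expm_def)
  moreover have "distr (expm 1) lborel (\<lambda>x. x / a) = distr (expm 1) (expm a) (\<lambda>x. x / a)"
    by (rule distr_cong) auto
  ultimately show ?thesis by simp
qed

section \<open>The renewal shift of a Poisson clock\<close>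

abbreviation clock :: "(nat \<Rightarrow> real) measure" where
  "clock \<equiv> iid (expm 1)"

abbreviation seqs :: "(nat \<Rightarrow> real) measure" where
  "seqs \<equiv> iid borel"

lemma prob_space_clock: "prob_space clock"
  by (intro prob_space_iid prob_space_expm) simp

definition ring :: "(nat \<Rightarrow> real) \<Rightarrow> nat \<Rightarrow> real" where
  "ring \<omega> n = (\<Sum>i\<le>n. \<omega> i)"

definition first_ring :: "real \<Rightarrow> (nat \<Rightarrow> real) \<Rightarrow> nat" where
  "first_ring x \<omega> = (LEAST n. x < ring \<omega> n)"

text \<open>The clock seen from time \<open>x\<close>: the first entry is what remains of the
  waiting time in progress, the later ones are untouched. A ring exactly at \<open>x\<close> counts
  as past.\<close>

definition restart :: "real \<Rightarrow> (nat \<Rightarrow> real) \<Rightarrow> nat \<Rightarrow> real" where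
  "restart x \<omega> i = (if i = 0 then ring \<omega> (first_ring x \<omega>) - x else \<omega> (first_ring x \<omega> + i))"

text \<open>An almost sure event on which the rings are strictly increasing and unbounded, so that
  each \<open>LEAST\<close> over rings or jumps below is attained.\<close>

definition good :: "(nat \<Rightarrow> real) \<Rightarrow> bool" where
  "good \<omega> \<longleftrightarrow> (\<forall>i. 0 < \<omega> i) \<and> (\<forall>x. \<exists>n. x < ring \<omega> n)"

lemma ring_0[simp]: "ring \<omega> 0 = \<omega> 0"
  by (simp add: ring_def)

lemma ring_Suc: "ring \<omega> (Suc n) = ring \<omega> n + \<omega> (Suc n)"
  by (simp add: ring_def)

lemma ring_Suc_shift: "ring \<omega> (Suc n) = \<omega> 0 + ring (\<lambda>i. \<omega> (Suc i)) n"
  by (simp only: ring_def sum.atMost_Suc_shift)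

lemma ring_add: "ring \<omega> (Suc n + m) = ring \<omega> n + ring (\<lambda>i. \<omega> (Suc n + i)) m"
  by (induction m) (auto simp: ring_Suc)

lemma ring_strict_mono: "good \<omega> \<Longrightarrow> strict_mono (ring \<omega>)"
  by (rule strict_monoI_Suc) (auto simp: ring_Suc good_def)

lemma ring_less_iff[simp]: "good \<omega> \<Longrightarrow> ring \<omega> m < ring \<omega> n \<longleftrightarrow> m < n"
  using ring_strict_mono[of \<omega>] by (simp add: strict_mono_less)

lemma ring_le_iff[simp]: "good \<omega> \<Longrightarrow> ring \<omega> m \<le> ring \<omega> n \<longleftrightarrow> m \<le> n"
  using ring_strict_mono[of \<omega>] by (simp add: strict_mono_less_eq)

lemma ring_pos: "good \<omega> \<Longrightarrow> 0 < ring \<omega> n"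
  unfolding ring_def good_def by (intro sum_pos) auto

lemma first_ring_le_iff: "good \<omega> \<Longrightarrow> first_ring x \<omega> \<le> n \<longleftrightarrow> x < ring \<omega> n"
proof
  assume g: "good \<omega>"
  then have 1: "x < ring \<omega> (first_ring x \<omega>)"
    unfolding first_ring_def good_def by (auto intro: LeastI_ex)
  { assume "first_ring x \<omega> \<le> n"
    then show "x < ring \<omega> n" using 1 g ring_le_iff less_le_trans by blast }
  assume "x < ring \<omega> n" then show "first_ring x \<omega> \<le> n"
    unfolding first_ring_def by (rule Least_le)
qed

lemma less_first_ring_iff: "good \<omega> \<Longrightarrow> n < first_ring x \<omega> \<longleftrightarrow> ring \<omega> n \<le> x"
  using first_ring_le_iff[of \<omega> x n] by linarith

lemma ring_restart: "ring (restart x \<omega>) n = ring \<omega> (first_ring x \<omega> + n) - x"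
  by (induction n) (auto simp: ring_Suc restart_def)

lemma good_restart:
  assumes "good \<omega>" shows "good (restart x \<omega>)"
  unfolding good_def
proof (intro conjI allI)
  show "0 < restart x \<omega> i" for i
    using assms first_ring_le_iff[OF assms, of x "first_ring x \<omega>"]
    by (auto simp: restart_def good_def)
  show "\<exists>n. y < ring (restart x \<omega>) n" for y
  proof -
    obtain n where "y + x < ring \<omega> n" using assms by (auto simp: good_def)
    also have "\<dots> \<le> ring \<omega> (first_ring x \<omega> + n)" using assms by simp
    finally show ?thesis by (intro exI[of _ n]) (simp add: ring_restart)
  qed
qed

lemma good_tl: assumes "good \<omega>" shows "good (\<lambda>i. \<omega> (Suc i))"
  unfolding good_def
proof (intro conjI allI)
  show "\<exists>n. y < ring (\<lambda>i. \<omega> (Suc i)) n" for y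
  proof -
    obtain n where n: "y + \<omega> 0 < ring \<omega> n" using assms by (auto simp: good_def)
    also have "ring \<omega> n < ring \<omega> (Suc n)" using assms by simp
    finally show ?thesis by (intro exI[of _ n]) (simp add: ring_Suc_shift)
  qed
qed (use assms in \<open>auto simp: good_def\<close>)

lemma measurable_ring[measurable (raw)]:
  assumes [measurable]: "g \<in> measurable M seqs"
  shows "(\<lambda>x. ring (g x) n) \<in> borel_measurable M"
  unfolding ring_def by (rule borel_measurable_sum) (rule measurable_seq_nth[OF assms])

lemma measurable_first_ring[measurable (raw)]:
  assumes [measurable]: "f \<in> borel_measurable M" "g \<in> measurable M seqs"
  shows "(\<lambda>x. first_ring (f x) (g x)) \<in> measurable M (count_space UNIV)"
  unfolding first_ring_def
proof (rule measurable_Least)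
  show "Measurable.pred M (\<lambda>x. f x < ring (g x) i)" for i
    using borel_measurable_pred_less[OF assms(1) measurable_ring[OF assms(2)]] .
qed

lemma measurable_restart[measurable (raw)]:
  assumes [measurable]: "f \<in> borel_measurable M" "g \<in> measurable M seqs"
  shows "(\<lambda>x. restart (f x) (g x)) \<in> measurable M seqs"
proof (rule measurable_seqI)
  fix i
  have [measurable]: "(\<lambda>x. g x j) \<in> borel_measurable M" for j
    by (rule measurable_seq_nth) fact
  have 1: "(\<lambda>x. ring (g x) (first_ring (f x) (g x))) \<in> borel_measurable M"
    by (rule measurable_compose_countable[where f="\<lambda>n x. ring (g x) n"]) measurable
  have 2: "(\<lambda>x. g x (first_ring (f x) (g x) + i)) \<in> borel_measurable M"
    by (rule measurable_compose_countable[where f="\<lambda>n x. g x (n + i)"]) measurable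
  show "(\<lambda>x. restart (f x) (g x) i) \<in> borel_measurable M"
    using 1 2 by (cases "i = 0") (auto simp: restart_def)
qed

section \<open>Chernoff bound and non-explosion of a clock\<close>

lemma nn_integral_exp_neg_expm: "(\<integral>\<^sup>+x. ennreal (exp (- x)) \<partial>expm 1) = ennreal (1/2)"
proof -
  interpret prob_space "expm 2" by (rule prob_space_expm) simp
  define c :: real where "c = 1 / 2"
  have c0: "0 \<le> c" by (simp add: c_def)
  have "(\<integral>\<^sup>+x. ennreal (exp (- x)) \<partial>expm 1) = (\<integral>\<^sup>+x. ennreal (exponential_density 1 x * exp (- x)) \<partial>lborel)"
    by (subst nn_integral_expm) (auto simp: ennreal_mult')
  also have "(\<lambda>x. exponential_density 1 x * exp (- x)) = (\<lambda>x. c * exponential_density 2 x)"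
    by (auto simp: fun_eq_iff exponential_density_def mult_exp_exp c_def)
  also have "(\<integral>\<^sup>+x. ennreal (c * exponential_density 2 x) \<partial>lborel) =
      ennreal c * (\<integral>\<^sup>+x. ennreal (exponential_density 2 x) * 1 \<partial>lborel)"
    using c0 by (simp add: ennreal_mult' nn_integral_cmult)
  also have "(\<integral>\<^sup>+x. ennreal (exponential_density 2 x) * 1 \<partial>lborel) = 1"
    using emeasure_space_1 by (subst nn_integral_expm[symmetric]) auto
  finally show ?thesis by (simp add: c_def)
qed

lemma nn_integral_exp_neg_ring: "(\<integral>\<^sup>+\<omega>. ennreal (exp (- ring \<omega> n)) \<partial>clock) = ennreal ((1/2) ^ Suc n)"
proof (induction n)
  case 0
  show ?case
    using nn_integral_iid_hd[of "expm 1" "\<lambda>x. ennreal (exp (- x))"] nn_integral_exp_neg_expm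
    by (simp add: prob_space_expm)
next
  case (Suc n)
  have "(\<integral>\<^sup>+\<omega>. ennreal (exp (- ring \<omega> (Suc n))) \<partial>clock) =
    (\<integral>\<^sup>+x. \<integral>\<^sup>+\<omega>. ennreal (exp (- x)) * ennreal (exp (- ring \<omega> n)) \<partial>clock \<partial>expm 1)"
    by (subst nn_integral_iid_peel)
       (auto simp: prob_space_expm ring_Suc_shift ennreal_mult'[symmetric] mult_exp_exp)
  also have "\<dots> = ennreal (1/2) * ennreal ((1/2) ^ Suc n)"
    using Suc by (simp add: nn_integral_cmult nn_integral_multc nn_integral_exp_neg_expm)
  also have "\<dots> = ennreal ((1/2) ^ Suc (Suc n))"
    by (subst ennreal_mult'[symmetric]) auto
  finally show ?case .
qed

text \<open>Markov's inequality for \<open>exp (- ring \<omega> n)\<close>, whose mean is a product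
  of Laplace transforms at \<open>1\<close>, each equal to \<open>1/2\<close>. The bound is crude in
  \<open>t\<close> but geometric in \<open>n\<close>, which is enough for non-explosion and later
  for an integrable majorant.\<close>

lemma emeasure_ring_le:
  "emeasure clock {\<omega>\<in>space clock. ring \<omega> n \<le> t} \<le> ennreal (exp t * (1/2) ^ Suc n)"
proof -
  have "emeasure clock {\<omega>\<in>space clock. ring \<omega> n \<le> t} =
      (\<integral>\<^sup>+\<omega>. indicator {\<omega>\<in>space clock. ring \<omega> n \<le> t} \<omega> \<partial>clock)" by simp
  also have "\<dots> \<le> (\<integral>\<^sup>+\<omega>. ennreal (exp t) * ennreal (exp (- ring \<omega> n)) \<partial>clock)"
    by (intro nn_integral_mono)
       (auto simp: indicator_def ennreal_mult'[symmetric] mult_exp_exp)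
  also have "\<dots> = ennreal (exp t) * ennreal ((1/2) ^ Suc n)"
    by (simp add: nn_integral_cmult nn_integral_exp_neg_ring)
  also have "\<dots> = ennreal (exp t * (1/2) ^ Suc n)" by (subst ennreal_mult') auto
  finally show ?thesis .
qed

lemma AE_clock_good: "AE \<omega> in clock. good \<omega>"
proof -
  have "AE \<omega> in clock. \<exists>n. real k < ring \<omega> n" for k :: nat
  proof (rule AE_I)
    show "{\<omega> \<in> space clock. \<not> (\<exists>n. real k < ring \<omega> n)} \<subseteq> {\<omega> \<in> space clock. \<forall>n. ring \<omega> n \<le> real k}"
      by (auto simp: not_less)
    show "{\<omega> \<in> space clock. \<forall>n. ring \<omega> n \<le> real k} \<in> sets clock" by measurable
    have le: "emeasure clock {\<omega> \<in> space clock. \<forall>n. ring \<omega> n \<le> real k} \<le> ennreal (exp k * (1/2) ^ Suc n)" for n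
      by (rule order_trans[OF emeasure_mono emeasure_ring_le]) auto
    have "(\<lambda>n. ennreal (exp k * (1/2) ^ Suc n)) \<longlonglongrightarrow> ennreal (exp k * 0)"
      by (intro tendsto_ennrealI tendsto_mult tendsto_const LIMSEQ_Suc LIMSEQ_realpow_zero) auto
    from LIMSEQ_le_const[OF this] le
    show "emeasure clock {\<omega> \<in> space clock. \<forall>n. ring \<omega> n \<le> real k} = 0" by auto
  qed
  then have "AE \<omega> in clock. \<forall>k::nat. \<exists>n. real k < ring \<omega> n" by (simp add: AE_all_countable)
  moreover have "AE \<omega> in clock. \<forall>i. 0 < \<omega> i"
    by (intro AE_iid_nth AE_expm_pos prob_space_expm) simp
  ultimately show ?thesis
  proof eventually_elim
    case (elim \<omega>)
    show ?case unfolding good_def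
      by (metis elim less_trans reals_Archimedean2)
  qed
qed

lemma nn_integral_expm_memoryless:
  assumes x: "0 \<le> x" and g[measurable]: "g \<in> borel_measurable borel"
  shows "(\<integral>\<^sup>+w. indicator {x<..} w * g (w - x) \<partial>expm 1) = ennreal (exp (- x)) * (\<integral>\<^sup>+w. g w \<partial>expm 1)"
proof -
  have "(\<integral>\<^sup>+w. indicator {x<..} w * g (w - x) \<partial>expm 1) =
      (\<integral>\<^sup>+w. ennreal (exponential_density 1 w) * (indicator {x<..} w * g (w - x)) \<partial>lborel)"
    by (rule nn_integral_expm) auto
  also have "\<dots> = (\<integral>\<^sup>+w. ennreal (exponential_density 1 (x + w)) * (indicator {x<..} (x + w) * g (x + w - x)) \<partial>lborel)"
    by (subst nn_integral_real_affine[of _ 1 x]) auto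
  also have "\<dots> = (\<integral>\<^sup>+w. ennreal (exp (- x)) * (ennreal (exponential_density 1 w) * g w) \<partial>lborel)"
  proof (rule nn_integral_cong_AE)
    \<comment> \<open>At \<open>w = 0\<close> the two sides may differ: the half-line is open while
      the density does not vanish there.\<close>
    have "AE w in lborel. w \<noteq> (0::real)" by (rule AE_lborel_singleton)
    then show "AE w in lborel. ennreal (exponential_density 1 (x + w)) * (indicator {x<..} (x + w) * g (x + w - x)) =
      ennreal (exp (- x)) * (ennreal (exponential_density 1 w) * g w)"
    proof eventually_elim
      case (elim w)
      have e: "ennreal (exp (- (x + w))) = ennreal (exp (- x)) * ennreal (exp (- w))"
        by (simp add: mult_exp_exp flip: ennreal_mult)
      show ?case
      proof (cases "w < 0")
        case False
        with elim have "0 < w" by simp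
        with x e show ?thesis by (simp add: exponential_density_def mult.assoc)
      qed (simp add: exponential_density_def)
    qed
  qed
  also have "\<dots> = ennreal (exp (- x)) * (\<integral>\<^sup>+w. g w \<partial>expm 1)"
    by (subst nn_integral_expm) (auto simp: nn_integral_cmult)
  finally show ?thesis .
qed

text \<open>Inspecting only the first \<open>n\<close> rings preserves the law of the clock exactly, which follows by
  induction from memorylessness; almost surely the restarted clock is such a truncation for large \<open>n\<close>.\<close>

primrec restart_trunc :: "nat \<Rightarrow> real \<Rightarrow> (nat \<Rightarrow> real) \<Rightarrow> nat \<Rightarrow> real" where
  "restart_trunc 0 x \<omega> = \<omega>"
| "restart_trunc (Suc n) x \<omega> = (if x < \<omega> 0 then case_nat (\<omega> 0 - x) (\<lambda>i. \<omega> (Suc i))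
     else restart_trunc n (x - \<omega> 0) (\<lambda>i. \<omega> (Suc i)))"

lemma measurable_restart_trunc[measurable (raw)]:
  assumes "f \<in> borel_measurable M" "g \<in> measurable M seqs"
  shows "(\<lambda>x. restart_trunc n (f x) (g x)) \<in> measurable M seqs"
  using assms
proof (induction n arbitrary: f g)
  case (Suc n)
  note [measurable] = Suc.prems
  have [measurable]: "(\<lambda>x. g x 0) \<in> borel_measurable M"
    by (rule measurable_seq_nth) fact
  have [measurable]: "(\<lambda>x. restart_trunc n (f x - g x 0) (\<lambda>i. g x (Suc i))) \<in> measurable M seqs"
    by (rule Suc.IH) measurable
  show ?case by simp
qed simp

lemma restart_trunc_eq:
  assumes "good \<omega>" "0 \<le> x" "x < ring \<omega> n"
  shows "restart_trunc (Suc n) x \<omega> = restart x \<omega>"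
  using assms
proof (induction n arbitrary: x \<omega>)
  case 0
  then have "first_ring x \<omega> = 0" using first_ring_le_iff[of \<omega> x 0] by simp
  with 0 show ?case by (auto simp: restart_def fun_eq_iff split: nat.split)
next
  case (Suc n)
  let ?t = "\<lambda>i. \<omega> (Suc i)"
  show ?case
  proof (cases "x < \<omega> 0")
    case True
    then have "first_ring x \<omega> = 0" using first_ring_le_iff[of \<omega> x 0] Suc.prems by simp
    with True show ?thesis by (auto simp: restart_def fun_eq_iff split: nat.split)
  next
    case False
    have g: "good ?t" using Suc.prems good_tl by blast
    have "first_ring x \<omega> = Suc (first_ring (x - \<omega> 0) ?t)"
    proof (rule antisym)
      show "first_ring x \<omega> \<le> Suc (first_ring (x - \<omega> 0) ?t)"
        using first_ring_le_iff[OF g, of "x - \<omega> 0" "first_ring (x - \<omega> 0) ?t"] Suc.prems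
        by (subst first_ring_le_iff) (auto simp: ring_Suc_shift)
      have "first_ring x \<omega> \<noteq> 0" using first_ring_le_iff[of \<omega> x 0] Suc.prems False by auto
      then obtain k where k: "first_ring x \<omega> = Suc k" by (cases "first_ring x \<omega>") auto
      with first_ring_le_iff[of \<omega> x "Suc k"] Suc.prems have "x < ring \<omega> (Suc k)" by auto
      then have "first_ring (x - \<omega> 0) ?t \<le> k"
        by (subst first_ring_le_iff[OF g]) (auto simp: ring_Suc_shift)
      then show "Suc (first_ring (x - \<omega> 0) ?t) \<le> first_ring x \<omega>" by (simp add: k)
    qed
    then have "restart x \<omega> = restart (x - \<omega> 0) ?t"
      by (auto simp: restart_def fun_eq_iff ring_Suc_shift)
    moreover have "restart_trunc (Suc n) (x - \<omega> 0) ?t = restart (x - \<omega> 0) ?t"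
      by (rule Suc.IH) (use g Suc.prems False in \<open>auto simp: ring_Suc_shift\<close>)
    ultimately show ?thesis using False
      by (simp only: restart_trunc.simps(2)[of "Suc n"]) simp
  qed
qed

lemma nn_integral_restart_trunc:
  assumes f: "f \<in> borel_measurable seqs" and x: "0 \<le> x"
  shows "(\<integral>\<^sup>+\<omega>. f (restart_trunc n x \<omega>) \<partial>clock) = (\<integral>\<^sup>+\<omega>. f \<omega> \<partial>clock)"
  using x
proof (induction n arbitrary: x)
  case (Suc n)
  note [measurable] = f
  interpret C: prob_space clock by (rule prob_space_clock)
  interpret E: prob_space "expm 1" by (rule prob_space_expm) simp
  let ?c = "\<integral>\<^sup>+\<omega>. f \<omega> \<partial>clock"
  define g where "g w = (\<integral>\<^sup>+\<omega>. f (case_nat w \<omega>) \<partial>clock)" for w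
  have [measurable]: "g \<in> borel_measurable borel" unfolding g_def by measurable
  have int_g: "(\<integral>\<^sup>+w. g w \<partial>expm 1) = ?c"
    unfolding g_def by (subst nn_integral_iid_peel[symmetric]) (auto simp: prob_space_expm)
  have "(\<integral>\<^sup>+\<omega>. f (restart_trunc (Suc n) x \<omega>) \<partial>clock) =
    (\<integral>\<^sup>+w. \<integral>\<^sup>+\<omega>. f (restart_trunc (Suc n) x (case_nat w \<omega>)) \<partial>clock \<partial>expm 1)"
    by (rule nn_integral_iid_peel) (auto simp: prob_space_expm)
  \<comment> \<open>If \<open>w\<close> exceeds \<open>x\<close>, memorylessness applies to
    \<open>w - x\<close>; otherwise the tail is a fresh clock to be restarted at the remaining time
    \<open>x - w\<close>, which is the induction hypothesis.\<close>
  also have "\<dots> = (\<integral>\<^sup>+w. indicator {x<..} w * g (w - x) + indicator {..x} w * ?c \<partial>expm 1)"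
  proof (rule nn_integral_cong)
    fix w
    show "(\<integral>\<^sup>+\<omega>. f (restart_trunc (Suc n) x (case_nat w \<omega>)) \<partial>clock) =
      indicator {x<..} w * g (w - x) + indicator {..x} w * ?c"
    proof (cases "x < w")
      case False
      then have "(\<integral>\<^sup>+\<omega>. f (restart_trunc n (x - w) \<omega>) \<partial>clock) = ?c" by (intro Suc.IH) simp
      with False show ?thesis by simp
    qed (simp add: g_def)
  qed
  also have "\<dots> = ennreal (exp (- x)) * ?c + emeasure (expm 1) {..x} * ?c"
    using Suc.prems by (subst nn_integral_add) (auto simp: nn_integral_expm_memoryless int_g nn_integral_multc)
  also have "\<dots> = (emeasure (expm 1) {x<..} + emeasure (expm 1) {..x}) * ?c"
    using Suc.prems by (simp add: emeasure_expm_greater distrib_right)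
  also have "emeasure (expm 1) {x<..} + emeasure (expm 1) {..x} = emeasure (expm 1) ({x<..} \<union> {..x})"
    by (rule plus_emeasure) auto
  also have "{x<..} \<union> {..x} = space (expm 1)" by auto
  finally show ?case by (simp add: E.emeasure_space_1 del: space_expm)
qed simp

theorem distr_restart:
  assumes x: "0 \<le> x" shows "distr clock clock (restart x) = clock"
proof (rule measure_eqI)
  interpret C: prob_space clock by (rule prob_space_clock)
  fix B assume "B \<in> sets (distr clock clock (restart x))"
  then have B[measurable]: "B \<in> sets seqs" and B': "B \<in> sets clock"
    by (simp_all cong: sets_PiM_cong)
  have "(\<lambda>n. \<integral>\<^sup>+\<omega>. indicator B (restart_trunc n x \<omega>) \<partial>clock) \<longlonglongrightarrow> (\<integral>\<^sup>+\<omega>. indicator B (restart x \<omega>) \<partial>clock)"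
  proof (rule nn_integral_dominated_convergence[where w="\<lambda>_. 1"])
    show "AE \<omega> in clock. (\<lambda>n. indicator B (restart_trunc n x \<omega>) :: ennreal) \<longlonglongrightarrow> indicator B (restart x \<omega>)"
      using AE_clock_good
    proof eventually_elim
      case (elim \<omega>)
      then obtain m where m: "x < ring \<omega> m" by (auto simp: good_def)
      have "restart_trunc n x \<omega> = restart x \<omega>" if n: "n \<ge> Suc m" for n
      proof -
        obtain k where k: "n = Suc k" using n by (cases n) auto
        have "x < ring \<omega> k" using m elim n k by (rule_tac less_le_trans[OF m]) simp
        then show ?thesis unfolding k by (intro restart_trunc_eq) (use elim x in auto)
      qed
      then show ?case
        by (intro tendsto_eventually) (auto simp: eventually_sequentially intro!: exI[of _ "Suc m"])
    qed
    show "(\<integral>\<^sup>+x. 1 \<partial>clock) < \<infinity>" by (simp add: C.emeasure_space_1)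
  qed (auto simp: indicator_def)
  moreover have "(\<integral>\<^sup>+\<omega>. indicator B (restart_trunc n x \<omega>) \<partial>clock) = emeasure clock B" for n
    using B' by (subst nn_integral_restart_trunc[OF _ x]) auto
  ultimately have "(\<integral>\<^sup>+\<omega>. indicator B (restart x \<omega>) \<partial>clock) = emeasure clock B"
    by (simp add: LIMSEQ_const_iff)
  moreover have "(\<integral>\<^sup>+\<omega>. indicator B \<omega> \<partial>distr clock clock (restart x)) = (\<integral>\<^sup>+\<omega>. indicator B (restart x \<omega>) \<partial>clock)"
    using B' by (subst nn_integral_distr) auto
  ultimately show "emeasure (distr clock clock (restart x)) B = emeasure clock B"
    using B' by simp
qed simp

section \<open>One particle following another\<close>

text \<open>\<open>s k\<close> is the time of jump number \<open>k\<close> of the particle in front, \<open>c\<close> a time origin for the clock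
  \<open>\<omega>\<close>, and \<open>hops\<close> counts the rings among the first \<open>n\<close> at which the particle jumps.\<close>

primrec hops :: "real \<Rightarrow> (nat \<Rightarrow> real) \<Rightarrow> (nat \<Rightarrow> real) \<Rightarrow> nat \<Rightarrow> nat" where
  "hops c s \<omega> 0 = 0"
| "hops c s \<omega> (Suc n) = hops c s \<omega> n + (if s (hops c s \<omega> n) < c + ring \<omega> n then 1 else 0)"

definition hop_index :: "real \<Rightarrow> (nat \<Rightarrow> real) \<Rightarrow> (nat \<Rightarrow> real) \<Rightarrow> nat \<Rightarrow> nat" where
  "hop_index c s \<omega> k = (LEAST n. k < hops c s \<omega> (Suc n))"

definition hop_time :: "real \<Rightarrow> (nat \<Rightarrow> real) \<Rightarrow> (nat \<Rightarrow> real) \<Rightarrow> nat \<Rightarrow> real" where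
  "hop_time c s \<omega> k = c + ring \<omega> (hop_index c s \<omega> k)"

lemma hops_mono: "m \<le> n \<Longrightarrow> hops c s \<omega> m \<le> hops c s \<omega> n"
  by (induction n rule: dec_induct) auto

text \<open>After exactly \<open>k\<close> jumps the next one is made at the latest at a further
  ring later than \<open>s k\<close>, and a good clock has arbitrarily late rings.\<close>

lemma hops_unbounded:
  assumes "good \<omega>" shows "\<exists>n. k < hops c s \<omega> (Suc n)"
proof (induction k)
  have step: "\<exists>n. k < hops c s \<omega> (Suc n)" if "k \<le> hops c s \<omega> m" for k m
  proof (cases "k < hops c s \<omega> m")
    case True
    then show ?thesis using hops_mono[of m "Suc m" c s \<omega>] by (intro exI[of _ m]) auto
  next
    case False
    with that have k: "hops c s \<omega> m = k" by simp
    obtain n where n: "s k - c < ring \<omega> n" using assms by (auto simp: good_def)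
    define n' where "n' = max m n"
    have n': "s k - c < ring \<omega> n'"
      using n assms by (rule_tac less_le_trans[OF n]) (simp add: n'_def)
    have "k \<le> hops c s \<omega> n'" using hops_mono[of m n' c s \<omega>] k by (simp add: n'_def)
    then show ?thesis using n' by (intro exI[of _ n']) (auto simp: le_less)
  qed
  { case 0 show ?case using step[of 0 0] by simp }
  { case (Suc k) then show ?case using step Suc_leI by blast }
qed

lemma hop_index_le_iff:
  assumes "good \<omega>" shows "hop_index c s \<omega> k \<le> n \<longleftrightarrow> k < hops c s \<omega> (Suc n)"
proof
  have 1: "k < hops c s \<omega> (Suc (hop_index c s \<omega> k))"
    unfolding hop_index_def by (rule LeastI_ex) (rule hops_unbounded[OF assms])
  { assume "hop_index c s \<omega> k \<le> n"
    then show "k < hops c s \<omega> (Suc n)"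
      using hops_mono[of "Suc (hop_index c s \<omega> k)" "Suc n" c s \<omega>] 1 by linarith }
  assume "k < hops c s \<omega> (Suc n)" then show "hop_index c s \<omega> k \<le> n"
    unfolding hop_index_def by (rule Least_le)
qed

lemma hop_index_less_iff:
  assumes "good \<omega>" shows "hop_index c s \<omega> k < n \<longleftrightarrow> k < hops c s \<omega> n"
  using hop_index_le_iff[OF assms, of c s k "n - 1"] by (cases n) auto

lemma hops_before_first:
  assumes "good \<omega>" "n \<le> first_ring (s 0 - c) \<omega>" shows "hops c s \<omega> n = 0"
  using assms(2)
proof (induction n)
  case (Suc n)
  then show ?case using less_first_ring_iff[OF assms(1), of n "s 0 - c"] by auto
qed simp

text \<open>Renewal at the first jump: afterwards the same rule runs with the remaining rings, the
  shifted sequence \<open>s\<close>, and the instant of that jump as the new origin.\<close>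

lemma hops_after_first:
  fixes c :: real and s :: "nat \<Rightarrow> real"
  assumes g: "good \<omega>"
  defines "n0 \<equiv> first_ring (s 0 - c) \<omega>"
  shows "hops c s \<omega> (Suc n0 + m) =
    Suc (hops (c + ring \<omega> n0) (\<lambda>i. s (Suc i)) (\<lambda>i. \<omega> (Suc n0 + i)) m)"
proof (induction m)
  case 0
  have "s 0 - c < ring \<omega> n0" using first_ring_le_iff[OF g, of "s 0 - c" n0] by (simp add: n0_def)
  then show ?case using hops_before_first[OF g, of n0 s c] by (simp add: n0_def)
next
  case (Suc m)
  have "hops c s \<omega> (Suc n0 + Suc m) = hops c s \<omega> (Suc n0 + m) +
      (if s (hops c s \<omega> (Suc n0 + m)) < c + ring \<omega> (Suc n0 + m) then 1 else 0)" by simp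
  then show ?case by (simp only: Suc ring_add) (simp add: add.assoc)
qed

lemma
  fixes c :: real and s :: "nat \<Rightarrow> real"
  assumes g: "good \<omega>"
  defines "n0 \<equiv> first_ring (s 0 - c) \<omega>"
  shows hop_index_0: "hop_index c s \<omega> 0 = n0"
    and hop_index_Suc: "hop_index c s \<omega> (Suc k) =
      Suc n0 + hop_index (c + ring \<omega> n0) (\<lambda>i. s (Suc i)) (\<lambda>i. \<omega> (Suc n0 + i)) k"
proof -
  let ?\<omega>' = "\<lambda>i. \<omega> (Suc n0 + i)" and ?c' = "c + ring \<omega> n0" and ?s' = "\<lambda>i. s (Suc i)"
  have g': "good ?\<omega>'"
    using good_tl[OF good_restart[OF g, of "s 0 - c"]] by (simp add: restart_def n0_def)
  have "hop_index c s \<omega> 0 \<le> n \<longleftrightarrow> n0 \<le> n" for n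
  proof (cases "n0 \<le> n")
    case True
    then have "hops c s \<omega> (Suc n) > 0"
      using hops_after_first[OF g, of c s 0] hops_mono[of "Suc n0" "Suc n" c s \<omega>]
      by (simp add: n0_def del: hops.simps)
    with True show ?thesis by (simp add: hop_index_le_iff[OF g] del: hops.simps)
  next
    case False
    then have "hops c s \<omega> (Suc n) = 0" by (intro hops_before_first[OF g]) (simp add: n0_def)
    with False show ?thesis by (simp add: hop_index_le_iff[OF g] del: hops.simps)
  qed
  then show "hop_index c s \<omega> 0 = n0" by (meson antisym order_refl)
  have "hop_index c s \<omega> (Suc k) \<le> n \<longleftrightarrow> Suc n0 + hop_index ?c' ?s' ?\<omega>' k \<le> n" for n
  proof (cases "Suc n0 \<le> n")
    case True
    then obtain m where m: "n = Suc n0 + m" using le_Suc_ex by blast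
    have "hops c s \<omega> (Suc n) = Suc (hops ?c' ?s' ?\<omega>' (Suc m))"
      using hops_after_first[OF g, of c s "Suc m"] by (simp add: m n0_def)
    then show ?thesis
      by (simp add: hop_index_le_iff[OF g] hop_index_le_iff[OF g', simplified plus_nat.add_Suc] m del: hops.simps)
  next
    case False
    then have "hops c s \<omega> (Suc n) \<le> hops c s \<omega> (Suc n0)" by (intro hops_mono) simp
    also have "\<dots> = 1" using hops_after_first[OF g, of c s 0] by (simp add: n0_def)
    finally show ?thesis using False by (simp add: hop_index_le_iff[OF g] del: hops.simps)
  qed
  then show "hop_index c s \<omega> (Suc k) = Suc n0 + hop_index ?c' ?s' ?\<omega>' k" by (meson antisym order_refl)
qed

text \<open>Last passage times along one row: \<open>s\<close> is the row below, \<open>e\<close>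
  are the weights, and \<open>c\<close> is the entry to the left of the first cell. The row is
  consumed from the left so as to match the renewal at the first jump; \<open>lpp_row_Suc\<close>
  gives the usual recursion at the right end.\<close>

primrec lpp_row :: "nat \<Rightarrow> real \<Rightarrow> (nat \<Rightarrow> real) \<Rightarrow> (nat \<Rightarrow> real) \<Rightarrow> real" where
  "lpp_row 0 c s e = max c (s 0) + e 0"
| "lpp_row (Suc k) c s e = lpp_row k (max c (s 0) + e 0) (\<lambda>i. s (Suc i)) (\<lambda>i. e (Suc i))"

text \<open>The wait from the moment when jump \<open>k\<close> becomes possible to the next ring.
  \<open>max 0\<close> covers the case that the jump is possible at once, where the clock is
  restarted at its origin and not at a negative time.\<close>

primrec residual :: "nat \<Rightarrow> real \<Rightarrow> (nat \<Rightarrow> real) \<Rightarrow> (nat \<Rightarrow> real) \<Rightarrow> real" where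
  "residual 0 c s \<omega> = restart (max 0 (s 0 - c)) \<omega> 0"
| "residual (Suc k) c s \<omega> = residual k (max c (s 0) + restart (max 0 (s 0 - c)) \<omega> 0)
     (\<lambda>i. s (Suc i)) (\<lambda>i. restart (max 0 (s 0 - c)) \<omega> (Suc i))"

lemma first_ring_max_0:
  assumes g: "good \<omega>" shows "first_ring (max 0 x) \<omega> = first_ring x \<omega>"
proof (cases "x \<le> 0")
  case True
  then have "x < ring \<omega> 0" "0 < ring \<omega> 0" using ring_pos[OF g, of 0] by linarith+
  then have "first_ring x \<omega> \<le> 0" "first_ring 0 \<omega> \<le> 0" using g by (simp_all only: first_ring_le_iff)
  then show ?thesis using True by (simp add: max_def)
qed (simp add: max_def)

text \<open>Jump \<open>k\<close> happens at the first ring after it becomes possible, and the wait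
  for that ring is \<open>residual\<close> by construction. The identity is pathwise; probability
  enters only with \<open>distr_residual\<close>.\<close>

lemma hop_time_eq_lpp_row:
  "good \<omega> \<Longrightarrow> hop_time c s \<omega> k = lpp_row k c s (\<lambda>i. residual i c s \<omega>)"
proof (induction k arbitrary: c s \<omega>)
  case (0 c s \<omega>)
  then show ?case by (simp add: hop_time_def hop_index_0 restart_def first_ring_max_0)
next
  case (Suc k c s \<omega>)
  let ?x = "max 0 (s 0 - c)" and ?n = "first_ring (s 0 - c) \<omega>"
  have eq: "first_ring ?x \<omega> = ?n" by (rule first_ring_max_0[OF Suc.prems])
  have r0: "max c (s 0) + restart ?x \<omega> 0 = c + ring \<omega> ?n"
    by (simp add: restart_def eq)
  have r1: "(\<lambda>i. restart ?x \<omega> (Suc i)) = (\<lambda>i. \<omega> (Suc ?n + i))"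
    by (simp add: restart_def eq)
  have g': "good (\<lambda>i. \<omega> (Suc ?n + i))"
    using good_tl[OF good_restart[OF Suc.prems, of ?x]] by (simp add: r1)
  have "hop_time c s \<omega> (Suc k) = hop_time (c + ring \<omega> ?n) (\<lambda>i. s (Suc i)) (\<lambda>i. \<omega> (Suc ?n + i)) k"
    unfolding hop_time_def by (simp only: hop_index_Suc[OF Suc.prems] ring_add add.assoc)
  also have "\<dots> = lpp_row k (c + ring \<omega> ?n) (\<lambda>i. s (Suc i))
      (\<lambda>i. residual i (c + ring \<omega> ?n) (\<lambda>i. s (Suc i)) (\<lambda>i. \<omega> (Suc ?n + i)))"
    by (rule Suc.IH[OF g'])
  also have "\<dots> = lpp_row (Suc k) c s (\<lambda>i. residual i c s \<omega>)"
    by (simp only: lpp_row.simps residual.simps r0 r1)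
  finally show ?case .
qed

lemma measurable_residual:
  assumes "f \<in> borel_measurable M" "h \<in> measurable M seqs" "g \<in> measurable M seqs"
  shows "(\<lambda>x. residual k (f x) (h x) (g x)) \<in> borel_measurable M"
  using assms
proof (induction k arbitrary: f g h)
  case 0
  note [measurable] = 0
  have [measurable]: "(\<lambda>x. h x 0) \<in> borel_measurable M" by (rule measurable_seq_nth) fact
  have "(\<lambda>x. restart (max 0 (h x 0 - f x)) (g x)) \<in> measurable M seqs" by measurable
  then show ?case unfolding residual.simps by (rule measurable_seq_nth)
next
  case (Suc k)
  note [measurable] = Suc.prems
  have [measurable]: "(\<lambda>x. h x 0) \<in> borel_measurable M" by (rule measurable_seq_nth) fact
  have m: "(\<lambda>x. restart (max 0 (h x 0 - f x)) (g x)) \<in> measurable M seqs" by measurable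
  note [measurable] = measurable_seq_nth[OF m, of 0] measurable_seq_tl[OF m]
  show ?case unfolding residual.simps by (rule Suc.IH) measurable
qed

lemma measurable_lpp_row:
  assumes "f \<in> borel_measurable M" "h \<in> measurable M seqs" "g \<in> measurable M seqs"
  shows "(\<lambda>x. lpp_row k (f x) (h x) (g x)) \<in> borel_measurable M"
  using assms
proof (induction k arbitrary: f g h)
  case 0
  have [measurable]: "(\<lambda>x. h x 0) \<in> borel_measurable M" "(\<lambda>x. g x 0) \<in> borel_measurable M"
    by (rule measurable_seq_nth, fact)+
  show ?case using 0 by simp
next
  case (Suc k)
  note [measurable] = Suc.prems
  have [measurable]: "(\<lambda>x. h x 0) \<in> borel_measurable M" "(\<lambda>x. g x 0) \<in> borel_measurable M"
    by (rule measurable_seq_nth, fact)+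
  show ?case unfolding lpp_row.simps by (rule Suc.IH) measurable
qed

lemma measurable_lpp_row_seq[measurable (raw)]:
  assumes "f \<in> borel_measurable M" "h \<in> measurable M seqs" "g \<in> measurable M seqs"
  shows "(\<lambda>x k. lpp_row k (f x) (h x) (g x)) \<in> measurable M seqs"
  by (rule measurable_seqI) (rule measurable_lpp_row[OF assms])

lemma measurable_hops[measurable (raw)]:
  assumes [measurable]: "f \<in> borel_measurable M" "h \<in> measurable M seqs" "g \<in> measurable M seqs"
  shows "(\<lambda>x. hops (f x) (h x) (g x) n) \<in> measurable M (count_space UNIV)"
proof (induction n)
  case (Suc n)
  note [measurable] = Suc
  have [measurable]: "(\<lambda>x. h x i) \<in> borel_measurable M" for i by (rule measurable_seq_nth) fact
  have [measurable]: "(\<lambda>x. h x (hops (f x) (h x) (g x) n)) \<in> borel_measurable M"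
    by (rule measurable_compose_countable[where f="\<lambda>n x. h x n"]) measurable
  show ?case unfolding hops.simps by measurable
qed simp

lemma measurable_hop_time[measurable (raw)]:
  assumes [measurable]: "f \<in> borel_measurable M" "h \<in> measurable M seqs" "g \<in> measurable M seqs"
  shows "(\<lambda>x. hop_time (f x) (h x) (g x)) \<in> measurable M seqs"
proof (rule measurable_seqI)
  fix k
  have [measurable]: "(\<lambda>x. hop_index (f x) (h x) (g x) k) \<in> measurable M (count_space UNIV)"
    unfolding hop_index_def
  proof (rule measurable_Least)
    fix n
    have [measurable]: "(\<lambda>x. hops (f x) (h x) (g x) (Suc n)) \<in> measurable M (count_space UNIV)"
      by (rule measurable_hops) fact+
    show "Measurable.pred M (\<lambda>x. k < hops (f x) (h x) (g x) (Suc n))"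
      by (rule measurable_compose[of "\<lambda>x. hops (f x) (h x) (g x) (Suc n)" M "count_space UNIV" "\<lambda>m. k < m"])
         (fact, simp)
  qed
  have [measurable]: "(\<lambda>x. ring (g x) (hop_index (f x) (h x) (g x) k)) \<in> borel_measurable M"
    by (rule measurable_compose_countable[where f="\<lambda>n x. ring (g x) n"]) measurable
  show "(\<lambda>x. hop_time (f x) (h x) (g x) k) \<in> borel_measurable M"
    unfolding hop_time_def by measurable
qed

lemma measurable_residual_clock: "(\<lambda>\<omega> i. residual i c s \<omega>) \<in> measurable clock clock"
proof (rule measurable_seqI)
  have "(\<lambda>\<omega>. residual i c s \<omega>) \<in> borel_measurable clock" for i
    by (rule measurable_residual) (auto simp: space_PiM)
  then show "(\<lambda>\<omega>. residual i c s \<omega>) \<in> measurable clock (expm 1)" for i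
    by (simp cong: measurable_cong_sets)
qed

text \<open>The residuals are independent although they are read off a single clock: restarting at a
  fixed time preserves the law, the first residual is then the head of a fresh clock, and given that
  head the others are the residuals of the independent tail with a new fixed origin.\<close>

lemma distr_residual: "distr clock clock (\<lambda>\<omega> i. residual i c s \<omega>) = clock"
proof (rule iid_eqI)
  show E: "prob_space (expm 1)" by (rule prob_space_expm) simp
  interpret E: prob_space "expm 1" by fact
  have s: "(\<lambda>_. s) \<in> measurable N seqs" for s :: "nat \<Rightarrow> real" and N :: "(nat \<Rightarrow> real) measure"
    by (simp add: space_PiM)
  have res: "(\<lambda>\<omega> i. residual i c s \<omega>) \<in> measurable clock clock" for c s
    by (rule measurable_residual_clock)
  fix m and A :: "nat \<Rightarrow> real set" assume A: "\<And>i. A i \<in> sets (expm 1)"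
  have "(\<integral>\<^sup>+\<omega>. (\<Prod>i<m. indicator (A i) (residual i c s \<omega>)) \<partial>clock) = (\<Prod>i<m. emeasure (expm 1) (A i))"
    using A
  proof (induction m arbitrary: c s A)
    case 0
    interpret C: prob_space clock by (rule prob_space_clock)
    show ?case by (simp add: C.emeasure_space_1)
  next
    case (Suc m)
    then have A'[measurable]: "A i \<in> sets borel" for i by simp
    let ?x = "max 0 (s 0 - c)" and ?s = "\<lambda>i. s (Suc i)"
    define h where "h \<eta> = (indicator (A 0) (\<eta> 0) *
      (\<Prod>i<m. indicator (A (Suc i)) (residual i (max c (s 0) + \<eta> 0) ?s (\<lambda>i. \<eta> (Suc i)))) :: ennreal)"
      for \<eta> :: "nat \<Rightarrow> real"
    have r[measurable]: "(\<lambda>\<eta>. residual i (max c (s 0) + \<eta> 0) ?s (\<lambda>i. \<eta> (Suc i))) \<in> borel_measurable seqs" for i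
      by (rule measurable_residual) (auto simp: s)
    have h[measurable]: "h \<in> borel_measurable seqs" unfolding h_def by measurable
    have "(\<integral>\<^sup>+\<omega>. (\<Prod>i<Suc m. indicator (A i) (residual i c s \<omega>)) \<partial>clock) = (\<integral>\<^sup>+\<omega>. h (restart ?x \<omega>) \<partial>clock)"
      by (simp add: h_def prod.lessThan_Suc_shift del: prod.lessThan_Suc)
    also have "\<dots> = (\<integral>\<^sup>+\<omega>. h \<omega> \<partial>distr clock clock (restart ?x))"
      by (subst nn_integral_distr) auto
    also have "\<dots> = (\<integral>\<^sup>+\<omega>. h \<omega> \<partial>clock)" by (subst distr_restart) auto
    also have "\<dots> = (\<integral>\<^sup>+w. \<integral>\<^sup>+\<omega>. h (case_nat w \<omega>) \<partial>clock \<partial>expm 1)"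
      by (rule nn_integral_iid_peel[OF E]) simp
    also have "\<dots> = (\<integral>\<^sup>+w. indicator (A 0) w * (\<Prod>i<m. emeasure (expm 1) (A (Suc i))) \<partial>expm 1)"
    proof (rule nn_integral_cong)
      fix w
      have [measurable]: "(\<lambda>\<omega>. residual i (max c (s 0) + w) ?s \<omega>) \<in> borel_measurable clock" for i
        by (rule measurable_residual) (auto simp: s)
      show "(\<integral>\<^sup>+\<omega>. h (case_nat w \<omega>) \<partial>clock) = indicator (A 0) w * (\<Prod>i<m. emeasure (expm 1) (A (Suc i)))"
        using Suc.IH[of "\<lambda>i. A (Suc i)" "max c (s 0) + w" ?s] Suc.prems
        by (simp add: h_def nn_integral_cmult)
    qed
    also have "\<dots> = (\<Prod>i<Suc m. emeasure (expm 1) (A i))"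
      by (simp add: nn_integral_multc prod.lessThan_Suc_shift del: prod.lessThan_Suc)
    finally show ?case .
  qed
  moreover have "(\<lambda>\<omega>. \<Prod>i<m. indicator (A i) (\<omega> i) :: ennreal) \<in> borel_measurable clock"
    using A by measurable
  ultimately show "(\<integral>\<^sup>+\<omega>. (\<Prod>i<m. indicator (A i) (\<omega> i)) \<partial>distr clock clock (\<lambda>\<omega> i. residual i c s \<omega>)) =
    (\<Prod>i<m. emeasure (expm 1) (A i))"
    by (subst nn_integral_distr[OF res]) (simp_all cong: measurable_cong_sets)
qed simp

lemma nn_integral_hop_time:
  assumes f[measurable]: "f \<in> borel_measurable seqs"
  shows "(\<integral>\<^sup>+\<omega>. f (hop_time c s \<omega>) \<partial>clock) = (\<integral>\<^sup>+e. f (\<lambda>k. lpp_row k c s e) \<partial>clock)"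
proof -
  have s: "(\<lambda>_. s) \<in> measurable N seqs" for s :: "nat \<Rightarrow> real" and N :: "(nat \<Rightarrow> real) measure"
    by (simp add: space_PiM)
  note res = measurable_residual_clock[of c s]
  have [measurable]: "(\<lambda>e k. lpp_row k c s e) \<in> measurable seqs seqs"
    by (rule measurable_lpp_row_seq) (auto simp: s)
  have "(\<integral>\<^sup>+\<omega>. f (hop_time c s \<omega>) \<partial>clock) = (\<integral>\<^sup>+\<omega>. f (\<lambda>k. lpp_row k c s (\<lambda>i. residual i c s \<omega>)) \<partial>clock)"
    using AE_clock_good
  proof (intro nn_integral_cong_AE, eventually_elim)
    case (elim \<omega>)
    have "hop_time c s \<omega> = (\<lambda>k. lpp_row k c s (\<lambda>i. residual i c s \<omega>))"
      by (rule ext) (rule hop_time_eq_lpp_row[OF elim(2)])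
    then show ?case by simp
  qed
  also have "\<dots> = (\<integral>\<^sup>+e. f (\<lambda>k. lpp_row k c s e) \<partial>distr clock clock (\<lambda>\<omega> i. residual i c s \<omega>))"
    by (subst nn_integral_distr[OF res]) auto
  finally show ?thesis by (simp add: distr_residual)
qed

section \<open>From particle jumps to last passage percolation\<close>

abbreviation grid :: "(nat \<Rightarrow> nat \<Rightarrow> real) measure" where
  "grid \<equiv> iid clock"

lemma measurable_clock[simp]: "measurable M clock = measurable M seqs"
  by (intro measurable_cong_sets sets_PiM_cong refl) simp_all

lemma prob_space_grid: "prob_space grid"
  by (intro prob_space_iid prob_space_clock)

section \<open>Chains of rows driven by independent inputs\<close>

primrec rows :: "('s \<Rightarrow> 'w \<Rightarrow> 's) \<Rightarrow> 's \<Rightarrow> (nat \<Rightarrow> 'w) \<Rightarrow> nat \<Rightarrow> 's" where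
  "rows F s w 0 = s"
| "rows F s w (Suc r) = F (rows F s w r) (w r)"

lemma rows_Suc_shift: "rows F s w (Suc r) = rows F (F s (w 0)) (\<lambda>i. w (Suc i)) r"
  by (induction r) auto

lemma measurable_rows:
  assumes F: "\<And>(M :: 'm measure) f g. f \<in> measurable M S \<Longrightarrow> g \<in> measurable M N \<Longrightarrow> (\<lambda>x. F (f x) (g x)) \<in> measurable M S"
    and f: "f \<in> measurable (M :: 'm measure) S" and g: "g \<in> measurable M (iid N)"
  shows "(\<lambda>x. rows F (f x) (g x) r) \<in> measurable M S"
proof (induction r)
  case (Suc r)
  then show ?case unfolding rows.simps by (rule F) (rule measurable_seq_nth[OF g])
qed (use f in simp)

text \<open>Two Markov chains with the same transition law have the same law of consecutive states;
  induction peels off the first input, for all initial states at once. Separate test functions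
  \<open>h\<close> and \<open>h'\<close> allow the last transition to be integrated in two ways.
  Measurability of \<open>F'\<close> is assumed twice because a hypothesis fixes the type of its
  source space.\<close>

lemma nn_integral_rows:
  fixes F F' :: "'s \<Rightarrow> 'w \<Rightarrow> 's"
  assumes N: "prob_space N"
    and F: "\<And>(M :: (nat \<Rightarrow> 'w) measure) f g. f \<in> measurable M S \<Longrightarrow> g \<in> measurable M N \<Longrightarrow> (\<lambda>x. F (f x) (g x)) \<in> measurable M S"
    and F': "\<And>(M :: (nat \<Rightarrow> 'w) measure) f g. f \<in> measurable M S \<Longrightarrow> g \<in> measurable M N \<Longrightarrow> (\<lambda>x. F' (f x) (g x)) \<in> measurable M S"
    and F'2: "\<And>(M :: ('s \<times> (nat \<Rightarrow> 'w)) measure) f g. f \<in> measurable M S \<Longrightarrow> g \<in> measurable M N \<Longrightarrow> (\<lambda>x. F' (f x) (g x)) \<in> measurable M S"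
    and eq: "\<And>s f. s \<in> space S \<Longrightarrow> f \<in> borel_measurable S \<Longrightarrow> (\<integral>\<^sup>+\<omega>. f (F s \<omega>) \<partial>N) = (\<integral>\<^sup>+\<omega>. f (F' s \<omega>) \<partial>N)"
    and h: "(\<lambda>(a, b). h a b) \<in> borel_measurable (S \<Otimes>\<^sub>M S)"
    and h': "(\<lambda>(a, b). h' a b) \<in> borel_measurable (S \<Otimes>\<^sub>M S)"
    and hh': "\<And>s. s \<in> space S \<Longrightarrow> (\<integral>\<^sup>+\<omega>. h s (F s \<omega>) \<partial>N) = (\<integral>\<^sup>+\<omega>. h' s (F' s \<omega>) \<partial>N)"
    and s: "s \<in> space S"
  shows "(\<integral>\<^sup>+w. h (rows F s w r) (rows F s w (Suc r)) \<partial>iid N) =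
    (\<integral>\<^sup>+w. h' (rows F' s w r) (rows F' s w (Suc r)) \<partial>iid N)"
  using s
proof (induction r arbitrary: s)
  case (0 s)
  interpret N: prob_space N by fact
  interpret I: prob_space "iid N" using prob_space_iid[OF N] .
  have sm: "(\<lambda>_. s) \<in> measurable M S" for M :: "(nat \<Rightarrow> 'w) measure" using 0 by simp
  have w0: "(\<lambda>w. w 0) \<in> measurable (iid N) N" by simp
  have m: "(\<lambda>w. h s (F s (w 0))) \<in> borel_measurable (iid N)"
    using measurable_compose[OF measurable_Pair[OF sm F[OF sm w0]] h] by simp
  have m': "(\<lambda>w. h' s (F' s (w 0))) \<in> borel_measurable (iid N)"
    using measurable_compose[OF measurable_Pair[OF sm F'[OF sm w0]] h'] by simp
  show ?case using hh'[OF 0] m m'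
    by (simp add: nn_integral_iid_peel[OF N] I.emeasure_space_1)
next
  case (Suc r s)
  interpret N: prob_space N by fact
  interpret I: prob_space "iid N" using prob_space_iid[OF N] .
  have sm: "(\<lambda>_. s) \<in> measurable M S" for M :: "(nat \<Rightarrow> 'w) measure" using Suc.prems by simp
  have id: "(\<lambda>w. w) \<in> measurable (iid N) (iid N)" by simp
  have m: "(\<lambda>w. h (rows F s w r) (rows F s w (Suc r))) \<in> borel_measurable (iid N)" for r
    using measurable_compose[OF measurable_Pair[OF measurable_rows[where r=r, OF F sm id] measurable_rows[where r="Suc r", OF F sm id]] h]
    by simp
  have m': "(\<lambda>w. h' (rows F' s w r) (rows F' s w (Suc r))) \<in> borel_measurable (iid N)" for r
    using measurable_compose[OF measurable_Pair[OF measurable_rows[where r=r, OF F' sm id] measurable_rows[where r="Suc r", OF F' sm id]] h']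
    by simp
  have Fs: "F s x \<in> space S" if "x \<in> space N" for x
    using measurable_space[OF F[OF sm measurable_seq_nth[OF id, of 0]], of "\<lambda>_. x"] that by (auto simp: space_PiM)
  have sh: "rows G s (case_nat x w) (Suc n) = rows G (G s x) w n" for G :: "'s \<Rightarrow> 'w \<Rightarrow> 's" and s x w n
    by (subst rows_Suc_shift) simp
  define g where "g s = (\<integral>\<^sup>+w. h' (rows F' s w r) (rows F' s w (Suc r)) \<partial>iid N)" for s
  have g: "g \<in> borel_measurable S"
  proof -
    have 1: "fst \<in> measurable (S \<Otimes>\<^sub>M iid N) S" "snd \<in> measurable (S \<Otimes>\<^sub>M iid N) (iid N)" by simp_all
    have "(\<lambda>x. h' (rows F' (fst x) (snd x) r) (rows F' (fst x) (snd x) (Suc r))) \<in> borel_measurable (S \<Otimes>\<^sub>M iid N)"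
      using measurable_compose[OF measurable_Pair[OF measurable_rows[where r=r, OF F'2 1] measurable_rows[where r="Suc r", OF F'2 1]] h']
      by simp
    then show ?thesis unfolding g_def by (intro I.borel_measurable_nn_integral) (simp add: split_beta')
  qed
  have "(\<integral>\<^sup>+w. h (rows F s w (Suc r)) (rows F s w (Suc (Suc r))) \<partial>iid N) =
    (\<integral>\<^sup>+x. \<integral>\<^sup>+w. h (rows F s (case_nat x w) (Suc r)) (rows F s (case_nat x w) (Suc (Suc r))) \<partial>iid N \<partial>N)"
    by (rule nn_integral_iid_peel[OF N m])
  also have "\<dots> = (\<integral>\<^sup>+x. g (F s x) \<partial>N)"
    unfolding sh g_def by (rule nn_integral_cong) (simp add: Suc.IH Fs del: rows.simps)
  also have "\<dots> = (\<integral>\<^sup>+x. g (F' s x) \<partial>N)" by (rule eq[OF Suc.prems g])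
  also have "\<dots> = (\<integral>\<^sup>+x. \<integral>\<^sup>+w. h' (rows F' s (case_nat x w) (Suc r)) (rows F' s (case_nat x w) (Suc (Suc r))) \<partial>iid N \<partial>N)"
    unfolding sh g_def by simp
  also have "\<dots> = (\<integral>\<^sup>+w. h' (rows F' s w (Suc r)) (rows F' s w (Suc (Suc r))) \<partial>iid N)"
    by (rule nn_integral_iid_peel[OF N m', symmetric])
  finally show ?case .
qed

text \<open>The zero row stands for an absent particle that never blocks. Row \<open>Suc r\<close>
  holds the jump times of particle number \<open>Suc r\<close>, whose clock is
  \<open>w r\<close>.\<close>

abbreviation hop_rows :: "(nat \<Rightarrow> nat \<Rightarrow> real) \<Rightarrow> nat \<Rightarrow> nat \<Rightarrow> real" where
  "hop_rows w \<equiv> rows (hop_time 0) (\<lambda>_. 0) w"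

abbreviation lpp_rows :: "(nat \<Rightarrow> nat \<Rightarrow> real) \<Rightarrow> nat \<Rightarrow> nat \<Rightarrow> real" where
  "lpp_rows e \<equiv> rows (\<lambda>s e k. lpp_row k 0 s e) (\<lambda>_. 0) e"

lemma nn_integral_hop_rows_eq_lpp_rows:
  assumes h: "(\<lambda>(a, b). h a b) \<in> borel_measurable (seqs \<Otimes>\<^sub>M seqs)"
  shows "(\<integral>\<^sup>+w. h (hop_rows w r) (hop_rows w (Suc r)) \<partial>grid) =
    (\<integral>\<^sup>+e. h (lpp_rows e r) (lpp_rows e (Suc r)) \<partial>grid)"
proof (rule nn_integral_rows[OF prob_space_clock _ _ _ _ h h])
  fix s :: "nat \<Rightarrow> real" and f :: "(nat \<Rightarrow> real) \<Rightarrow> ennreal" assume "f \<in> borel_measurable seqs"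
  then show "(\<integral>\<^sup>+\<omega>. f (hop_time 0 s \<omega>) \<partial>clock) = (\<integral>\<^sup>+\<omega>. f (\<lambda>k. lpp_row k 0 s \<omega>) \<partial>clock)"
    by (rule nn_integral_hop_time)
next
  fix s :: "nat \<Rightarrow> real" assume s: "s \<in> space seqs"
  have "(\<lambda>b. h s b) \<in> borel_measurable seqs"
    using measurable_compose[OF measurable_Pair1'[OF s] h] by simp
  then show "(\<integral>\<^sup>+\<omega>. h s (hop_time 0 s \<omega>) \<partial>clock) = (\<integral>\<^sup>+\<omega>. h s (\<lambda>k. lpp_row k 0 s \<omega>) \<partial>clock)"
    by (rule nn_integral_hop_time)
qed (auto simp: space_PiM intro!: measurable_hop_time measurable_lpp_row_seq)

text \<open>In a last passage percolation picture, \<open>slot j s T u\<close> says that cell \<open>j\<close> of the row \<open>T\<close> above the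
  row \<open>s\<close> is a corner at time \<open>u\<close>: both its predecessors are present, the cell itself is not.\<close>

definition slot :: "nat \<Rightarrow> (nat \<Rightarrow> real) \<Rightarrow> (nat \<Rightarrow> real) \<Rightarrow> real \<Rightarrow> ennreal" where
  "slot j s T u = (if max (case_nat 0 T j) (s j) \<le> u \<and> u < T j then 1 else 0)"

text \<open>Almost surely a row has at most one corner at a time, so this is the probability that
  particle number \<open>Suc r\<close> is active. It is also the rate at which row
  \<open>Suc r\<close> gains cells, since a corner is filled at rate one.\<close>

definition corner_rate :: "nat \<Rightarrow> real \<Rightarrow> ennreal" where
  "corner_rate r u = (\<integral>\<^sup>+e. (\<Sum>j. slot j (lpp_rows e r) (lpp_rows e (Suc r)) u) \<partial>grid)"

text \<open>The hazard rate of the unit exponential is one: the expected time spent waiting before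
  \<open>t\<close> equals the probability that the wait ends before \<open>t\<close>. Both sides are
  the integral of \<open>exp (- (u - m))\<close> over \<open>u\<close> from \<open>m\<close> to
  \<open>t\<close>.\<close>

lemma nn_integral_slot_expm:
  "(\<integral>\<^sup>+w. \<integral>\<^sup>+u. (if u \<le> t \<and> m \<le> u \<and> u < m + w then 1 else 0) \<partial>lborel \<partial>expm 1) =
    (\<integral>\<^sup>+w. (if m + w \<le> t then 1 else 0) \<partial>expm 1)"
proof -
  interpret E: prob_space "expm 1" by (rule prob_space_expm) simp
  interpret P: pair_sigma_finite "expm 1" "lborel :: real measure" ..
  have "(\<integral>\<^sup>+w. \<integral>\<^sup>+u. (if u \<le> t \<and> m \<le> u \<and> u < m + w then 1 else 0 :: ennreal) \<partial>lborel \<partial>expm 1) =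
      (\<integral>\<^sup>+u. \<integral>\<^sup>+w. (if u \<le> t \<and> m \<le> u \<and> u < m + w then 1 else 0) \<partial>expm 1 \<partial>lborel)"
    by (rule P.Fubini'[symmetric]) measurable
  also have "\<dots> = (\<integral>\<^sup>+u. ennreal (exponential_density 1 (u - m)) * (if u \<le> t then 1 else 0) \<partial>lborel)"
  proof (rule nn_integral_cong)
    fix u
    show "(\<integral>\<^sup>+w. (if u \<le> t \<and> m \<le> u \<and> u < m + w then 1 else 0 :: ennreal) \<partial>expm 1) =
      ennreal (exponential_density 1 (u - m)) * (if u \<le> t then 1 else 0)"
    proof (cases "u \<le> t \<and> m \<le> u")
      case True
      have "(\<integral>\<^sup>+w. (if u \<le> t \<and> m \<le> u \<and> u < m + w then 1 else 0 :: ennreal) \<partial>expm 1) =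
          (\<integral>\<^sup>+w. indicator {u - m<..} w \<partial>expm 1)"
        using True by (intro nn_integral_cong) (auto simp: indicator_def)
      also have "\<dots> = ennreal (exp (- (u - m) * 1))" using True by (simp add: emeasure_expm_greater)
      finally show ?thesis using True by (simp add: exponential_density_def)
    next
      case False
      then have 0: "(\<lambda>w. if u \<le> t \<and> m \<le> u \<and> u < m + w then 1 else 0 :: ennreal) = (\<lambda>w. 0)" by auto
      show ?thesis unfolding 0 using False by (auto simp: exponential_density_def)
    qed
  qed
  also have "\<dots> = (\<integral>\<^sup>+v. ennreal (exponential_density 1 v) * (if m + v \<le> t then 1 else 0) \<partial>lborel)"
    by (subst nn_integral_real_affine[of _ 1 m]) auto
  also have "\<dots> = (\<integral>\<^sup>+w. (if m + w \<le> t then 1 else 0) \<partial>expm 1)"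
    by (rule nn_integral_expm[symmetric]) simp
  finally show ?thesis .
qed

text \<open>The weight of cell \<open>j\<close> is independent of the moment when the cell becomes a
  corner. The induction integrates out the earlier weights by absorbing each into \<open>c\<close>,
  until \<open>nn_integral_slot_expm\<close> applies.\<close>

lemma nn_integral_slot_lpp_row:
  "(\<integral>\<^sup>+e. \<integral>\<^sup>+u. (if u \<le> t \<and> max (case_nat c (\<lambda>k. lpp_row k c s e) j) (s j) \<le> u \<and> u < lpp_row j c s e then 1 else 0)
      \<partial>lborel \<partial>clock) =
    (\<integral>\<^sup>+e. (if lpp_row j c s e \<le> t then 1 else 0) \<partial>clock)"
proof (induction j arbitrary: c s)
  case (0 c s)
  have E: "prob_space (expm 1)" by (rule prob_space_expm) simp
  have "(\<integral>\<^sup>+e. \<integral>\<^sup>+u. (if u \<le> t \<and> max c (s 0) \<le> u \<and> u < max c (s 0) + e 0 then 1 else 0 :: ennreal) \<partial>lborel \<partial>clock) =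
     (\<integral>\<^sup>+w. \<integral>\<^sup>+u. (if u \<le> t \<and> max c (s 0) \<le> u \<and> u < max c (s 0) + w then 1 else 0) \<partial>lborel \<partial>expm 1)"
    by (rule nn_integral_iid_hd[OF E, of "\<lambda>w. \<integral>\<^sup>+u. (if u \<le> t \<and> max c (s 0) \<le> u \<and> u < max c (s 0) + w then 1 else 0 :: ennreal) \<partial>lborel"]) measurable
  also have "\<dots> = (\<integral>\<^sup>+w. (if max c (s 0) + w \<le> t then 1 else 0) \<partial>expm 1)" by (rule nn_integral_slot_expm)
  also have "\<dots> = (\<integral>\<^sup>+e. (if max c (s 0) + e 0 \<le> t then 1 else 0) \<partial>clock)"
    by (rule nn_integral_iid_hd[OF E, of "\<lambda>w. if max c (s 0) + w \<le> t then 1 else 0", symmetric]) measurable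
  finally show ?case by simp
next
  case (Suc j c s)
  have E: "prob_space (expm 1)" by (rule prob_space_expm) simp
  have row[measurable]: "(\<lambda>e. lpp_row j c s e) \<in> borel_measurable clock" for j c s
    by (rule measurable_lpp_row) (auto simp: space_PiM)
  have [measurable]: "(\<lambda>e. case_nat c (\<lambda>k. lpp_row k c s e) j) \<in> borel_measurable clock" for j c s
    by (cases j) auto
  have prev: "case_nat c (\<lambda>k. lpp_row k c s (case_nat w e)) (Suc j) =
      case_nat (max c (s 0) + w) (\<lambda>k. lpp_row k (max c (s 0) + w) (\<lambda>i. s (Suc i)) e) j" for w e
    by (cases j) auto
  have m: "(\<lambda>e. \<integral>\<^sup>+u. (if u \<le> t \<and> max (case_nat c (\<lambda>k. lpp_row k c s e) j') (s j') \<le> u \<and>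
      u < lpp_row j' c s e then 1 else 0 :: ennreal) \<partial>lborel) \<in> borel_measurable clock"
    "(\<lambda>e. if lpp_row j' c s e \<le> t then 1 else 0 :: ennreal) \<in> borel_measurable clock" for j'
    by measurable
  show ?case unfolding nn_integral_iid_peel[OF E m(1)] nn_integral_iid_peel[OF E m(2)] prev
  proof (rule nn_integral_cong)
    fix w
    show "(\<integral>\<^sup>+\<omega>. \<integral>\<^sup>+u. (if u \<le> t \<and> max (case_nat (max c (s 0) + w)
          (\<lambda>k. lpp_row k (max c (s 0) + w) (\<lambda>i. s (Suc i)) \<omega>) j) (s (Suc j)) \<le> u \<and>
          u < lpp_row (Suc j) c s (case_nat w \<omega>) then 1 else 0) \<partial>lborel \<partial>clock) =
      (\<integral>\<^sup>+\<omega>. (if lpp_row (Suc j) c s (case_nat w \<omega>) \<le> t then 1 else 0) \<partial>clock)"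
      using Suc.IH[of "max c (s 0) + w" "\<lambda>i. s (Suc i)"] by simp
  qed
qed

lemma measurable_slot[measurable (raw)]:
  assumes "f \<in> measurable M seqs" "g \<in> measurable M seqs" and [measurable]: "h \<in> borel_measurable M"
  shows "(\<lambda>x. slot j (f x) (g x) (h x)) \<in> borel_measurable M"
proof -
  note [measurable] = measurable_seq_nth[OF assms(1)] measurable_seq_nth[OF assms(2)]
  have [measurable]: "(\<lambda>x. case_nat 0 (g x) j) \<in> borel_measurable M" by (cases j) auto
  show ?thesis unfolding slot_def by measurable
qed

lemma measurable_lpp_rows[measurable (raw)]:
  assumes "f \<in> measurable M (iid seqs)"
  shows "(\<lambda>x. lpp_rows (f x) r) \<in> measurable M seqs"
  by (rule measurable_rows[where N=seqs]) (auto intro!: measurable_lpp_row_seq assms simp: space_PiM)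

lemma measurable_corner_rate[measurable]: "corner_rate r \<in> borel_measurable borel"
proof -
  interpret prob_space grid by (rule prob_space_grid)
  show ?thesis unfolding corner_rate_def[abs_def] by measurable
qed

text \<open>The compensator identity summed along a row: integrated activity is the expected number
  of filled cells.\<close>

theorem nn_integral_corner_rate:
  "(\<integral>\<^sup>+u. indicator {..t} u * corner_rate r u \<partial>lborel) =
    (\<Sum>j. emeasure grid {e\<in>space grid. lpp_rows e (Suc r) j \<le> t})"
proof -
  interpret prob_space grid by (rule prob_space_grid)
  interpret P: pair_sigma_finite grid "lborel :: real measure" ..
  let ?sl = "\<lambda>j u s T. indicator {..t} u * slot j s T u"
  have "(\<integral>\<^sup>+u. indicator {..t} u * corner_rate r u \<partial>lborel) =
    (\<integral>\<^sup>+u. \<integral>\<^sup>+e. (\<Sum>j. ?sl j u (lpp_rows e r) (lpp_rows e (Suc r))) \<partial>grid \<partial>lborel)"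
    unfolding corner_rate_def by (subst nn_integral_cmult[symmetric]) auto
  also have "\<dots> = (\<integral>\<^sup>+e. \<integral>\<^sup>+u. (\<Sum>j. ?sl j u (lpp_rows e r) (lpp_rows e (Suc r))) \<partial>lborel \<partial>grid)"
    by (rule P.Fubini') measurable
  also have "\<dots> = (\<integral>\<^sup>+e. (\<Sum>j. \<integral>\<^sup>+u. ?sl j u (lpp_rows e r) (lpp_rows e (Suc r)) \<partial>lborel) \<partial>grid)"
  proof (intro nn_integral_cong nn_integral_suminf)
    fix j and a b :: "nat \<Rightarrow> real"
    have "(\<lambda>u. slot j a b u) \<in> borel_measurable lborel"
      by (rule measurable_slot) (auto simp: space_PiM)
    then show "(\<lambda>u. ?sl j u a b) \<in> borel_measurable lborel"
      by (intro borel_measurable_times_ennreal) auto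
  qed
  also have "\<dots> = (\<Sum>j. \<integral>\<^sup>+e. \<integral>\<^sup>+u. ?sl j u (lpp_rows e r) (lpp_rows e (Suc r)) \<partial>lborel \<partial>grid)"
    by (rule nn_integral_suminf) measurable
  also have "\<dots> = (\<Sum>j. \<integral>\<^sup>+e. (if lpp_rows e (Suc r) j \<le> t then 1 else 0) \<partial>grid)"
  proof (rule suminf_cong)
    fix j
    show "(\<integral>\<^sup>+e. \<integral>\<^sup>+u. ?sl j u (lpp_rows e r) (lpp_rows e (Suc r)) \<partial>lborel \<partial>grid) =
      (\<integral>\<^sup>+e. (if lpp_rows e (Suc r) j \<le> t then 1 else 0) \<partial>grid)"
    proof (rule nn_integral_rows[OF prob_space_clock, where S=seqs and h="\<lambda>s T. \<integral>\<^sup>+u. ?sl j u s T \<partial>lborel"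
          and h'="\<lambda>s T. if T j \<le> t then 1 else 0"])
      fix s :: "nat \<Rightarrow> real"
      have "?sl j u s (\<lambda>k. lpp_row k 0 s e) =
         (if u \<le> t \<and> max (case_nat 0 (\<lambda>k. lpp_row k 0 s e) j) (s j) \<le> u \<and> u < lpp_row j 0 s e then 1 else 0)" for u e
        by (auto simp: slot_def indicator_def)
      then show "(\<integral>\<^sup>+\<omega>. \<integral>\<^sup>+u. ?sl j u s (\<lambda>k. lpp_row k 0 s \<omega>) \<partial>lborel \<partial>clock) =
         (\<integral>\<^sup>+\<omega>. (if lpp_row j 0 s \<omega> \<le> t then 1 else 0) \<partial>clock)"
        using nn_integral_slot_lpp_row[of t 0 s j] by simp
    next
      show "(\<lambda>(s, T). \<integral>\<^sup>+u. ?sl j u s T \<partial>lborel) \<in> borel_measurable (seqs \<Otimes>\<^sub>M seqs)" by measurable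
      have [measurable]: "(\<lambda>x. snd x j) \<in> borel_measurable (seqs \<Otimes>\<^sub>M seqs)"
        by (rule measurable_seq_nth) measurable
      show "(\<lambda>(s, T). if T j \<le> t then 1 else 0 :: ennreal) \<in> borel_measurable (seqs \<Otimes>\<^sub>M seqs)"
        unfolding split_beta' by measurable
    qed (auto simp: space_PiM intro!: measurable_lpp_row_seq)
  qed
  also have "\<dots> = (\<Sum>j. emeasure grid {e\<in>space grid. lpp_rows e (Suc r) j \<le> t})"
  proof (rule suminf_cong)
    fix j
    have [measurable]: "(\<lambda>e. lpp_rows e (Suc r) j) \<in> borel_measurable grid"
      by (rule measurable_seq_nth) measurable
    have "(\<integral>\<^sup>+e. (if lpp_rows e (Suc r) j \<le> t then 1 else 0) \<partial>grid) =
      (\<integral>\<^sup>+e. indicator {e\<in>space grid. lpp_rows e (Suc r) j \<le> t} e \<partial>grid)"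
      by (rule nn_integral_cong) (auto simp: indicator_def)
    then show "(\<integral>\<^sup>+e. (if lpp_rows e (Suc r) j \<le> t then 1 else 0) \<partial>grid) =
        emeasure grid {e\<in>space grid. lpp_rows e (Suc r) j \<le> t}"
      by (simp del: rows.simps)
  qed
  finally show ?thesis .
qed

section \<open>Monotonicity of the activity of a particle in time\<close>

text \<open>Rings strictly before \<open>x\<close>, whereas \<open>first_ring\<close> also counts a
  ring at \<open>x\<close>. Both are needed, because a jump requires the particle in front to have
  moved strictly earlier, while positions at a time include the rings at that time.\<close>

definition rings_before :: "real \<Rightarrow> (nat \<Rightarrow> real) \<Rightarrow> nat" where
  "rings_before x \<omega> = (LEAST n. x \<le> ring \<omega> n)"

lemma less_rings_before_iff:
  assumes "good \<omega>" shows "n < rings_before x \<omega> \<longleftrightarrow> ring \<omega> n < x"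
proof -
  obtain m where "x < ring \<omega> m" using assms by (auto simp: good_def)
  then have 1: "x \<le> ring \<omega> (rings_before x \<omega>)"
    unfolding rings_before_def by (rule_tac LeastI[of "\<lambda>n. x \<le> ring \<omega> n" m]) simp
  show ?thesis
  proof
    assume "n < rings_before x \<omega>"
    then show "ring \<omega> n < x" unfolding rings_before_def using not_less_Least by force
  next
    assume "ring \<omega> n < x"
    then have "ring \<omega> n < ring \<omega> (rings_before x \<omega>)" using 1 by simp
    then show "n < rings_before x \<omega>" using assms by simp
  qed
qed

lemma rings_before_eqI:
  assumes "good \<omega>" "\<And>n. ring \<omega> n < x \<longleftrightarrow> n < m" shows "rings_before x \<omega> = m"
  using less_rings_before_iff[OF assms(1), of _ x] assms(2) by (meson nat_neq_iff)

lemma rings_before_mono: "good \<omega> \<Longrightarrow> x \<le> y \<Longrightarrow> rings_before x \<omega> \<le> rings_before y \<omega>"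
  by (rule ccontr) (metis less_rings_before_iff less_le_trans not_le order.asym)

lemma rings_before_nonpos: "good \<omega> \<Longrightarrow> x \<le> 0 \<Longrightarrow> rings_before x \<omega> = 0"
  by (rule rings_before_eqI) (use ring_pos[of \<omega>] in \<open>auto simp: not_less less_imp_le intro: order_trans\<close>)

text \<open>For \<open>x = 0\<close> the identity can fail: a ring exactly at \<open>h\<close> is
  counted by \<open>first_ring h \<omega>\<close> only. Hence the separate treatment of
  \<open>x = 0\<close> in the comparison of queues.\<close>

lemma rings_before_restart:
  assumes "good \<omega>" "0 < x" "0 \<le> h"
  shows "rings_before (x + h) \<omega> = first_ring h \<omega> + rings_before x (restart h \<omega>)"
proof (rule rings_before_eqI[OF assms(1)])
  fix n
  show "ring \<omega> n < x + h \<longleftrightarrow> n < first_ring h \<omega> + rings_before x (restart h \<omega>)"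
  proof (cases "n < first_ring h \<omega>")
    case True
    then show ?thesis using less_first_ring_iff[OF assms(1), of n h] assms by auto
  next
    case False
    then obtain m where m: "n = first_ring h \<omega> + m" by (metis le_add_diff_inverse not_less)
    show ?thesis
      using less_rings_before_iff[OF good_restart[OF assms(1), of h], of m x]
      by (auto simp: m ring_restart)
  qed
qed

lemma rings_before_le_first_ring: "good \<omega> \<Longrightarrow> rings_before h \<omega> \<le> first_ring h \<omega>"
  using first_ring_le_iff[of \<omega> h "first_ring h \<omega>"] less_rings_before_iff[of \<omega> "first_ring h \<omega>" h]
  by (meson le_refl not_le order.asym)

lemma hop_time_less_iff:
  "good \<omega> \<Longrightarrow> hop_time 0 s \<omega> k < x \<longleftrightarrow> k < hops 0 s \<omega> (rings_before x \<omega>)"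
  unfolding hop_time_def using less_rings_before_iff[of \<omega> "hop_index 0 s \<omega> k" x]
  by (simp add: hop_index_less_iff)

text \<open>Each increment of \<open>\<alpha>'\<close> is at most the increment of
  \<open>\<alpha>\<close> over the interval shifted by \<open>h\<close>, written with sums to avoid
  truncated subtraction. Domination of increments, unlike that of counts, passes from arrivals to
  departures.\<close>

definition dominates :: "real \<Rightarrow> (real \<Rightarrow> nat) \<Rightarrow> (real \<Rightarrow> nat) \<Rightarrow> bool" where
  "dominates h \<alpha> \<alpha>' \<longleftrightarrow> mono \<alpha> \<and> \<alpha>' 0 = 0 \<and> (\<forall>x y. 0 \<le> x \<longrightarrow> x \<le> y \<longrightarrow> \<alpha>' y + \<alpha> (x + h) \<le> \<alpha> (y + h) + \<alpha>' x)"

lemma dominatesI_hops: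
  assumes g: "good \<omega>" and h: "0 \<le> h"
    and inc: "\<And>m m'. m \<le> m' \<Longrightarrow> hops 0 s' (restart h \<omega>) m' + hops 0 s \<omega> (first_ring h \<omega> + m)
      \<le> hops 0 s \<omega> (first_ring h \<omega> + m') + hops 0 s' (restart h \<omega>) m"
  shows "dominates h (\<lambda>x. hops 0 s \<omega> (rings_before x \<omega>)) (\<lambda>x. hops 0 s' (restart h \<omega>) (rings_before x (restart h \<omega>)))"
  unfolding dominates_def
proof (intro conjI allI impI)
  let ?\<eta> = "restart h \<omega>"
  show "mono (\<lambda>x. hops 0 s \<omega> (rings_before x \<omega>))"
    by (intro monoI hops_mono rings_before_mono g)
  show "hops 0 s' ?\<eta> (rings_before 0 ?\<eta>) = 0"
    by (simp add: rings_before_nonpos good_restart[OF g])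
  fix x y :: real assume xy: "0 \<le> x" "x \<le> y"
  show "hops 0 s' ?\<eta> (rings_before y ?\<eta>) + hops 0 s \<omega> (rings_before (x + h) \<omega>)
    \<le> hops 0 s \<omega> (rings_before (y + h) \<omega>) + hops 0 s' ?\<eta> (rings_before x ?\<eta>)"
  proof (cases "x = 0")
    case False
    then show ?thesis using xy h inc[OF rings_before_mono[OF good_restart[OF g] xy(2)], of h]
      by (simp add: rings_before_restart[OF g])
  next
    case True
    show ?thesis
    proof (cases "y = 0")
      case False
      have "hops 0 s \<omega> (rings_before h \<omega>) \<le> hops 0 s \<omega> (first_ring h \<omega>)"
        by (intro hops_mono rings_before_le_first_ring g)
      then show ?thesis using True False xy h inc[of 0 "rings_before y ?\<eta>"]
        by (simp add: rings_before_restart[OF g] rings_before_nonpos[OF good_restart[OF g]])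
    qed (use True in simp)
  qed
qed

text \<open>The particle is a server and \<open>\<alpha>\<close>, \<open>\<beta>\<close> count its arrivals (jumps of the particle in front) and its
  departures; primes refer to the copy restarted at time \<open>h\<close> with an empty queue.\<close>

lemma queue_domination:
  assumes g: "good \<omega>" and h: "0 \<le> h" and dom: "dominates h \<alpha> \<alpha>'"
    and s: "\<And>k x. 0 < x \<Longrightarrow> s k < x \<longleftrightarrow> k < \<alpha> x"
    and s': "\<And>k x. 0 < x \<Longrightarrow> s' k < x \<longleftrightarrow> k < \<alpha>' x"
  defines "\<beta> \<equiv> \<lambda>x. hops 0 s \<omega> (rings_before x \<omega>)"
    and "\<beta>' \<equiv> \<lambda>x. hops 0 s' (restart h \<omega>) (rings_before x (restart h \<omega>))"
  shows "dominates h \<beta> \<beta>'" and "\<And>x. 0 \<le> x \<Longrightarrow> \<alpha>' x + \<beta> (x + h) \<le> \<alpha> (x + h) + \<beta>' x"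
proof -
  let ?\<eta> = "restart h \<omega>" and ?n = "first_ring h \<omega>"
  let ?K = "hops 0 s \<omega>" and ?K' = "hops 0 s' ?\<eta>"
  have g': "good ?\<eta>" by (rule good_restart[OF g])
  have mono: "\<alpha> x \<le> \<alpha> y" if "x \<le> y" for x y using dom that by (auto simp: dominates_def mono_def)
  have inc: "\<alpha>' y + \<alpha> (x + h) \<le> \<alpha> (y + h) + \<alpha>' x" if "0 \<le> x" "x \<le> y" for x y
    using dom that by (auto simp: dominates_def)
  have ring0: "0 < ring \<omega> n" "0 < ring ?\<eta> n" for n by (simp_all add: ring_pos g g')
  have K_Suc: "?K (Suc n) = ?K n + (if ?K n < \<alpha> (ring \<omega> n) then 1 else 0)" for n
    using s[OF ring0(1)] by simp
  have K'_Suc: "?K' (Suc n) = ?K' n + (if ?K' n < \<alpha>' (ring ?\<eta> n) then 1 else 0)" for n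
    using s'[OF ring0(2)] by simp
  have K_le: "?K (Suc n) \<le> \<alpha> (ring \<omega> n)" for n
  proof (induction n)
    case (Suc n)
    moreover have "\<alpha> (ring \<omega> n) \<le> \<alpha> (ring \<omega> (Suc n))" by (rule mono) (simp add: g)
    ultimately show ?case using K_Suc[of "Suc n"] by (auto split: if_splits)
  qed (use K_Suc[of 0] in auto)
  have K_n: "?K ?n \<le> \<alpha> h"
  proof (cases ?n)
    case (Suc m)
    then have "ring \<omega> m \<le> h" using less_first_ring_iff[OF g, of m h] by simp
    then show ?thesis using K_le[of m] mono[of "ring \<omega> m" h] Suc by simp
  qed simp
  \<comment> \<open>Queue lengths without subtraction: at time \<open>x\<close>, after the first
    \<open>m\<close> rings of the restarted clock, the restarted queue is at most the original one.
    Initially it is empty, and the other is nonnegative by \<open>K_n\<close>. If a ring serves only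
    the original queue, the restarted one is empty and the original one is not, so the order
    persists.\<close>
  have gap: "\<alpha>' x + ?K (?n + m) \<le> \<alpha> (x + h) + ?K' m"
    if "0 \<le> x" "m = 0 \<or> ring ?\<eta> (m - 1) \<le> x" for x m
    using that
  proof (induction m arbitrary: x)
    case 0
    then show ?case using inc[of 0 x] K_n dom by (simp add: dominates_def)
  next
    case (Suc m)
    let ?y = "ring ?\<eta> m"
    have y: "0 \<le> ?y" "?y \<le> x" using Suc.prems ring0(2)[of m] by auto
    have "m = 0 \<or> ring ?\<eta> (m - 1) \<le> ?y" by (cases m) (auto simp: g')
    from Suc.IH[OF y(1) this] have IH: "\<alpha>' ?y + ?K (?n + m) \<le> \<alpha> (?y + h) + ?K' m" .
    have yh: "?y + h = ring \<omega> (?n + m)" by (simp add: ring_restart)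
    show ?case
      using IH inc[OF y] K_Suc[of "?n + m"] K'_Suc[of m] unfolding yh
      by (simp del: hops.simps split: if_splits)
  qed
  \<comment> \<open>A departure from the restarted queue means that it was nonempty; by
    \<open>gap\<close> the original queue was nonempty too, and the same ring serves it.\<close>
  have step: "?K' (Suc m) + ?K (?n + m) \<le> ?K (?n + Suc m) + ?K' m" for m
  proof -
    have "m = 0 \<or> ring ?\<eta> (m - 1) \<le> ring ?\<eta> m" by (cases m) (auto simp: g')
    from gap[OF less_imp_le[OF ring0(2)] this]
    have "\<alpha>' (ring ?\<eta> m) + ?K (?n + m) \<le> \<alpha> (ring \<omega> (?n + m)) + ?K' m" by (simp add: ring_restart)
    then show ?thesis using K_Suc[of "?n + m"] K'_Suc[of m] by (simp del: hops.simps split: if_splits)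
  qed
  have "?K' m' + ?K (?n + m) \<le> ?K (?n + m') + ?K' m" if "m \<le> m'" for m m'
    using that
  proof (induction m' rule: dec_induct)
    case (step m')
    then show ?case using \<open>\<And>m. ?K' (Suc m) + ?K (?n + m) \<le> ?K (?n + Suc m) + ?K' m\<close>[of m'] by linarith
  qed simp
  then show "dominates h \<beta> \<beta>'" unfolding \<beta>_def \<beta>'_def by (rule dominatesI_hops[OF g h])
  fix x :: real assume x: "0 \<le> x"
  show "\<alpha>' x + \<beta> (x + h) \<le> \<alpha> (x + h) + \<beta>' x"
  proof (cases "x = 0")
    case True
    have "?K (rings_before h \<omega>) \<le> ?K ?n" by (intro hops_mono rings_before_le_first_ring g)
    then show ?thesis using True K_n dom rings_before_nonpos[OF g', of 0]
      by (simp add: \<beta>_def \<beta>'_def dominates_def)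
  next
    case False
    let ?m = "rings_before x ?\<eta>"
    have "?m = 0 \<or> ring ?\<eta> (?m - 1) \<le> x"
      using less_rings_before_iff[OF g', of "?m - 1" x] by (cases ?m) auto
    from gap[OF x this] show ?thesis using False x h
      by (simp add: \<beta>_def \<beta>'_def rings_before_restart[OF g])
  qed
qed

section \<open>Comparison along the tandem of queues\<close>

definition jumps :: "(nat \<Rightarrow> nat \<Rightarrow> real) \<Rightarrow> nat \<Rightarrow> real \<Rightarrow> nat" where
  "jumps w r x = hops 0 (hop_rows w r) (w r) (rings_before x (w r))"

lemma hop_rows_less_iff: "good (w r) \<Longrightarrow> hop_rows w (Suc r) k < x \<longleftrightarrow> k < jumps w r x"
  by (simp add: jumps_def hop_time_less_iff)

lemma hops_free: "good \<omega> \<Longrightarrow> hops 0 (\<lambda>_. 0) \<omega> n = n"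
  by (induction n) (auto simp: ring_pos)

text \<open>Induction along the tandem: the departures of one queue are the arrivals of the next.
  The first server is never idle, so its departures are exactly its rings.\<close>

lemma jumps_dominate:
  assumes g: "\<And>r. good (w r)" and h: "0 \<le> h"
  defines "w' \<equiv> \<lambda>r. restart h (w r)"
  shows "dominates h (jumps w r) (jumps w' r)"
proof (induction r)
  case 0
  have g': "good (w' 0)" using good_restart[OF g] by (simp add: w'_def)
  show ?case
    unfolding jumps_def[abs_def] rows.simps w'_def
    by (rule dominatesI_hops[OF g h]) (simp add: hops_free g good_restart)
next
  case (Suc r)
  have g': "good (w' r)" for r using good_restart[OF g] by (simp add: w'_def)
  have w'r: "restart h (w r) = w' r" for r by (simp add: w'_def)
  show ?case
    using queue_domination(1)[OF g[of "Suc r"] h Suc, of "hop_rows w (Suc r)" "hop_rows w' (Suc r)",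
        OF hop_rows_less_iff[OF g] hop_rows_less_iff[OF g']]
    unfolding w'r jumps_def[of w "Suc r", abs_def] jumps_def[of w' "Suc r", abs_def] .
qed

lemma gap_le:
  assumes g: "\<And>r. good (w r)" and h: "0 \<le> h" and x: "0 \<le> x"
  defines "w' \<equiv> \<lambda>r. restart h (w r)"
  shows "jumps w' r x + jumps w (Suc r) (x + h) \<le> jumps w r (x + h) + jumps w' (Suc r) x"
proof -
  have g': "good (w' r)" for r using good_restart[OF g] by (simp add: w'_def)
  have w'r: "restart h (w r) = w' r" for r by (simp add: w'_def)
  have "dominates h (jumps w r) (jumps w' r)" unfolding w'_def by (rule jumps_dominate[OF g h])
  from queue_domination(2)[OF g[of "Suc r"] h this, of "hop_rows w (Suc r)" "hop_rows w' (Suc r)",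
      OF hop_rows_less_iff[OF g] hop_rows_less_iff[OF g'] x]
  show ?thesis unfolding w'r jumps_def[of w "Suc r"] jumps_def[of w' "Suc r"] .
qed

lemma hop_index_mono: "good \<omega> \<Longrightarrow> k \<le> k' \<Longrightarrow> hop_index c s \<omega> k \<le> hop_index c s \<omega> k'"
  using hop_index_le_iff[of \<omega> c s k' "hop_index c s \<omega> k'"]
  by (subst hop_index_le_iff) auto

lemma hop_time_mono: "good \<omega> \<Longrightarrow> k \<le> k' \<Longrightarrow> hop_time c s \<omega> k \<le> hop_time c s \<omega> k'"
  by (simp add: hop_time_def hop_index_mono)

section \<open>Corners as nonempty queues\<close>

definition has_slot :: "(nat \<Rightarrow> real) \<Rightarrow> (nat \<Rightarrow> real) \<Rightarrow> real \<Rightarrow> bool" where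
  "has_slot s T t \<longleftrightarrow> (\<exists>j. max (case_nat 0 T j) (s j) \<le> t \<and> t < T j)"

text \<open>Cell \<open>j\<close> is a corner only between the consecutive entries
  \<open>j - 1\<close> and \<open>j\<close> of \<open>T\<close>, and these time intervals are
  disjoint.\<close>

lemma suminf_slot:
  assumes T: "mono T" shows "(\<Sum>j. slot j s T t) = (if has_slot s T t then 1 else 0)"
proof (cases "has_slot s T t")
  case True
  then obtain j where j: "max (case_nat 0 T j) (s j) \<le> t" "t < T j" by (auto simp: has_slot_def)
  have "slot i s T t = 0" if "i \<noteq> j" for i
  proof (rule ccontr)
    assume "slot i s T t \<noteq> 0"
    then have i: "max (case_nat 0 T i) (s i) \<le> t" "t < T i" by (auto simp: slot_def split: if_splits)
    have *: False if ab: "max (case_nat 0 T b) (s b) \<le> t" "t < T a" "a < b" for a b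
    proof -
      obtain c where c: "b = Suc c" using ab(3) by (cases b) auto
      then have "T a \<le> T c" using T ab by (auto simp: mono_def)
      then show False using ab c by simp
    qed
    show False using *[OF i(1) j(2)] *[OF j(1) i(2)] that by linarith
  qed
  then have "(\<Sum>j. slot j s T t) = (\<Sum>j\<in>{j}. slot j s T t)"
    by (intro suminf_finite) auto
  then show ?thesis using True j by (simp add: slot_def)
next
  case False
  then have "slot j s T t = 0" for j by (auto simp: has_slot_def slot_def)
  then show ?thesis using False by simp
qed

lemma hop_time_le_iff_less:
  assumes "\<And>n. ring \<omega> n < y \<Longrightarrow> ring \<omega> n \<le> t" "t < y"
  shows "hop_time 0 s \<omega> k \<le> t \<longleftrightarrow> hop_time 0 s \<omega> k < y"
  using assms by (auto simp: hop_time_def)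

text \<open>The only candidate for a corner is cell \<open>b\<close>, the first one not yet
  filled.\<close>

lemma has_slot_iff:
  assumes t: "0 \<le> t" and s: "\<And>k. s k \<le> t \<longleftrightarrow> k < a" and T: "\<And>k. T k \<le> t \<longleftrightarrow> k < b"
  shows "has_slot s T t \<longleftrightarrow> b < (a :: nat)"
proof -
  have "has_slot s T t \<longleftrightarrow> (\<exists>j. (j = 0 \<or> j - 1 < b) \<and> j < a \<and> \<not> j < b)"
    unfolding has_slot_def s[symmetric] T[symmetric]
    by (intro ex_cong1) (auto split: nat.split simp: t not_le)
  also have "\<dots> \<longleftrightarrow> b < a" by (auto intro!: exI[of _ b])
  finally show ?thesis .
qed

text \<open>Corners are defined by jumps up to and including \<open>t\<close>, the comparison of
  queues by jumps strictly before a time. The two agree for \<open>y\<close> when neither clock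
  rings strictly between \<open>t\<close> and \<open>y\<close>.\<close>

lemma has_slot_iff_gap:
  assumes g: "\<And>r. good (w r)" and t: "0 \<le> t"
    and y: "t < y" "\<And>n. ring (w r) n < y \<Longrightarrow> ring (w r) n \<le> t" "\<And>n. ring (w (Suc r)) n < y \<Longrightarrow> ring (w (Suc r)) n \<le> t"
  shows "has_slot (hop_rows w (Suc r)) (hop_rows w (Suc (Suc r))) t \<longleftrightarrow> jumps w (Suc r) y < jumps w r y"
proof -
  have 1: "hop_rows w (Suc r) k \<le> t \<longleftrightarrow> k < jumps w r y" for k
    using hop_time_le_iff_less[OF y(2,1)] hop_rows_less_iff[of w r k y, OF g] by simp
  have 2: "hop_rows w (Suc (Suc r)) k \<le> t \<longleftrightarrow> k < jumps w (Suc r) y" for k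
    using hop_time_le_iff_less[OF y(3,1)] hop_rows_less_iff[of w "Suc r" k y, OF g] by simp
  show ?thesis by (rule has_slot_iff[OF t 1 2])
qed

lemma has_slot_first:
  assumes g: "good (w 0)" and t: "0 \<le> t" shows "has_slot (hop_rows w 0) (hop_rows w (Suc 0)) t"
proof -
  have idx: "hop_index 0 (\<lambda>_. 0) (w 0) k = k" for k
  proof -
    have "hop_index 0 (\<lambda>_. 0) (w 0) k \<le> n \<longleftrightarrow> k \<le> n" for n
      by (simp add: hop_index_le_iff[OF g] hops_free[OF g] less_Suc_eq_le del: hops.simps)
    then show ?thesis by (meson antisym order_refl)
  qed
  \<comment> \<open>Jump \<open>k\<close> of the first particle is ring \<open>k\<close>, so the
    corner is the cell of the next ring.\<close>
  let ?j = "first_ring t (w 0)"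
  have "t < ring (w 0) ?j" using first_ring_le_iff[OF g, of t ?j] by simp
  moreover have "case_nat 0 (hop_time 0 (\<lambda>_. 0) (w 0)) ?j \<le> t"
    using less_first_ring_iff[OF g, of "?j - 1" t] t by (cases ?j) (auto simp: hop_time_def idx)
  ultimately show ?thesis unfolding has_slot_def rows.simps using t
    by (intro exI[of _ ?j]) (simp add: hop_time_def idx)
qed

lemma has_slot_restart:
  assumes g: "\<And>r. good (w r)" and h: "0 \<le> h" and t: "0 \<le> t"
  defines "w' \<equiv> \<lambda>r. restart h (w r)"
  assumes a: "has_slot (hop_rows w' r) (hop_rows w' (Suc r)) t"
  shows "has_slot (hop_rows w r) (hop_rows w (Suc r)) (t + h)"
proof (cases r)
  case 0
  then show ?thesis using has_slot_first[OF g, of "t + h"] t h by simp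
next
  case (Suc p)
  have g': "good (w' r)" for r using good_restart[OF g] by (simp add: w'_def)
  let ?nx = "\<lambda>r. ring (w r) (first_ring (t + h) (w r))"
  \<comment> \<open>No ring of either clock lies strictly between \<open>t + h\<close> and the
    earlier of the two next rings. Shifted back by \<open>h\<close>, this also separates
    \<open>t\<close> from the next rings of the restarted clocks.\<close>
  define y where "y = min (?nx p) (?nx (Suc p)) - h"
  have "t + h < ?nx r" for r using first_ring_le_iff[OF g[of r], of "t + h" "first_ring (t + h) (w r)"] by simp
  from this[of p] this[of "Suc p"] have ty: "t < y" by (simp add: y_def min_def)
  have nx: "ring (w q) n \<le> t + h" if "ring (w q) n < ?nx q" for q n
  proof -
    have "n < first_ring (t + h) (w q)" using that g by simp
    then show ?thesis using less_first_ring_iff[OF g] by simp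
  qed
  have le: "ring (w q) n \<le> t + h" if "ring (w q) n < y + h" "q = p \<or> q = Suc p" for q n
    using that nx[of q n] by (auto simp: y_def)
  have le': "ring (w' q) n \<le> t" if "ring (w' q) n < y" "q = p \<or> q = Suc p" for q n
    using that le[of q "first_ring h (w q) + n"] by (auto simp: w'_def ring_restart)
  have "jumps w' (Suc p) y < jumps w' p y"
    using a has_slot_iff_gap[of w' t y p] g' t ty le' by (simp add: Suc del: rows.simps)
  moreover have "jumps w' p y + jumps w (Suc p) (y + h) \<le> jumps w p (y + h) + jumps w' (Suc p) y"
    unfolding w'_def using ty t by (intro gap_le g h) simp
  ultimately have "jumps w (Suc p) (y + h) < jumps w p (y + h)" by linarith
  then show ?thesis
    using has_slot_iff_gap[of w "t + h" "y + h" p] g t h ty le by (simp add: Suc del: rows.simps)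
qed

lemma measurable_hop_rows[measurable (raw)]:
  assumes "f \<in> measurable M (iid seqs)"
  shows "(\<lambda>x. hop_rows (f x) r) \<in> measurable M seqs"
  by (rule measurable_rows[where N=seqs]) (auto intro!: measurable_hop_time assms simp: space_PiM)

lemma AE_grid_good: "AE w in grid. \<forall>r. good (w r)"
  by (rule AE_iid_nth[OF prob_space_clock AE_clock_good])

lemma corner_rate_hop_rows:
  "corner_rate r t = (\<integral>\<^sup>+w. (if has_slot (hop_rows w r) (hop_rows w (Suc r)) t then 1 else 0) \<partial>grid)"
proof -
  have "corner_rate r t = (\<integral>\<^sup>+w. (\<Sum>j. slot j (hop_rows w r) (hop_rows w (Suc r)) t) \<partial>grid)"
    unfolding corner_rate_def
    by (rule nn_integral_hop_rows_eq_lpp_rows[of "\<lambda>a b. \<Sum>j. slot j a b t", symmetric]) measurable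
  also have "\<dots> = (\<integral>\<^sup>+w. (if has_slot (hop_rows w r) (hop_rows w (Suc r)) t then 1 else 0) \<partial>grid)"
    using AE_grid_good
  proof (intro nn_integral_cong_AE, eventually_elim)
    case (elim w)
    then show ?case by (intro suminf_slot monoI) (auto intro!: hop_time_mono)
  qed
  finally show ?thesis .
qed

theorem corner_rate_mono:
  assumes t: "0 \<le> t" "t \<le> u" shows "corner_rate r t \<le> corner_rate r u"
proof -
  define h where "h = u - t"
  have h: "0 \<le> h" using t by (simp add: h_def)
  have cl: "restart h \<in> measurable clock clock" by simp
  have "corner_rate r t = (\<integral>\<^sup>+w. (\<Sum>j. slot j (hop_rows w r) (hop_rows w (Suc r)) t) \<partial>grid)"
    unfolding corner_rate_def
    by (rule nn_integral_hop_rows_eq_lpp_rows[of "\<lambda>a b. \<Sum>j. slot j a b t", symmetric]) measurable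
  also have "\<dots> = (\<integral>\<^sup>+w. (\<Sum>j. slot j (hop_rows (\<lambda>r. restart h (w r)) r) (hop_rows (\<lambda>r. restart h (w r)) (Suc r)) t) \<partial>grid)"
    by (rule nn_integral_iid_map[OF prob_space_clock cl distr_restart[OF h], symmetric]) measurable
  also have "\<dots> \<le> (\<integral>\<^sup>+w. (if has_slot (hop_rows w r) (hop_rows w (Suc r)) (t + h) then 1 else 0) \<partial>grid)"
    using AE_grid_good
  proof (intro nn_integral_mono_AE, eventually_elim)
    case (elim w)
    have "(\<Sum>j. slot j (hop_rows (\<lambda>r. restart h (w r)) r) (hop_rows (\<lambda>r. restart h (w r)) (Suc r)) t) =
        (if has_slot (hop_rows (\<lambda>r. restart h (w r)) r) (hop_rows (\<lambda>r. restart h (w r)) (Suc r)) t then 1 else 0)"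
      using elim by (intro suminf_slot monoI) (auto intro!: hop_time_mono good_restart)
    also have "\<dots> \<le> (if has_slot (hop_rows w r) (hop_rows w (Suc r)) (t + h) then 1 else 0)"
      using has_slot_restart[of w h t r] elim h t(1) by auto
    finally show ?case .
  qed
  also have "\<dots> = corner_rate r u" by (simp add: corner_rate_hop_rows h_def del: rows.simps)
  finally show ?thesis .
qed

section \<open>The number of active particles\<close>

text \<open>The default values agree: for an infinite set both \<open>infsum\<close> and
  \<open>card\<close> return \<open>0\<close>.\<close>

lemma active_count_card:
  "active_count w t = real (card {k. (\<exists>r\<ge>1. particle_site w r t = k) \<and> \<not> (\<exists>r\<ge>1. particle_site w r t = k + 1)})"
  (is "_ = real (card ?S)")
proof -
  have "active_count w t = infsum (\<lambda>_. 1) ?S"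
    unfolding active_count_def by (rule infsum_cong_neutral) (auto simp: occupied_def)
  also have "\<dots> = real (card ?S)" by (simp only: has_sum_constant_archimedean mult_1_right)
  finally show ?thesis .
qed

lemma ring_time_eq: "ring_time w r n = ring (w r) n"
  by (simp add: ring_time_def ring_def)

lemma card_ring_less: "good \<omega> \<Longrightarrow> card {m. ring \<omega> m < x} = rings_before x \<omega>"
  using card_lessThan[of "rings_before x \<omega>"] by (simp add: less_rings_before_iff[symmetric] lessThan_def)

lemma card_ring_le: "good \<omega> \<Longrightarrow> card {m. ring \<omega> m \<le> x} = first_ring x \<omega>"
  using card_lessThan[of "first_ring x \<omega>"] by (simp add: less_first_ring_iff[symmetric] lessThan_def)

text \<open>Gaps stay nonnegative: a ring leads to a jump only while the particle in front has
  strictly more jumps, and that number never decreases.\<close>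

lemma hops_Suc_le_jumps:
  assumes g: "\<And>r. good (v r)"
  shows "hops 0 (hop_rows v (Suc r)) (v (Suc r)) (Suc n) \<le> jumps v r (ring (v (Suc r)) n)"
proof (induction n)
  case 0
  then show ?case by (simp add: hop_rows_less_iff[OF g] del: rows.simps)
next
  case (Suc n)
  have "jumps v r (ring (v (Suc r)) n) \<le> jumps v r (ring (v (Suc r)) (Suc n))"
    unfolding jumps_def by (intro hops_mono rings_before_mono g) (simp add: g)
  with Suc show ?case
    unfolding hops.simps(2)[of 0 "hop_rows v (Suc r)" "v (Suc r)" "Suc n"]
    by (simp add: hop_rows_less_iff[OF g] del: rows.simps hops.simps)
qed

lemma hops_le_jumps:
  assumes g: "\<And>r. good (v r)"
  shows "hops 0 (hop_rows v (Suc r)) (v (Suc r)) n \<le> jumps v r (ring (v (Suc r)) n)"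
  using hops_Suc_le_jumps[where v=v and r=r and n=n, OF g]
    hops_mono[of n "Suc n" 0 "hop_rows v (Suc r)" "v (Suc r)"] by (simp del: hops.simps rows.simps)

lemma site_after_eq_hops:
  assumes g: "\<And>r. good (w (Suc r))"
  defines "v \<equiv> \<lambda>r. w (Suc r)"
  shows "site_after w (Suc r) n = int (hops 0 (hop_rows v r) (v r) n) - int r"
proof (induction r arbitrary: n)
  case 0
  have "site_after w (Suc 0) n = int n" by (induction n) auto
  then show ?case by (simp add: hops_free g v_def)
next
  case (Suc r)
  note IHr = Suc
  have gv: "good (v r)" for r using g by (simp add: v_def)
  show ?case
  proof (induction n)
    case (Suc n)
    let ?x = "ring (v (Suc r)) n"
    let ?h = "hops 0 (hop_rows v (Suc r)) (v (Suc r))"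
    have c: "card {m. ring_time w (Suc r) m < ring_time w (Suc (Suc r)) n} = rings_before ?x (v r)"
      unfolding ring_time_eq using card_ring_less[OF gv[of r]] by (simp add: v_def)
    have front: "site_after w (Suc r) (rings_before ?x (v r)) = int (jumps v r ?x) - int r"
      by (simp add: IHr jumps_def)
    \<comment> \<open>\<open>site_after\<close> blocks only when the sites are exactly adjacent,
      that is when the two jump counts are equal. The order of the counts turns its negation into
      the strict inequality used by \<open>hops\<close>.\<close>
    have le: "?h n \<le> jumps v r ?x" by (rule hops_le_jumps[OF gv])
    have succ: "hop_rows v (Suc r) (?h n) < ?x \<longleftrightarrow> ?h n < jumps v r ?x"
      by (rule hop_rows_less_iff[OF gv])
    have h: "?h (Suc n) = ?h n + (if ?h n < jumps v r ?x then 1 else 0)"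
      using succ by simp
    have "site_after w (Suc (Suc r)) (Suc n) =
      (if int (jumps v r ?x) - int r = site_after w (Suc (Suc r)) n + 1 then site_after w (Suc (Suc r)) n
       else site_after w (Suc (Suc r)) n + 1)"
      unfolding site_after.simps(2)[of w "Suc (Suc r)" n] by (simp add: c front del: site_after.simps)
    then show ?case unfolding Suc h using le by auto
  qed simp
qed

lemma ennreal_active_count:
  assumes g: "\<And>r. good (w (Suc r))" and t: "0 \<le> t"
    and ex: "\<exists>r. t < w (Suc r) 0"
  defines "v \<equiv> \<lambda>r. w (Suc r)"
  shows "ennreal (active_count w t) = (\<Sum>r. if has_slot (hop_rows v r) (hop_rows v (Suc r)) t then 1 else 0)"
proof -
  have gv: "good (v r)" for r using g by (simp add: v_def)
  define N where "N r = hops 0 (hop_rows v r) (v r) (first_ring t (v r))" for r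
  define X where "X r = int (N r) - int r" for r
  have site: "particle_site w (Suc r) t = X r" for r
    unfolding particle_site_def ring_time_eq card_ring_le[OF g] site_after_eq_hops[of w, OF g] X_def N_def v_def ..
  have time_le: "hop_rows v (Suc r) k \<le> t \<longleftrightarrow> k < N r" for r k
    by (simp add: N_def hop_time_def hop_index_less_iff[OF gv, symmetric] less_first_ring_iff[OF gv])
  have N_Suc: "N (Suc r) \<le> N r" for r
  proof (cases "first_ring t (v (Suc r))")
    case (Suc n)
    then have le: "ring (v (Suc r)) n \<le> t" using less_first_ring_iff[of "v (Suc r)" n t, OF gv] by simp
    have "N (Suc r) \<le> jumps v r (ring (v (Suc r)) n)"
      unfolding N_def Suc by (rule hops_Suc_le_jumps[OF gv])
    also have "\<dots> \<le> N r"
    proof -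
      have "rings_before (ring (v (Suc r)) n) (v r) \<le> rings_before t (v r)"
        by (rule rings_before_mono[OF gv le])
      also have "\<dots> \<le> first_ring t (v r)" by (rule rings_before_le_first_ring[OF gv])
      finally show ?thesis unfolding jumps_def N_def by (rule hops_mono)
    qed
    finally show ?thesis .
  qed (simp add: N_def)
  have N_anti: "antimono N" by (rule antimonoI) (metis N_Suc lift_Suc_antimono_le)
  define act where "act r \<longleftrightarrow> (case r of 0 \<Rightarrow> True | Suc p \<Rightarrow> N (Suc p) < N p)" for r
  have slot: "has_slot (hop_rows v r) (hop_rows v (Suc r)) t \<longleftrightarrow> act r" for r
  proof (cases r)
    case 0
    then show ?thesis using has_slot_first[OF gv t] by (simp add: act_def)
  next
    case (Suc p)
    then show ?thesis using has_slot_iff[OF t time_le[of p] time_le[of "Suc p"]] by (simp add: act_def del: rows.simps)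
  qed
  have X_less: "X q < X r" if "r < q" for q r
  proof -
    have "N q \<le> N r" using N_anti that by (simp add: antimonoD)
    with that show ?thesis by (simp add: X_def)
  qed
  then have inj: "inj X" by (intro injI) (metis less_irrefl nat_neq_iff)
  \<comment> \<open>Since \<open>N\<close> is nonincreasing, only the particle directly in front can
    stand on the next site.\<close>
  have blocked: "(\<exists>q. X q = X r + 1) \<longleftrightarrow> \<not> act r" for r
  proof
    assume "\<exists>q. X q = X r + 1"
    then obtain q where q: "X q = X r + 1" by auto
    then have "q < r" using X_less[of r q] by (cases q r rule: linorder_cases) auto
    then obtain p where p: "r = Suc p" "q \<le> p" by (cases r) auto
    have "N (Suc p) \<le> N p" "N p \<le> N q" using N_anti p by (auto simp: antimono_def)
    with q p show "\<not> act r" by (auto simp: act_def X_def)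
  next
    assume "\<not> act r"
    then obtain p where p: "r = Suc p" "\<not> N (Suc p) < N p" by (auto simp: act_def split: nat.splits)
    with N_Suc[of p] have "N (Suc p) = N p" by simp
    with p show "\<exists>q. X q = X r + 1" by (intro exI[of _ p]) (simp add: X_def)
  qed
  have ex_site: "(\<exists>r\<ge>1. particle_site w r t = k) \<longleftrightarrow> (\<exists>r. X r = k)" for k
    unfolding site[symmetric] by (metis One_nat_def Suc_le_D le_numeral_extra(4) Suc_le_mono zero_le)
  have "{k. (\<exists>r\<ge>1. particle_site w r t = k) \<and> \<not> (\<exists>r\<ge>1. particle_site w r t = k + 1)} = X ` {r. act r}"
    unfolding ex_site using blocked by auto
  then have count: "active_count w t = real (card {r. act r})"
    unfolding active_count_card by (simp add: card_image inj_on_subset[OF inj])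
  \<comment> \<open>A particle whose clock has not rung by \<open>t\<close> has not moved. Then all
    particles behind it are at their starting sites, each blocked by the one in front.\<close>
  obtain r0 where "t < v r0 0" using ex by (auto simp: v_def)
  then have "N r0 = 0" using first_ring_le_iff[of "v r0" t 0, OF gv] by (simp add: N_def)
  then have "N r = 0" if "r \<ge> r0" for r using N_anti that by (metis antimonoD le_zero_eq)
  then have "\<not> act r" if "r > r0" for r using that by (auto simp: act_def split: nat.splits)
  then have fin: "finite {r. act r}"
    by (intro finite_subset[OF _ finite_atMost[of r0]]) (auto intro: leI)
  have "(\<Sum>r. if act r then 1 else 0 :: ennreal) = (\<Sum>r\<in>{r. act r}. if act r then 1 else 0)"
    by (rule suminf_finite[OF fin]) auto
  also have "\<dots> = ennreal (real (card {r. act r}))" by (simp add: ennreal_of_nat_eq_real_of_nat)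
  finally show ?thesis by (simp add: slot count del: rows.simps)
qed

text \<open>The first rings are independent, and each comes by time \<open>t\<close> with the same
  probability \<open>1 - exp (- t) < 1\<close>. The idle particle found here bounds the set of
  active ones in \<open>ennreal_active_count\<close>.\<close>

lemma AE_grid_idle:
  assumes t: "0 \<le> t" shows "AE w in grid. \<exists>r. t < w r 0"
proof (rule AE_I)
  interpret E: prob_space "expm 1" by (rule prob_space_expm) simp
  let ?A = "{\<omega>\<in>space clock. \<omega> 0 \<le> t}"
  let ?N = "{w\<in>space grid. \<forall>r. w r 0 \<le> t}"
  have "(\<lambda>\<omega>. \<omega> 0) \<in> borel_measurable seqs" by (rule measurable_component_singleton) simp
  then have "{\<omega>\<in>space seqs. \<omega> 0 \<le> t} \<in> sets seqs" by (rule borel_measurable_le) simp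
  then have A: "?A \<in> sets clock" by (simp add: space_PiM cong: sets_PiM_cong)
  have m: "(\<lambda>w. w r 0) \<in> borel_measurable grid" for r
  proof -
    have "(\<lambda>w. w r) \<in> measurable grid clock" by (rule measurable_component_singleton) simp
    then have "(\<lambda>w. w r) \<in> measurable grid seqs" by (simp only: measurable_clock)
    from measurable_seq_nth[OF this, of 0] show ?thesis .
  qed
  show "{w \<in> space grid. \<not> (\<exists>r. t < w r 0)} \<subseteq> ?N" by (auto simp: not_less)
  show N: "?N \<in> sets grid"
    by (intro sets.sets_Collect_countable_All borel_measurable_le m) simp
  have "emeasure clock ?A = (\<integral>\<^sup>+\<omega>. indicator ?A \<omega> \<partial>clock)"
    by (rule nn_integral_indicator[OF A, symmetric])
  also have "\<dots> = (\<integral>\<^sup>+\<omega>. indicator {..t} (\<omega> 0) \<partial>clock)"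
    by (rule nn_integral_cong) (simp add: indicator_def)
  also have "\<dots> = emeasure (expm 1) {..t}"
    by (subst nn_integral_iid_hd) (auto simp: prob_space_expm)
  also have "\<dots> = ennreal (1 - exp (- t))"
  proof -
    have "E.prob (space (expm 1) - {t<..}) = 1 - E.prob {t<..}" by (rule E.prob_compl) simp
    moreover have "E.prob {t<..} = exp (- t)" using emeasure_expm_greater[of 1 t] t
      by (simp add: E.emeasure_eq_measure)
    moreover have "space (expm 1) - {t<..} = {..t}" by auto
    ultimately show ?thesis by (simp add: E.emeasure_eq_measure)
  qed
  finally have q: "emeasure clock ?A = ennreal (1 - exp (- t))" .
  have "emeasure grid ?N \<le> ennreal ((1 - exp (- t)) ^ n)" for n
  proof -
    have "emeasure grid ?N = (\<integral>\<^sup>+w. indicator ?N w \<partial>grid)" using N by simp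
    also have "\<dots> \<le> (\<integral>\<^sup>+w. (\<Prod>i<n. indicator ?A (w i)) \<partial>grid)"
    proof (rule nn_integral_mono)
      fix w assume "w \<in> space grid"
      then show "indicator ?N w \<le> (\<Prod>i<n. indicator ?A (w i) :: ennreal)"
        by (cases "w \<in> ?N") (auto simp: space_PiM)
    qed
    also have "\<dots> = (\<Prod>i<n. emeasure clock ?A)"
      by (rule nn_integral_iid_prod_indicator[OF prob_space_clock A])
    also have "\<dots> = ennreal ((1 - exp (- t)) ^ n)" using t by (simp add: q ennreal_power)
    finally show ?thesis .
  qed
  moreover have "(\<lambda>n. ennreal ((1 - exp (- t)) ^ n)) \<longlonglongrightarrow> ennreal 0"
    using t by (intro tendsto_ennrealI LIMSEQ_realpow_zero) auto
  ultimately show "emeasure grid ?N = 0"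
    using LIMSEQ_le_const[of "\<lambda>n. ennreal ((1 - exp (- t)) ^ n)" "ennreal 0" "emeasure grid ?N"] by auto
qed

lemma measurable_active_count:
  fixes W :: "nat \<Rightarrow> nat \<Rightarrow> 'a \<Rightarrow> real"
  assumes W: "\<And>r n. 1 \<le> r \<Longrightarrow> W r n \<in> borel_measurable M"
  shows "(\<lambda>\<omega>. active_count (\<lambda>r n. W r n \<omega>) t) \<in> borel_measurable M"
proof -
  have rt: "(\<lambda>\<omega>. ring_time (\<lambda>r n. W r n \<omega>) r n) \<in> borel_measurable M" if "1 \<le> r" for r n
    unfolding ring_time_def using W[OF that] by measurable
  have site: "(\<lambda>\<omega>. site_after (\<lambda>r n. W r n \<omega>) (Suc r) n) \<in> measurable M (count_space UNIV)" for r n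
  proof (induction r arbitrary: n)
    case 0
    show ?case by (induction n) simp_all
  next
    case (Suc r)
    note IH[measurable] = Suc
    note [measurable] = rt[of "Suc r"] rt[of "Suc (Suc r)"]
    show ?case
    proof (induction n)
      case (Suc n)
      note [measurable] = Suc
      have "(\<lambda>\<omega>. card {m. ring_time (\<lambda>r n. W r n \<omega>) (Suc r) m < ring_time (\<lambda>r n. W r n \<omega>) (Suc (Suc r)) n})
        \<in> measurable M (count_space UNIV)"
        by measurable
      from measurable_compose_countable[OF IH this]
      have [measurable]: "(\<lambda>\<omega>. site_after (\<lambda>r n. W r n \<omega>) (Suc r)
          (card {m. ring_time (\<lambda>r n. W r n \<omega>) (Suc r) m < ring_time (\<lambda>r n. W r n \<omega>) (Suc (Suc r)) n}))
        \<in> measurable M (count_space UNIV)" .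
      show ?case unfolding site_after.simps(2)[of _ "Suc (Suc r)" n] by simp measurable
    qed simp
  qed
  have [measurable]: "(\<lambda>\<omega>. particle_site (\<lambda>r n. W r n \<omega>) (Suc r) t) \<in> measurable M (count_space UNIV)" for r
  proof -
    note [measurable] = rt[of "Suc r"]
    have "(\<lambda>\<omega>. card {m. ring_time (\<lambda>r n. W r n \<omega>) (Suc r) m \<le> t}) \<in> measurable M (count_space UNIV)"
      by measurable
    from measurable_compose_countable[OF site this] show ?thesis by (simp add: particle_site_def)
  qed
  let ?S = "\<lambda>\<omega>. {k. (\<exists>r. particle_site (\<lambda>r n. W r n \<omega>) (Suc r) t = k) \<and>
      \<not> (\<exists>r. particle_site (\<lambda>r n. W r n \<omega>) (Suc r) t = k + 1)}"
  \<comment> \<open>The sites are coded as naturals by \<open>int_decode\<close>, because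
    \<open>measurable_card\<close> concerns random sets of naturals.\<close>
  have "active_count (\<lambda>r n. W r n \<omega>) t = real (card (int_decode -` ?S \<omega>))" for \<omega>
  proof -
    have "(\<exists>r\<ge>1. particle_site (\<lambda>r n. W r n \<omega>) r t = k) \<longleftrightarrow> (\<exists>r. particle_site (\<lambda>r n. W r n \<omega>) (Suc r) t = k)" for k
      by (metis One_nat_def Suc_le_D le_numeral_extra(4) Suc_le_mono zero_le)
    moreover have "card (int_decode -` ?S \<omega>) = card (?S \<omega>)"
      by (rule card_vimage_inj) (auto simp: inj_int_decode surj_int_decode)
    ultimately show ?thesis unfolding active_count_card by simp
  qed
  moreover have "(\<lambda>\<omega>. card (int_decode -` ?S \<omega>)) \<in> measurable M (count_space UNIV)"
    by (rule measurable_card) (simp, measurable)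
  ultimately show ?thesis by simp
qed

text \<open>Independence is used twice: inside a row, to identify its law as \<open>clock\<close>,
  and between the rows after the variables have been grouped.\<close>

lemma distr_clocks:
  fixes M :: "'a measure" and W :: "nat \<Rightarrow> nat \<Rightarrow> 'a \<Rightarrow> real"
  assumes M: "prob_space M"
    and ind: "prob_space.indep_vars M (\<lambda>_. borel) (\<lambda>(r, n). W r n) ({1..} \<times> UNIV)"
    and dist: "\<And>r n. r \<ge> 1 \<Longrightarrow> distributed M lborel (W r n) (exponential_density 1)"
  shows "(\<lambda>\<omega> r n. W (Suc r) n \<omega>) \<in> measurable M grid" "distr M grid (\<lambda>\<omega> r n. W (Suc r) n \<omega>) = grid"
proof -
  interpret prob_space M by fact
  have W[measurable]: "W (Suc r) n \<in> borel_measurable M" for r n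
    using dist[of "Suc r" n] by (simp add: distributed_def)
  have grid_seqs: "measurable M grid = measurable M (iid seqs)"
    by (intro measurable_cong_sets sets_PiM_cong refl) simp
  show meas: "(\<lambda>\<omega> r n. W (Suc r) n \<omega>) \<in> measurable M grid"
    unfolding grid_seqs by (intro measurable_seqI W)
  have row[measurable]: "(\<lambda>\<omega> n. W (Suc r) n \<omega>) \<in> measurable M seqs" for r
    by (intro measurable_seqI W)
  have law: "distr M (expm 1) (W (Suc r) n) = expm 1" for r n
  proof -
    have "distr M (expm 1) (W (Suc r) n) = distr M lborel (W (Suc r) n)" by (rule distr_cong) auto
    then show ?thesis using dist[of "Suc r" n] by (simp add: distributed_def expm_def)
  qed
  have row_law: "distr M clock (\<lambda>\<omega> n. W (Suc r) n \<omega>) = clock" for r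
  proof (rule iid_eqI)
    show "prob_space (expm 1)" by (rule prob_space_expm) simp
    fix m :: nat and A :: "nat \<Rightarrow> real set" assume A: "\<And>i. A i \<in> sets (expm 1)"
    then have [measurable]: "A i \<in> sets borel" for i by simp
    have inj: "inj_on (Pair (Suc r)) {..<m}" by (simp add: inj_on_def)
    have "indep_vars (\<lambda>_. borel) (\<lambda>(r, n). W r n) (Pair (Suc r) ` {..<m})"
      by (rule indep_vars_subset[OF ind]) auto
    then have "indep_vars (\<lambda>_. borel) (\<lambda>p \<omega>. indicator (A (snd p)) ((case p of (r, n) \<Rightarrow> W r n) \<omega>) :: ennreal)
        (Pair (Suc r) ` {..<m})"
      by (rule indep_vars_compose2) auto
    from indep_vars_nn_integral[OF _ this]
    have "(\<integral>\<^sup>+\<omega>. (\<Prod>n<m. indicator (A n) (W (Suc r) n \<omega>)) \<partial>M) = (\<Prod>n<m. \<integral>\<^sup>+\<omega>. indicator (A n) (W (Suc r) n \<omega>) \<partial>M)"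
      by (simp add: prod.reindex[OF inj])
    also have "\<dots> = (\<Prod>n<m. emeasure (expm 1) (A n))"
    proof (rule prod.cong[OF refl])
      fix n
      have "(\<integral>\<^sup>+\<omega>. indicator (A n) (W (Suc r) n \<omega>) \<partial>M) = (\<integral>\<^sup>+x. indicator (A n) x \<partial>distr M (expm 1) (W (Suc r) n))"
        by (subst nn_integral_distr) auto
      then show "(\<integral>\<^sup>+\<omega>. indicator (A n) (W (Suc r) n \<omega>) \<partial>M) = emeasure (expm 1) (A n)" by (simp add: law)
    qed
    finally show "(\<integral>\<^sup>+\<omega>. (\<Prod>i<m. indicator (A i) (\<omega> i)) \<partial>distr M clock (\<lambda>\<omega> n. W (Suc r) n \<omega>)) =
        (\<Prod>i<m. emeasure (expm 1) (A i))"
      by (subst nn_integral_distr) auto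
  qed simp
  have "indep_vars (\<lambda>r. PiM ({Suc r} \<times> UNIV) (\<lambda>_. borel)) (\<lambda>r \<omega>. restrict (\<lambda>i. (\<lambda>(r, n). W r n) i \<omega>) ({Suc r} \<times> UNIV)) UNIV"
    by (rule indep_vars_restrict[OF ind]) (auto simp: disjoint_family_on_def)
  then have "indep_vars (\<lambda>_. seqs) (\<lambda>r \<omega>. (\<lambda>x n. x (Suc r, n)) (restrict (\<lambda>i. (\<lambda>(r, n). W r n) i \<omega>) ({Suc r} \<times> UNIV))) UNIV"
    by (rule indep_vars_compose2) (intro measurable_seqI measurable_component_singleton, auto)
  then have rows: "indep_vars (\<lambda>_. seqs) (\<lambda>r \<omega> n. W (Suc r) n \<omega>) UNIV" by simp
  show "distr M grid (\<lambda>\<omega> r n. W (Suc r) n \<omega>) = grid"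
  proof (rule iid_eqI[OF prob_space_clock])
    fix m :: nat and A :: "nat \<Rightarrow> (nat \<Rightarrow> real) set" assume A[measurable]: "\<And>i. A i \<in> sets clock"
    then have A'[measurable]: "A i \<in> sets seqs" for i by (simp cong: sets_PiM_cong)
    have "indep_vars (\<lambda>_. borel) (\<lambda>r \<omega>. indicator (A r) (\<lambda>n. W (Suc r) n \<omega>) :: ennreal) {..<m}"
      by (rule indep_vars_compose2[OF indep_vars_subset[OF rows]]) auto
    from indep_vars_nn_integral[OF _ this]
    have "(\<integral>\<^sup>+\<omega>. (\<Prod>r<m. indicator (A r) (\<lambda>n. W (Suc r) n \<omega>)) \<partial>M) = (\<Prod>r<m. \<integral>\<^sup>+\<omega>. indicator (A r) (\<lambda>n. W (Suc r) n \<omega>) \<partial>M)"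
      by simp
    also have "\<dots> = (\<Prod>r<m. emeasure clock (A r))"
    proof (rule prod.cong[OF refl])
      fix r
      have "(\<integral>\<^sup>+\<omega>. indicator (A r) (\<lambda>n. W (Suc r) n \<omega>) \<partial>M) = (\<integral>\<^sup>+x. indicator (A r) x \<partial>distr M clock (\<lambda>\<omega> n. W (Suc r) n \<omega>))"
        by (subst nn_integral_distr) auto
      then show "(\<integral>\<^sup>+\<omega>. indicator (A r) (\<lambda>n. W (Suc r) n \<omega>) \<partial>M) = emeasure clock (A r)"
        by (simp add: row_law A)
    qed
    finally show "(\<integral>\<^sup>+\<omega>. (\<Prod>i<m. indicator (A i) (\<omega> i)) \<partial>distr M grid (\<lambda>\<omega> r n. W (Suc r) n \<omega>)) =
        (\<Prod>i<m. emeasure clock (A i))"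
      by (subst nn_integral_distr[OF meas]) auto
  qed simp
qed

text \<open>Should the expectation be infinite, both sides are \<open>0\<close> by convention.
  Finiteness for \<open>t \<ge> 1\<close> is established in
  \<open>tendsto_corner_rate\<close>.\<close>

theorem integral_active_count:
  fixes M :: "'a measure" and W :: "nat \<Rightarrow> nat \<Rightarrow> 'a \<Rightarrow> real"
  assumes M: "prob_space M"
    and ind: "prob_space.indep_vars M (\<lambda>_. borel) (\<lambda>(r, n). W r n) ({1..} \<times> UNIV)"
    and dist: "\<And>r n. r \<ge> 1 \<Longrightarrow> distributed M lborel (W r n) (exponential_density 1)"
    and t: "0 \<le> t"
  shows "(\<integral>\<omega>. active_count (\<lambda>r n. W r n \<omega>) t \<partial>M) = enn2real (\<Sum>r. corner_rate r t)"
proof -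
  interpret prob_space M by fact
  have meas: "(\<lambda>\<omega> r n. W (Suc r) n \<omega>) \<in> measurable M grid"
    by (rule distr_clocks(1)[OF M ind]) (rule dist)
  have law: "distr M grid (\<lambda>\<omega> r n. W (Suc r) n \<omega>) = grid"
    by (rule distr_clocks(2)[OF M ind]) (rule dist)
  have W: "W r n \<in> borel_measurable M" if "1 \<le> r" for r n
    using dist[OF that, of n] by (simp add: distributed_def)
  let ?V = "\<lambda>w. \<Sum>r. if has_slot (hop_rows w r) (hop_rows w (Suc r)) t then 1 else (0::ennreal)"
  \<comment> \<open>The pathwise argument yields \<open>?V\<close>; its almost sure version
    \<open>?V'\<close> is visibly measurable.\<close>
  let ?V' = "\<lambda>w. \<Sum>r. \<Sum>j. slot j (hop_rows w r) (hop_rows w (Suc r)) t"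
  have VV': "AE w in grid. ?V w = ?V' w"
    using AE_grid_good
  proof eventually_elim
    case (elim w)
    show ?case
      by (intro suminf_cong suminf_slot[symmetric] monoI) (use elim in \<open>auto intro!: hop_time_mono\<close>)
  qed
  have AE_M: "AE \<omega> in M. P (\<lambda>r n. W (Suc r) n \<omega>)" if "AE w in grid. P w" for P
    using that by (intro AE_distrD[OF meas]) (simp only: law)
  have "(\<integral>\<omega>. active_count (\<lambda>r n. W r n \<omega>) t \<partial>M) = enn2real (\<integral>\<^sup>+\<omega>. ennreal (active_count (\<lambda>r n. W r n \<omega>) t) \<partial>M)"
    by (rule integral_eq_nn_integral[OF measurable_active_count[OF W]]) (simp_all add: active_count_card)
  also have "(\<integral>\<^sup>+\<omega>. ennreal (active_count (\<lambda>r n. W r n \<omega>) t) \<partial>M) = (\<integral>\<^sup>+\<omega>. ?V' (\<lambda>r n. W (Suc r) n \<omega>) \<partial>M)"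
    using AE_M[OF AE_grid_good] AE_M[OF AE_grid_idle[OF t]] AE_M[OF VV']
  proof (intro nn_integral_cong_AE, eventually_elim)
    case (elim \<omega>)
    then show ?case using ennreal_active_count[of "\<lambda>r n. W r n \<omega>" t] t by (simp del: rows.simps)
  qed
  also have "\<dots> = (\<integral>\<^sup>+w. ?V' w \<partial>distr M grid (\<lambda>\<omega> r n. W (Suc r) n \<omega>))"
    by (rule nn_integral_distr[OF meas, symmetric]) measurable
  also have "\<dots> = (\<integral>\<^sup>+w. ?V' w \<partial>grid)" by (simp only: law)
  also have "\<dots> = (\<Sum>r. \<integral>\<^sup>+w. (\<Sum>j. slot j (hop_rows w r) (hop_rows w (Suc r)) t) \<partial>grid)"
    by (rule nn_integral_suminf) measurable
  also have "\<dots> = (\<Sum>r. corner_rate r t)"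
  proof (rule suminf_cong)
    fix r
    show "(\<integral>\<^sup>+w. (\<Sum>j. slot j (hop_rows w r) (hop_rows w (Suc r)) t) \<partial>grid) = corner_rate r t"
      unfolding corner_rate_def
      by (rule nn_integral_hop_rows_eq_lpp_rows[of "\<lambda>a b. \<Sum>j. slot j a b t"]) measurable
  qed
  finally show ?thesis .
qed

section \<open>Stationary last passage percolation\<close>

text \<open>In the coordinates \<open>x = min u v\<close> and \<open>d = u - v\<close> the exponent
  splits as \<open>a * u + b * v = (a + b) * x + a * max 0 d + b * max 0 (- d)\<close>. The joint
  density is therefore a product, and \<open>a + b = 1\<close> makes the factor in \<open>x\<close>
  the unit exponential.\<close>

lemma nn_integral_expm_min_diff:
  assumes ab: "0 < a" "0 < b" "a + b = 1"
    and g[measurable]: "(\<lambda>(x, d). g x d) \<in> borel_measurable (borel \<Otimes>\<^sub>M borel)"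
  shows "(\<integral>\<^sup>+u. \<integral>\<^sup>+v. g (min u v) (u - v) \<partial>expm b \<partial>expm a) =
    (\<integral>\<^sup>+d. ennreal (a * b * exp (- a * max 0 d - b * max 0 (- d))) * (\<integral>\<^sup>+x. g x d \<partial>expm 1) \<partial>lborel)"
proof -
  let ?D = "\<lambda>c x. ennreal (exponential_density c x)"
  have [measurable]: "(\<lambda>z. g (fst z) (snd z)) \<in> borel_measurable (borel \<Otimes>\<^sub>M borel)"
    using g by (simp add: split_beta')
  have g2[measurable]: "(\<lambda>z. g (f z) (h z)) \<in> borel_measurable M"
    if "f \<in> borel_measurable M" "h \<in> borel_measurable M" for f h and M :: "'c measure"
    using measurable_compose[OF measurable_Pair[OF that] g] by simp
  have [measurable]: "(\<lambda>u. \<integral>\<^sup>+v. g (min u v) (u - v) \<partial>expm b) \<in> borel_measurable borel"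
  proof -
    interpret prob_space "expm b" by (rule prob_space_expm) fact
    show ?thesis by measurable
  qed
  have "(\<integral>\<^sup>+u. \<integral>\<^sup>+v. g (min u v) (u - v) \<partial>expm b \<partial>expm a) =
    (\<integral>\<^sup>+u. ?D a u * (\<integral>\<^sup>+v. ?D b v * g (min u v) (u - v) \<partial>lborel) \<partial>lborel)"
    by (simp add: nn_integral_expm)
  also have "\<dots> = (\<integral>\<^sup>+u. \<integral>\<^sup>+v. ?D a u * (?D b v * g (min u v) (u - v)) \<partial>lborel \<partial>lborel)"
    by (intro nn_integral_cong nn_integral_cmult[symmetric]) measurable
  also have "\<dots> = (\<integral>\<^sup>+u. \<integral>\<^sup>+d. ?D a u * (?D b (u - d) * g (min u (u - d)) d) \<partial>lborel \<partial>lborel)"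
  proof (rule nn_integral_cong)
    fix u :: real
    show "(\<integral>\<^sup>+v. ?D a u * (?D b v * g (min u v) (u - v)) \<partial>lborel) =
      (\<integral>\<^sup>+d. ?D a u * (?D b (u - d) * g (min u (u - d)) d) \<partial>lborel)"
      by (subst nn_integral_real_affine[of _ "-1" u]) auto
  qed
  also have "\<dots> = (\<integral>\<^sup>+d. \<integral>\<^sup>+u. ?D a u * (?D b (u - d) * g (min u (u - d)) d) \<partial>lborel \<partial>lborel)"
    by (rule lborel_pair.Fubini') measurable
  also have "\<dots> = (\<integral>\<^sup>+d. \<integral>\<^sup>+x. ennreal (a * b * exp (- a * max 0 d - b * max 0 (- d))) * (?D 1 x * g x d) \<partial>lborel \<partial>lborel)"
  proof (rule nn_integral_cong)
    fix d :: real
    have "(\<integral>\<^sup>+u. ?D a u * (?D b (u - d) * g (min u (u - d)) d) \<partial>lborel) =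
      (\<integral>\<^sup>+x. ?D a (max 0 d + x) * (?D b (max 0 d + x - d) * g (min (max 0 d + x) (max 0 d + x - d)) d) \<partial>lborel)"
      \<comment> \<open>For fixed \<open>d\<close>, subtracting \<open>max 0 d\<close> from
        \<open>u\<close> leaves the minimum.\<close>
      by (subst nn_integral_real_affine[of _ 1 "max 0 d"]) auto
    also have "\<dots> = (\<integral>\<^sup>+x. ennreal (a * b * exp (- a * max 0 d - b * max 0 (- d))) * (?D 1 x * g x d) \<partial>lborel)"
    proof (rule nn_integral_cong)
      fix x :: real
      have 1: "max 0 d + x - d = max 0 (- d) + x" "min (max 0 d + x) (max 0 (- d) + x) = x" by auto
      have "exponential_density a (max 0 d + x) * exponential_density b (max 0 (- d) + x) =
        a * b * exp (- a * max 0 d - b * max 0 (- d)) * exponential_density 1 x"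
      proof (cases "x < 0")
        case False
        define p q where "p = max 0 d" and "q = max 0 (- d)"
        have D: "exponential_density c y = c * exp (- (y * c))" if "0 \<le> y" for c y
          using that by (simp add: exponential_density_def)
        have pq: "0 \<le> p + x" "0 \<le> q + x" "0 \<le> x" using False by (auto simp: p_def q_def)
        have x: "x = a * x + b * x" using ab(3) by (simp add: distrib_right[symmetric])
        have "- ((p + x) * a) + - ((q + x) * b) = - a * p - b * q + - (x * 1)"
          by (subst (3) x) (simp add: algebra_simps)
        then have "exp (- ((p + x) * a)) * exp (- ((q + x) * b)) = exp (- a * p - b * q) * exp (- (x * 1))"
          by (simp only: mult_exp_exp)
        then show ?thesis
          unfolding p_def[symmetric] q_def[symmetric] D[OF pq(1)] D[OF pq(2)] D[OF pq(3)]
          by (metis mult.assoc mult.left_commute mult_1)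
      qed (auto simp: exponential_density_def max_def)
      then have "?D a (max 0 d + x) * ?D b (max 0 (- d) + x) =
        ennreal (a * b * exp (- a * max 0 d - b * max 0 (- d))) * ?D 1 x"
        using ab by (simp add: ennreal_mult'[symmetric] exponential_density_nonneg)
      then show "?D a (max 0 d + x) * (?D b (max 0 d + x - d) * g (min (max 0 d + x) (max 0 d + x - d)) d) =
        ennreal (a * b * exp (- a * max 0 d - b * max 0 (- d))) * (?D 1 x * g x d)"
        unfolding 1 by (metis mult.assoc)
    qed
    finally show "(\<integral>\<^sup>+u. ?D a u * (?D b (u - d) * g (min u (u - d)) d) \<partial>lborel) =
      (\<integral>\<^sup>+x. ennreal (a * b * exp (- a * max 0 d - b * max 0 (- d))) * (?D 1 x * g x d) \<partial>lborel)" .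
  qed
  also have "\<dots> = (\<integral>\<^sup>+d. ennreal (a * b * exp (- a * max 0 d - b * max 0 (- d))) * (\<integral>\<^sup>+x. g x d \<partial>expm 1) \<partial>lborel)"
    by (intro nn_integral_cong) (simp add: nn_integral_cmult nn_integral_expm)
  finally show ?thesis .
qed

text \<open>The Burke property: \<open>min u v\<close> has law \<open>expm 1\<close> and is independent of \<open>u - v\<close>, so it may be
  replaced by an independent copy \<open>x\<close> without changing the law of the pair \<open>(u, v)\<close>.\<close>

lemma nn_integral_burke:
  assumes ab: "0 < a" "0 < b" "a + b = 1"
    and f: "(\<lambda>(u, v). f u v) \<in> borel_measurable (borel \<Otimes>\<^sub>M borel)"
  shows "(\<integral>\<^sup>+u. \<integral>\<^sup>+v. \<integral>\<^sup>+x. f (x + max 0 (u - v)) (x + max 0 (v - u)) \<partial>expm 1 \<partial>expm b \<partial>expm a) =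
    (\<integral>\<^sup>+u. \<integral>\<^sup>+v. f u v \<partial>expm b \<partial>expm a)"
proof -
  interpret E: prob_space "expm 1" by (rule prob_space_expm) simp
  have f2[measurable]: "(\<lambda>z. f (p z) (q z)) \<in> borel_measurable M"
    if "p \<in> borel_measurable M" "q \<in> borel_measurable M" for p q and M :: "'c measure"
    using measurable_compose[OF measurable_Pair[OF that] f] by simp
  let ?g = "\<lambda>x d. f (x + max 0 d) (x + max 0 (- d))"
  let ?k = "\<lambda>d. ennreal (a * b * exp (- a * max 0 d - b * max 0 (- d)))"
  have "(\<integral>\<^sup>+u. \<integral>\<^sup>+v. f u v \<partial>expm b \<partial>expm a) = (\<integral>\<^sup>+u. \<integral>\<^sup>+v. ?g (min u v) (u - v) \<partial>expm b \<partial>expm a)"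
    by (intro nn_integral_cong arg_cong2[where f=f]) auto
  also have "\<dots> = (\<integral>\<^sup>+d. ?k d * (\<integral>\<^sup>+x. ?g x d \<partial>expm 1) \<partial>lborel)"
    by (rule nn_integral_expm_min_diff[OF ab]) measurable
  \<comment> \<open>The dummy variable \<open>x'\<close> takes the place of the discarded minimum,
    so that \<open>nn_integral_expm_min_diff\<close> can be read backwards.\<close>
  also have "\<dots> = (\<integral>\<^sup>+d. ?k d * (\<integral>\<^sup>+x'. (\<integral>\<^sup>+x. ?g x d \<partial>expm 1) \<partial>expm 1) \<partial>lborel)"
    by (simp add: E.emeasure_space_1 del: space_expm)
  also have "\<dots> = (\<integral>\<^sup>+u. \<integral>\<^sup>+v. (\<integral>\<^sup>+x. ?g x (u - v) \<partial>expm 1) \<partial>expm b \<partial>expm a)"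
    by (rule nn_integral_expm_min_diff[OF ab, symmetric]) measurable
  finally show ?thesis by simp
qed

text \<open>Increments in place of passage times: \<open>u\<close> are those along the lower row,
  \<open>v\<close> the one up the left side, \<open>x\<close> the weights, and the values are the
  increments along the upper row. In the recursion, \<open>x 0 + max 0 (v - u 0)\<close> is the
  increment up the right side of the first cell.\<close>

primrec queue_row :: "nat \<Rightarrow> real \<Rightarrow> (nat \<Rightarrow> real) \<Rightarrow> (nat \<Rightarrow> real) \<Rightarrow> real" where
  "queue_row 0 v u x = x 0 + max 0 (u 0 - v)"
| "queue_row (Suc k) v u x = queue_row k (x 0 + max 0 (v - u 0)) (\<lambda>i. u (Suc i)) (\<lambda>i. x (Suc i))"

lemma measurable_queue_row:
  assumes "f \<in> borel_measurable M" "h \<in> measurable M seqs" "g \<in> measurable M seqs"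
  shows "(\<lambda>x. queue_row k (f x) (h x) (g x)) \<in> borel_measurable M"
  using assms
proof (induction k arbitrary: f g h)
  case 0
  have [measurable]: "(\<lambda>x. h x 0) \<in> borel_measurable M" "(\<lambda>x. g x 0) \<in> borel_measurable M"
    by (rule measurable_seq_nth, fact)+
  show ?case using 0 by simp
next
  case (Suc k)
  note [measurable] = Suc.prems
  have [measurable]: "(\<lambda>x. h x 0) \<in> borel_measurable M" "(\<lambda>x. g x 0) \<in> borel_measurable M"
    by (rule measurable_seq_nth, fact)+
  show ?case unfolding queue_row.simps by (rule Suc.IH) measurable
qed

lemma measurable_queue_row_seq[measurable (raw)]:
  assumes "f \<in> borel_measurable M" "h \<in> measurable M seqs" "g \<in> measurable M seqs"
  shows "(\<lambda>x k. queue_row k (f x) (h x) (g x)) \<in> measurable M seqs"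
  by (rule measurable_seqI) (rule measurable_queue_row[OF assms])

lemma measurable_iid_expm[simp]: "measurable M (iid (expm a)) = measurable M seqs"
  "measurable (iid (expm a)) N = measurable seqs N"
  by (intro measurable_cong_sets sets_PiM_cong refl; simp)+

text \<open>By \<open>nn_integral_burke\<close> the first cell turns the incoming pair of increments
  into an outgoing pair of the same law. The horizontal one is recorded; the vertical one,
  independent of it and again of rate \<open>b\<close>, enters the next cell. The remaining work is
  to order the integrals accordingly.\<close>

lemma nn_integral_queue_row_cylinder:
  assumes ab: "0 < a" "0 < b" "a + b = 1" and A: "\<And>i. A i \<in> sets borel"
  shows "(\<integral>\<^sup>+v. \<integral>\<^sup>+u. \<integral>\<^sup>+x. (\<Prod>i<m. indicator (A i) (queue_row i v u x)) \<partial>clock \<partial>iid (expm a) \<partial>expm b) =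
    (\<Prod>i<m. emeasure (expm a) (A i))"
  using A
proof (induction m arbitrary: A)
  case 0
  interpret C: prob_space clock by (rule prob_space_clock)
  interpret A: prob_space "iid (expm a)" by (intro prob_space_iid prob_space_expm ab)
  interpret B: prob_space "expm b" by (intro prob_space_expm ab)
  show ?case by (simp add: C.emeasure_space_1 A.emeasure_space_1 B.emeasure_space_1 del: space_expm)
next
  case (Suc m)
  interpret C: prob_space clock by (rule prob_space_clock)
  interpret A: prob_space "iid (expm a)" by (intro prob_space_iid prob_space_expm ab)
  interpret A1: prob_space "expm a" by (intro prob_space_expm ab)
  interpret B: prob_space "expm b" by (intro prob_space_expm ab)
  interpret E: prob_space "expm 1" by (intro prob_space_expm) simp
  interpret AE: pair_sigma_finite "expm 1" "iid (expm a)" ..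
  interpret AB: pair_sigma_finite "expm a" "expm b" ..
  note A[measurable] = Suc.prems
  let ?P = "\<lambda>m A v u x. (\<Prod>i<m. indicator (A i) (queue_row i v u x)) :: ennreal"
  define G where "G v = (\<integral>\<^sup>+u. \<integral>\<^sup>+x. ?P m (\<lambda>i. A (Suc i)) v u x \<partial>clock \<partial>iid (expm a))" for v
  have P[measurable]: "(\<lambda>z. ?P m A (f z) (g z) (h z)) \<in> borel_measurable M"
    if "f \<in> borel_measurable M" "g \<in> measurable M seqs" "h \<in> measurable M seqs" "\<And>i. A i \<in> sets borel"
    for f g h m A and M :: "'c measure"
  proof -
    note [measurable] = measurable_queue_row[OF that(1-3)] that(4)
    show ?thesis by measurable
  qed
  have Gm[measurable]: "G \<in> borel_measurable borel"
    unfolding G_def[abs_def] by (measurable; simp)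
  have step: "?P (Suc m) A v (case_nat u0 u) (case_nat x0 x) =
      indicator (A 0) (x0 + max 0 (u0 - v)) * ?P m (\<lambda>i. A (Suc i)) (x0 + max 0 (v - u0)) u x" for v u0 u x0 x
    by (simp add: prod.lessThan_Suc_shift del: prod.lessThan_Suc)
  have "(\<integral>\<^sup>+v. \<integral>\<^sup>+u. \<integral>\<^sup>+x. ?P (Suc m) A v u x \<partial>clock \<partial>iid (expm a) \<partial>expm b) =
    (\<integral>\<^sup>+v. \<integral>\<^sup>+u0. \<integral>\<^sup>+u. \<integral>\<^sup>+x0. \<integral>\<^sup>+x. ?P (Suc m) A v (case_nat u0 u) (case_nat x0 x) \<partial>clock \<partial>expm 1 \<partial>iid (expm a) \<partial>expm a \<partial>expm b)"
  proof (rule nn_integral_cong)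
    fix v
    have "(\<integral>\<^sup>+u. \<integral>\<^sup>+x. ?P (Suc m) A v u x \<partial>clock \<partial>iid (expm a)) =
        (\<integral>\<^sup>+u0. \<integral>\<^sup>+u. \<integral>\<^sup>+x. ?P (Suc m) A v (case_nat u0 u) x \<partial>clock \<partial>iid (expm a) \<partial>expm a)"
      by (rule nn_integral_iid_peel[OF A1.prob_space_axioms]) (measurable; simp)
    also have "\<dots> = (\<integral>\<^sup>+u0. \<integral>\<^sup>+u. \<integral>\<^sup>+x0. \<integral>\<^sup>+x. ?P (Suc m) A v (case_nat u0 u) (case_nat x0 x) \<partial>clock \<partial>expm 1 \<partial>iid (expm a) \<partial>expm a)"
    proof (intro nn_integral_cong)
      fix u0 and u :: "nat \<Rightarrow> real"
      have "(\<lambda>x. ?P (Suc m) A v (case_nat u0 u) x) \<in> borel_measurable clock"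
        by (rule P[of "\<lambda>_. v" clock "\<lambda>_. case_nat u0 u" "\<lambda>x. x"]) (auto simp: space_PiM)
      from nn_integral_iid_peel[OF E.prob_space_axioms this]
      show "(\<integral>\<^sup>+x. ?P (Suc m) A v (case_nat u0 u) x \<partial>clock) =
        (\<integral>\<^sup>+x0. \<integral>\<^sup>+x. ?P (Suc m) A v (case_nat u0 u) (case_nat x0 x) \<partial>clock \<partial>expm 1)" .
    qed
    finally show "(\<integral>\<^sup>+u. \<integral>\<^sup>+x. ?P (Suc m) A v u x \<partial>clock \<partial>iid (expm a)) =
        (\<integral>\<^sup>+u0. \<integral>\<^sup>+u. \<integral>\<^sup>+x0. \<integral>\<^sup>+x. ?P (Suc m) A v (case_nat u0 u) (case_nat x0 x) \<partial>clock \<partial>expm 1 \<partial>iid (expm a) \<partial>expm a)" .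
  qed
  also have "\<dots> = (\<integral>\<^sup>+v. \<integral>\<^sup>+u0. \<integral>\<^sup>+x0. indicator (A 0) (x0 + max 0 (u0 - v)) * G (x0 + max 0 (v - u0)) \<partial>expm 1 \<partial>expm a \<partial>expm b)"
  proof (intro nn_integral_cong)
    fix v u0
    have "(\<integral>\<^sup>+u. \<integral>\<^sup>+x0. \<integral>\<^sup>+x. ?P (Suc m) A v (case_nat u0 u) (case_nat x0 x) \<partial>clock \<partial>expm 1 \<partial>iid (expm a)) =
      (\<integral>\<^sup>+x0. \<integral>\<^sup>+u. \<integral>\<^sup>+x. ?P (Suc m) A v (case_nat u0 u) (case_nat x0 x) \<partial>clock \<partial>iid (expm a) \<partial>expm 1)"
      by (rule AE.Fubini') (measurable; simp)
    also have "\<dots> = (\<integral>\<^sup>+x0. indicator (A 0) (x0 + max 0 (u0 - v)) * G (x0 + max 0 (v - u0)) \<partial>expm 1)"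
    proof (rule nn_integral_cong)
      fix x0
      have m1: "(\<lambda>x. ?P m (\<lambda>i. A (Suc i)) c u x) \<in> borel_measurable clock" for c u
        by (simp, rule P) (auto simp: space_PiM)
      have m2: "(\<lambda>u. \<integral>\<^sup>+x. ?P m (\<lambda>i. A (Suc i)) c u x \<partial>clock) \<in> borel_measurable (iid (expm a))" for c
        by (measurable; simp)
      show "(\<integral>\<^sup>+u. \<integral>\<^sup>+x. ?P (Suc m) A v (case_nat u0 u) (case_nat x0 x) \<partial>clock \<partial>iid (expm a)) =
          indicator (A 0) (x0 + max 0 (u0 - v)) * G (x0 + max 0 (v - u0))"
        unfolding step G_def by (simp only: nn_integral_cmult[OF m1] nn_integral_cmult[OF m2])
    qed
    finally show "(\<integral>\<^sup>+u. \<integral>\<^sup>+x0. \<integral>\<^sup>+x. ?P (Suc m) A v (case_nat u0 u) (case_nat x0 x) \<partial>clock \<partial>expm 1 \<partial>iid (expm a)) =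
      (\<integral>\<^sup>+x0. indicator (A 0) (x0 + max 0 (u0 - v)) * G (x0 + max 0 (v - u0)) \<partial>expm 1)" .
  qed
  also have "\<dots> = (\<integral>\<^sup>+u0. \<integral>\<^sup>+v. \<integral>\<^sup>+x0. indicator (A 0) (x0 + max 0 (u0 - v)) * G (x0 + max 0 (v - u0)) \<partial>expm 1 \<partial>expm b \<partial>expm a)"
    by (rule AB.Fubini') measurable
  also have "\<dots> = (\<integral>\<^sup>+u0. \<integral>\<^sup>+v. indicator (A 0) u0 * G v \<partial>expm b \<partial>expm a)"
    by (rule nn_integral_burke[OF ab, of "\<lambda>u v. indicator (A 0) u * G v"]) measurable
  also have "\<dots> = (\<integral>\<^sup>+v. G v \<partial>expm b) * emeasure (expm a) (A 0)"
    by (simp add: nn_integral_cmult nn_integral_multc mult.commute)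
  also have "(\<integral>\<^sup>+v. G v \<partial>expm b) = (\<Prod>i<m. emeasure (expm a) (A (Suc i)))"
    unfolding G_def by (rule Suc.IH) (rule A)
  finally show ?case by (simp add: prod.lessThan_Suc_shift mult.commute del: prod.lessThan_Suc)
qed

lemma nn_integral_queue_row:
  assumes ab: "0 < a" "0 < b" "a + b = 1" and h[measurable]: "h \<in> borel_measurable seqs"
  shows "(\<integral>\<^sup>+u. \<integral>\<^sup>+v. \<integral>\<^sup>+x. h (\<lambda>i. queue_row i v u x) \<partial>clock \<partial>expm b \<partial>iid (expm a)) = (\<integral>\<^sup>+u. h u \<partial>iid (expm a))"
proof -
  interpret C: prob_space clock by (rule prob_space_clock)
  interpret A: prob_space "iid (expm a)" by (intro prob_space_iid prob_space_expm ab)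
  interpret B: prob_space "expm b" by (intro prob_space_expm ab)
  interpret AC: pair_prob_space "iid (expm a)" clock ..
  interpret BAC: pair_prob_space "expm b" "iid (expm a) \<Otimes>\<^sub>M clock" ..
  interpret AB: pair_sigma_finite "iid (expm a)" "expm b" ..
  let ?M = "expm b \<Otimes>\<^sub>M (iid (expm a) \<Otimes>\<^sub>M clock)"
  let ?q = "\<lambda>z i. queue_row i (fst z) (fst (snd z)) (snd (snd z))"
  have q[measurable]: "?q \<in> measurable ?M (iid (expm a))"
  proof -
    have 1: "(\<lambda>z. fst (snd z)) \<in> measurable ?M (iid (expm a))" "(\<lambda>z. snd (snd z)) \<in> measurable ?M clock"
      by (rule measurable_compose[OF measurable_snd], simp_all only: measurable_fst measurable_snd)+
    have "fst \<in> measurable ?M (expm b)" by (rule measurable_fst)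
    then have "fst \<in> borel_measurable ?M" by (simp cong: measurable_cong_sets)
    then have "?q \<in> measurable ?M seqs"
      by (rule measurable_queue_row_seq) (use 1 in \<open>simp_all only: measurable_iid_expm measurable_clock\<close>)
    then show ?thesis by (simp only: measurable_iid_expm)
  qed
  have int: "(\<integral>\<^sup>+z. k (?q z) \<partial>?M) = (\<integral>\<^sup>+v. \<integral>\<^sup>+u. \<integral>\<^sup>+x. k (\<lambda>i. queue_row i v u x) \<partial>clock \<partial>iid (expm a) \<partial>expm b)"
    if k[measurable]: "k \<in> borel_measurable (iid (expm a))" for k
  proof -
    have "(\<integral>\<^sup>+z. k (?q z) \<partial>?M) = (\<integral>\<^sup>+v. \<integral>\<^sup>+z. k (?q (v, z)) \<partial>(iid (expm a) \<Otimes>\<^sub>M clock) \<partial>expm b)"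
      by (rule AC.nn_integral_fst[symmetric]) measurable
    also have "\<dots> = (\<integral>\<^sup>+v. \<integral>\<^sup>+u. \<integral>\<^sup>+x. k (?q (v, u, x)) \<partial>clock \<partial>iid (expm a) \<partial>expm b)"
    proof (rule nn_integral_cong)
      fix v assume v: "v \<in> space (expm b)"
      have "(\<lambda>z. k (?q (v, z))) \<in> borel_measurable (iid (expm a) \<Otimes>\<^sub>M clock)"
        by (rule measurable_compose[OF measurable_compose[OF measurable_Pair1'[OF v] q] k])
      from C.nn_integral_fst[OF this] show "(\<integral>\<^sup>+z. k (?q (v, z)) \<partial>(iid (expm a) \<Otimes>\<^sub>M clock)) =
         (\<integral>\<^sup>+u. \<integral>\<^sup>+x. k (?q (v, u, x)) \<partial>clock \<partial>iid (expm a))" by simp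
    qed
    finally show ?thesis by simp
  qed
  have law: "distr ?M (iid (expm a)) ?q = iid (expm a)"
  proof (rule iid_eqI)
    show "prob_space (expm a)" by (rule prob_space_expm) fact
    fix m :: nat and A :: "nat \<Rightarrow> real set" assume A: "\<And>i. A i \<in> sets (expm a)"
    have k: "(\<lambda>\<omega>. \<Prod>i<m. indicator (A i) (\<omega> i) :: ennreal) \<in> borel_measurable (iid (expm a))"
      using A by measurable
    have "(\<integral>\<^sup>+\<omega>. (\<Prod>i<m. indicator (A i) (\<omega> i)) \<partial>distr ?M (iid (expm a)) ?q) =
        (\<integral>\<^sup>+z. (\<Prod>i<m. indicator (A i) (?q z i)) \<partial>?M)"
      using k by (subst nn_integral_distr[OF q]) auto
    also have "\<dots> = (\<Prod>i<m. emeasure (expm a) (A i))"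
      using int[OF k] nn_integral_queue_row_cylinder[OF ab, of A m] A by simp
    finally show "(\<integral>\<^sup>+\<omega>. (\<Prod>i<m. indicator (A i) (\<omega> i)) \<partial>distr ?M (iid (expm a)) ?q) = (\<Prod>i<m. emeasure (expm a) (A i))" .
  qed simp
  have h': "h \<in> borel_measurable (iid (expm a))" by simp
  have "(\<integral>\<^sup>+u. \<integral>\<^sup>+v. \<integral>\<^sup>+x. h (\<lambda>i. queue_row i v u x) \<partial>clock \<partial>expm b \<partial>iid (expm a)) =
      (\<integral>\<^sup>+v. \<integral>\<^sup>+u. \<integral>\<^sup>+x. h (\<lambda>i. queue_row i v u x) \<partial>clock \<partial>iid (expm a) \<partial>expm b)"
    by (rule AB.Fubini'[symmetric]) (measurable; simp)
  also have "\<dots> = (\<integral>\<^sup>+z. h (?q z) \<partial>?M)" by (rule int[OF h', symmetric])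
  also have "\<dots> = (\<integral>\<^sup>+u. h u \<partial>distr ?M (iid (expm a)) ?q)"
    by (rule nn_integral_distr[OF q, symmetric]) simp
  finally show ?thesis by (simp only: law)
qed

section \<open>Variance of sums of independent exponentials\<close>

lemma nn_integral_expm_square:
  assumes "0 < a"
  shows "(\<integral>\<^sup>+x. ennreal ((c + (x - 1 / a))\<^sup>2) \<partial>expm a) = ennreal (c\<^sup>2 + 1 / a\<^sup>2)"
proof -
  interpret E: prob_space "expm a" by (rule prob_space_expm) fact
  have ex: "E.expectation (\<lambda>x. x) = 1 / a"
    by (rule E.exponential_distributed_expectation[OF assms distributed_expm[OF assms]])
  have var: "E.expectation (\<lambda>x. (x - 1 / a)\<^sup>2) = 1 / a\<^sup>2"
    using E.exponential_distributed_variance[OF assms distributed_expm[OF assms]] by (simp add: ex)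
  \<comment> \<open>A function that is not integrable would have Bochner integral \<open>0\<close>,
    against the positive value just found.\<close>
  have i1: "integrable (expm a) (\<lambda>x. x)"
  proof (rule ccontr)
    assume "\<not> integrable (expm a) (\<lambda>x. x)"
    then show False using ex assms by (simp add: not_integrable_integral_eq)
  qed
  have i2: "integrable (expm a) (\<lambda>x. (x - 1 / a)\<^sup>2)"
  proof (rule ccontr)
    assume "\<not> integrable (expm a) (\<lambda>x. (x - 1 / a)\<^sup>2)"
    then show False using var assms by (simp add: not_integrable_integral_eq)
  qed
  have eq: "(\<lambda>x. (c + (x - 1 / a))\<^sup>2) = (\<lambda>x. c\<^sup>2 + (2 * c * (x - 1 / a) + (x - 1 / a)\<^sup>2))"
    by (auto simp: power2_sum fun_eq_iff)
  have i: "integrable (expm a) (\<lambda>x. (c + (x - 1 / a))\<^sup>2)" unfolding eq using i1 i2 by auto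
  have "E.expectation (\<lambda>x. (c + (x - 1 / a))\<^sup>2) = c\<^sup>2 + 1 / a\<^sup>2"
    unfolding eq using i1 i2 E.prob_space by (simp add: var ex)
  then show ?thesis using nn_integral_eq_integral[OF i] by simp
qed

text \<open>The free shift \<open>c\<close> absorbs the centred terms already split off, so no
  covariances have to be computed.\<close>

lemma nn_integral_iid_square:
  assumes a: "0 < a"
  shows "(\<integral>\<^sup>+\<omega>. ennreal ((c + (\<Sum>i<m. \<omega> i - 1 / a))\<^sup>2) \<partial>iid (expm a)) = ennreal (c\<^sup>2 + m / a\<^sup>2)"
proof (induction m arbitrary: c)
  case 0
  interpret prob_space "iid (expm a)" by (intro prob_space_iid prob_space_expm a)
  show ?case by (simp add: emeasure_space_1)
next
  case (Suc m)
  interpret E: prob_space "expm a" by (rule prob_space_expm) fact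
  have coord: "(\<lambda>\<omega>. \<omega> i) \<in> borel_measurable seqs" for i :: nat
    by (rule measurable_component_singleton) simp
  have "(\<integral>\<^sup>+\<omega>. ennreal ((c + (\<Sum>i<Suc m. \<omega> i - 1 / a))\<^sup>2) \<partial>iid (expm a)) =
    (\<integral>\<^sup>+x. \<integral>\<^sup>+\<omega>. ennreal ((c + (\<Sum>i<Suc m. case_nat x \<omega> i - 1 / a))\<^sup>2) \<partial>iid (expm a) \<partial>expm a)"
  proof (rule nn_integral_iid_peel[OF E.prob_space_axioms])
    have "(\<lambda>\<omega>. \<Sum>i<Suc m. \<omega> i - 1 / a) \<in> borel_measurable seqs"
      by (intro borel_measurable_sum borel_measurable_diff coord) simp
    then show "(\<lambda>\<omega>. ennreal ((c + (\<Sum>i<Suc m. \<omega> i - 1 / a))\<^sup>2)) \<in> borel_measurable (iid (expm a))"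
      by (simp del: sum.lessThan_Suc)
  qed
  also have "\<dots> = (\<integral>\<^sup>+x. \<integral>\<^sup>+\<omega>. ennreal (((c + (x - 1 / a)) + (\<Sum>i<m. \<omega> i - 1 / a))\<^sup>2) \<partial>iid (expm a) \<partial>expm a)"
    by (simp add: sum.lessThan_Suc_shift add.assoc del: sum.lessThan_Suc)
  also have "\<dots> = (\<integral>\<^sup>+x. ennreal ((c + (x - 1 / a))\<^sup>2) + ennreal (m / a\<^sup>2) \<partial>expm a)"
    unfolding Suc.IH by (intro nn_integral_cong ennreal_plus) auto
  also have "\<dots> = (\<integral>\<^sup>+x. ennreal ((c + (x - 1 / a))\<^sup>2) \<partial>expm a) + (\<integral>\<^sup>+x. ennreal (m / a\<^sup>2) \<partial>expm a)"
    by (rule nn_integral_add) simp_all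
  also have "\<dots> = ennreal (c\<^sup>2 + 1 / a\<^sup>2) + ennreal (m / a\<^sup>2)"
    using E.emeasure_space_1 by (simp only: nn_integral_expm_square[OF a]) simp
  also have "\<dots> = ennreal (c\<^sup>2 + Suc m / a\<^sup>2)"
    by (subst ennreal_plus[symmetric]) (auto simp: add_divide_distrib add.assoc)
  finally show ?case .
qed

lemma chebyshev_iid:
  assumes a: "0 < a" and \<epsilon>: "0 < \<epsilon>"
  shows "emeasure (iid (expm a)) {\<omega>\<in>space (iid (expm a)). \<epsilon> < \<bar>(\<Sum>i<m. \<omega> i) - m / a\<bar>} \<le> ennreal (m / a\<^sup>2 / \<epsilon>\<^sup>2)"
proof -
  let ?M = "iid (expm a)"
  let ?B = "{\<omega>\<in>space ?M. \<epsilon> < \<bar>(\<Sum>i<m. \<omega> i) - m / a\<bar>}"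
  have "(\<lambda>\<omega>. \<Sum>i<m. \<omega> i) \<in> borel_measurable seqs"
    by (intro borel_measurable_sum measurable_component_singleton) simp
  then have sm: "(\<lambda>\<omega>. \<Sum>i<m. \<omega> i) \<in> borel_measurable ?M" by simp
  have B: "?B \<in> sets ?M" by (rule borel_measurable_less) (use sm in auto)
  have sum: "(\<Sum>i<m. \<omega> i - 1 / a) = (\<Sum>i<m. \<omega> i) - m / a" for \<omega> :: "nat \<Rightarrow> real"
    by (simp add: sum_subtractf)
  have "ennreal (\<epsilon>\<^sup>2) * emeasure ?M ?B = (\<integral>\<^sup>+\<omega>. ennreal (\<epsilon>\<^sup>2) * indicator ?B \<omega> \<partial>?M)"
    using B by (simp add: nn_integral_cmult_indicator)
  also have "\<dots> \<le> (\<integral>\<^sup>+\<omega>. ennreal ((0 + (\<Sum>i<m. \<omega> i - 1 / a))\<^sup>2) \<partial>?M)"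
  proof (rule nn_integral_mono)
    fix \<omega>
    show "ennreal (\<epsilon>\<^sup>2) * indicator ?B \<omega> \<le> ennreal ((0 + (\<Sum>i<m. \<omega> i - 1 / a))\<^sup>2)"
    proof (cases "\<omega> \<in> ?B")
      case True
      then have "\<epsilon>\<^sup>2 \<le> (0 + (\<Sum>i<m. \<omega> i - 1 / a))\<^sup>2"
        unfolding sum using \<epsilon> by (subst abs_le_square_iff[symmetric]) auto
      then show ?thesis using True by (simp add: ennreal_leI)
    qed simp
  qed
  also have "\<dots> = ennreal (m / a\<^sup>2)" by (subst nn_integral_iid_square[OF a]) simp
  finally have "ennreal (\<epsilon>\<^sup>2) * emeasure ?M ?B \<le> ennreal (m / a\<^sup>2)" .
  then have "ennreal (1 / \<epsilon>\<^sup>2) * (ennreal (\<epsilon>\<^sup>2) * emeasure ?M ?B) \<le> ennreal (1 / \<epsilon>\<^sup>2) * ennreal (m / a\<^sup>2)"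
    by (rule mult_left_mono) simp
  also have "ennreal (1 / \<epsilon>\<^sup>2) * (ennreal (\<epsilon>\<^sup>2) * emeasure ?M ?B) = emeasure ?M ?B"
    using \<epsilon> by (simp add: mult.assoc[symmetric] flip: ennreal_mult)
  also have "ennreal (1 / \<epsilon>\<^sup>2) * ennreal (m / a\<^sup>2) = ennreal (m / a\<^sup>2 / \<epsilon>\<^sup>2)"
    using \<epsilon> by (subst ennreal_mult[symmetric]) auto
  finally show ?thesis .
qed

section \<open>Last passage times with boundary weights\<close>

fun lpp :: "(nat \<Rightarrow> nat \<Rightarrow> real) \<Rightarrow> nat \<Rightarrow> nat \<Rightarrow> real" where
  "lpp w 0 0 = 0"
| "lpp w 0 (Suc j) = lpp w 0 j + w 0 (Suc j)"
| "lpp w (Suc r) 0 = lpp w r 0 + w (Suc r) 0"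
| "lpp w (Suc r) (Suc j) = max (lpp w r (Suc j)) (lpp w (Suc r) j) + w (Suc r) (Suc j)"

definition bulk :: "(nat \<Rightarrow> nat \<Rightarrow> real) \<Rightarrow> nat \<Rightarrow> nat \<Rightarrow> real" where
  "bulk e r j = (if r = 0 \<or> j = 0 then 0 else e r j)"

text \<open>Boundary weights of rates \<open>1 - \<rho>\<close> and \<open>\<rho>\<close>, whose sum
  one is the condition of the Burke property. Scaling one array \<open>e\<close> of unit rate allows
  \<open>bulk\<close> and models with different parameters to be compared pathwise.\<close>

definition stat :: "real \<Rightarrow> (nat \<Rightarrow> nat \<Rightarrow> real) \<Rightarrow> nat \<Rightarrow> nat \<Rightarrow> real" where
  "stat \<rho> e r j = (if r = 0 then e r j / (1 - \<rho>) else if j = 0 then e r j / \<rho> else e r j)"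

lemma bulk_simps[simp]: "bulk e 0 j = 0" "bulk e r 0 = 0" "bulk e (Suc r) (Suc j) = e (Suc r) (Suc j)"
  by (simp_all add: bulk_def)

lemma stat_simps[simp]: "stat \<rho> e 0 j = e 0 j / (1 - \<rho>)" "stat \<rho> e (Suc r) 0 = e (Suc r) 0 / \<rho>"
  "stat \<rho> e (Suc r) (Suc j) = e (Suc r) (Suc j)"
  by (simp_all add: stat_def)

lemma lpp_mono: "(\<And>r j. w r j \<le> w' r j) \<Longrightarrow> lpp w r j \<le> lpp w' r j"
  by (induction w r j rule: lpp.induct) (auto intro!: add_mono max.mono)

lemma lpp_nonneg: "(\<And>r j. 0 \<le> w r j) \<Longrightarrow> 0 \<le> lpp w r j"
  by (induction w r j rule: lpp.induct) (auto simp: le_max_iff_disj intro!: add_nonneg_nonneg)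

lemma lpp_bulk_0[simp]: "lpp (bulk e) 0 j = 0" "lpp (bulk e) r 0 = 0"
proof -
  show "lpp (bulk e) 0 j = 0" by (induction j) simp_all
  show "lpp (bulk e) r 0 = 0" by (induction r) simp_all
qed

lemma lpp_row_Suc: "lpp_row (Suc k) c s e = max (lpp_row k c s e) (s (Suc k)) + e (Suc k)"
proof (induction k arbitrary: c s e)
  case (Suc k)
  let ?r = "\<lambda>k. lpp_row k (max c (s 0) + e 0) (\<lambda>i. s (Suc i)) (\<lambda>i. e (Suc i))"
  have "lpp_row (Suc (Suc k)) c s e = ?r (Suc k)" by (rule lpp_row.simps(2))
  also have "\<dots> = max (?r k) (s (Suc (Suc k))) + e (Suc (Suc k))" by (rule Suc.IH)
  also have "?r k = lpp_row (Suc k) c s e" by simp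
  finally show ?case .
qed simp

lemma lpp_rows_eq_lpp: "lpp_rows (\<lambda>r j. e (Suc r) (Suc j)) r j = lpp (bulk e) r (Suc j)"
proof (induction r arbitrary: j)
  case 0
  show ?case by simp
next
  case (Suc r)
  show ?case
  proof (induction j)
    case 0
    then show ?case using Suc[of 0] by (simp add: max.commute)
  next
    case (Suc j)
    then show ?case using \<open>\<And>j. lpp_rows (\<lambda>r j. e (Suc r) (Suc j)) r j = lpp (bulk e) r (Suc j)\<close>[of "Suc j"]
      by (simp add: lpp_row_Suc max.commute del: lpp_row.simps)
  qed
qed

text \<open>Subtracting either argument from \<open>max p q + x\<close> leaves \<open>x\<close> plus
  the positive part of a difference, which is the rule of \<open>queue_row\<close>.\<close>

lemma queue_row_increment:
  assumes "H' 0 = H 0 + v" "\<And>i. H' (Suc i) = max (H (Suc i)) (H' i) + x i"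
  shows "queue_row i v (\<lambda>i. H (Suc i) - H i) x = H' (Suc i) - H' i"
  using assms
proof (induction i arbitrary: v x H H')
  case (Suc i)
  show ?case unfolding queue_row.simps
    by (rule Suc.IH[of "\<lambda>i. H' (Suc i)" "\<lambda>i. H (Suc i)"]) (auto simp: Suc.prems)
qed (auto simp: max_def)

definition increments :: "real \<Rightarrow> (nat \<Rightarrow> real) \<Rightarrow> (nat \<Rightarrow> real) \<Rightarrow> nat \<Rightarrow> real" where
  "increments \<rho> u r = (\<lambda>i. queue_row i (r 0 / \<rho>) u (\<lambda>i. r (Suc i)))"

lemma rows_increments:
  "rows (increments \<rho>) (\<lambda>i. e 0 (Suc i) / (1 - \<rho>)) (\<lambda>r. e (Suc r)) n =
    (\<lambda>i. lpp (stat \<rho> e) n (Suc i) - lpp (stat \<rho> e) n i)"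
proof (induction n)
  case 0
  show ?case by simp
next
  case (Suc n)
  have "rows (increments \<rho>) (\<lambda>i. e 0 (Suc i) / (1 - \<rho>)) (\<lambda>r. e (Suc r)) (Suc n) =
      increments \<rho> (\<lambda>i. lpp (stat \<rho> e) n (Suc i) - lpp (stat \<rho> e) n i) (e (Suc n))"
    by (simp only: rows.simps Suc)
  also have "\<dots> = (\<lambda>i. lpp (stat \<rho> e) (Suc n) (Suc i) - lpp (stat \<rho> e) (Suc n) i)"
    unfolding increments_def by (rule ext, rule queue_row_increment) simp_all
  finally show ?case .
qed

lemma measurable_increments:
  assumes "f \<in> measurable M seqs" "g \<in> measurable M seqs"
  shows "(\<lambda>x. increments \<rho> (f x) (g x)) \<in> measurable M seqs"
proof -
  have [measurable]: "(\<lambda>x. g x 0) \<in> borel_measurable M" by (rule measurable_seq_nth) fact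
  show ?thesis unfolding increments_def
    by (rule measurable_queue_row_seq) (use assms in measurable)
qed

text \<open>The increments of successive rows form a Markov chain, and the Burke property makes
  \<open>iid (expm (1 - \<rho>))\<close> its stationary law.\<close>

lemma nn_integral_rows_increments:
  assumes \<rho>: "0 < \<rho>" "\<rho> < 1" and f[measurable]: "f \<in> borel_measurable seqs"
  shows "(\<integral>\<^sup>+u. \<integral>\<^sup>+w. f (rows (increments \<rho>) u w n) \<partial>grid \<partial>iid (expm (1 - \<rho>))) = (\<integral>\<^sup>+u. f u \<partial>iid (expm (1 - \<rho>)))"
proof (induction n)
  case 0
  interpret G: prob_space grid by (rule prob_space_grid)
  show ?case by (simp add: G.emeasure_space_1)
next
  case (Suc n)
  interpret G: prob_space grid by (rule prob_space_grid)
  interpret C: prob_space clock by (rule prob_space_clock)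
  have E: "prob_space (expm 1)" by (rule prob_space_expm) simp
  define g where "g s = (\<integral>\<^sup>+w. f (rows (increments \<rho>) s w n) \<partial>grid)" for s
  have "(\<lambda>z. rows (increments \<rho>) (fst z) (snd z) n) \<in> measurable (seqs \<Otimes>\<^sub>M grid) seqs"
    by (rule measurable_rows[where N=clock]) (auto intro: measurable_increments)
  then have "(\<lambda>(s, w). f (rows (increments \<rho>) s w n)) \<in> borel_measurable (seqs \<Otimes>\<^sub>M grid)"
    unfolding split_beta' by (rule measurable_compose) fact
  then have g[measurable]: "g \<in> borel_measurable seqs"
    unfolding g_def[abs_def] by (rule G.borel_measurable_nn_integral)
  have sh: "rows F s (case_nat x w) (Suc n) = rows F (F s x) w n"
    for F :: "(nat \<Rightarrow> real) \<Rightarrow> (nat \<Rightarrow> real) \<Rightarrow> (nat \<Rightarrow> real)" and s x w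
    by (subst rows_Suc_shift) simp
  have row: "(\<integral>\<^sup>+w. f (rows (increments \<rho>) u w (Suc n)) \<partial>grid) =
      (\<integral>\<^sup>+v. \<integral>\<^sup>+x. g (\<lambda>i. queue_row i v u x) \<partial>clock \<partial>expm \<rho>)" for u
  proof -
    have "(\<lambda>w. rows (increments \<rho>) u w (Suc n)) \<in> measurable grid seqs"
      by (rule measurable_rows[where N=clock]) (auto intro: measurable_increments simp: space_PiM)
    then have "(\<integral>\<^sup>+w. f (rows (increments \<rho>) u w (Suc n)) \<partial>grid) =
        (\<integral>\<^sup>+r. \<integral>\<^sup>+w. f (rows (increments \<rho>) u (case_nat r w) (Suc n)) \<partial>grid \<partial>clock)"
      by (intro nn_integral_iid_peel[OF prob_space_clock] measurable_compose[OF _ f])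
    also have "\<dots> = (\<integral>\<^sup>+r. g (increments \<rho> u r) \<partial>clock)" unfolding sh g_def ..
    also have "\<dots> = (\<integral>\<^sup>+v. \<integral>\<^sup>+x. g (increments \<rho> u (case_nat v x)) \<partial>clock \<partial>expm 1)"
    proof (rule nn_integral_iid_peel[OF E])
      have "(\<lambda>r. increments \<rho> u r) \<in> measurable clock seqs"
        by (rule measurable_increments) (auto simp: space_PiM)
      then show "(\<lambda>r. g (increments \<rho> u r)) \<in> borel_measurable clock" by (rule measurable_compose) fact
    qed
    also have "\<dots> = (\<integral>\<^sup>+v. \<integral>\<^sup>+x. g (\<lambda>i. queue_row i (v / \<rho>) u x) \<partial>clock \<partial>expm 1)"
      by (simp add: increments_def)
    also have "\<dots> = (\<integral>\<^sup>+v. \<integral>\<^sup>+x. g (\<lambda>i. queue_row i v u x) \<partial>clock \<partial>distr (expm 1) (expm \<rho>) (\<lambda>v. v / \<rho>))"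
    proof -
      have "(\<lambda>z i. queue_row i (fst z) u (snd z)) \<in> measurable (borel \<Otimes>\<^sub>M clock) seqs"
        by (rule measurable_queue_row_seq[OF measurable_fst _ measurable_snd[of borel clock, unfolded measurable_clock]])
           (simp add: space_PiM)
      from measurable_compose[OF this g]
      have "(\<lambda>v. \<integral>\<^sup>+x. g (\<lambda>i. queue_row i v u x) \<partial>clock) \<in> borel_measurable borel"
        by (intro C.borel_measurable_nn_integral) (simp add: split_beta')
      then show ?thesis by (subst nn_integral_distr) (simp_all cong: measurable_cong_sets)
    qed
    finally show ?thesis by (simp only: distr_expm_scale[OF \<rho>(1)])
  qed
  have "(\<integral>\<^sup>+u. \<integral>\<^sup>+w. f (rows (increments \<rho>) u w (Suc n)) \<partial>grid \<partial>iid (expm (1 - \<rho>))) = (\<integral>\<^sup>+u. g u \<partial>iid (expm (1 - \<rho>)))"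
    unfolding row by (rule nn_integral_queue_row) (use \<rho> g in auto)
  then show ?case unfolding g_def Suc .
qed

lemma distr_eqI_nn_integral:
  assumes X: "X \<in> measurable M N" and "\<And>f. f \<in> borel_measurable N \<Longrightarrow> (\<integral>\<^sup>+x. f (X x) \<partial>M) = (\<integral>\<^sup>+y. f y \<partial>N)"
  shows "distr M N X = N"
proof (rule measure_eqI)
  fix A assume "A \<in> sets (distr M N X)"
  then have A: "A \<in> sets N" by simp
  have "emeasure (distr M N X) A = (\<integral>\<^sup>+y. indicator A y \<partial>distr M N X)" using A by simp
  also have "\<dots> = (\<integral>\<^sup>+x. indicator A (X x) \<partial>M)" using A by (intro nn_integral_distr X) simp
  also have "\<dots> = (\<integral>\<^sup>+y. indicator A y \<partial>N)" using A by (intro assms(2)) simp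
  also have "\<dots> = emeasure N A" using A by simp
  finally show "emeasure (distr M N X) A = emeasure N A" .
qed simp

lemma
  fixes n :: nat
  assumes \<rho>: "0 < \<rho>" "\<rho> < 1"
  defines "X \<equiv> \<lambda>e i. lpp (stat \<rho> e) n (Suc i) - lpp (stat \<rho> e) n i"
  shows measurable_lpp_increments: "X \<in> measurable grid (iid (expm (1 - \<rho>)))"
    and distr_lpp_increments: "distr grid (iid (expm (1 - \<rho>))) X = iid (expm (1 - \<rho>))"
proof -
  interpret G: prob_space grid by (rule prob_space_grid)
  let ?a = "1 - \<rho>"
  let ?R = "\<lambda>e. rows (increments \<rho>) (\<lambda>i. e 0 (Suc i) / ?a) (\<lambda>r. e (Suc r)) n"
  have X_eq: "X = ?R" unfolding X_def rows_increments ..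
  have sc: "(\<lambda>x. x / ?a) \<in> measurable (expm 1) (expm ?a)" by simp
  have scale: "(\<lambda>\<omega> i. \<omega> (Suc i) / ?a) \<in> measurable seqs seqs"
    by (rule measurable_seqI) simp
  have R: "?R \<in> measurable grid seqs"
  proof (rule measurable_rows[where N=clock])
    have "(\<lambda>e. e 0) \<in> measurable grid clock" by (rule measurable_component_singleton) simp
    then have "(\<lambda>e. e 0) \<in> measurable grid seqs" by (simp only: measurable_clock)
    from measurable_compose[OF this scale]
    show "(\<lambda>e i. e 0 (Suc i) / ?a) \<in> measurable grid seqs" .
    show "(\<lambda>e r. e (Suc r)) \<in> measurable grid grid" by (rule measurable_seq_reindex) simp
  qed (auto intro: measurable_increments)
  then show X: "X \<in> measurable grid (iid (expm ?a))" by (simp only: X_eq measurable_iid_expm)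
  show "distr grid (iid (expm ?a)) X = iid (expm ?a)"
  proof (rule distr_eqI_nn_integral[OF X])
    fix f :: "(nat \<Rightarrow> real) \<Rightarrow> ennreal" assume "f \<in> borel_measurable (iid (expm ?a))"
    then have f: "f \<in> borel_measurable seqs" by simp
    define h where "h u = (\<integral>\<^sup>+w. f (rows (increments \<rho>) u w n) \<partial>grid)" for u
    have "(\<lambda>z. rows (increments \<rho>) (fst z) (snd z) n) \<in> measurable (seqs \<Otimes>\<^sub>M grid) seqs"
      by (rule measurable_rows[where N=clock]) (auto intro: measurable_increments)
    then have "(\<lambda>(s, w). f (rows (increments \<rho>) s w n)) \<in> borel_measurable (seqs \<Otimes>\<^sub>M grid)"
      unfolding split_beta' by (rule measurable_compose) fact
    then have h: "h \<in> borel_measurable seqs"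
      unfolding h_def[abs_def] by (rule G.borel_measurable_nn_integral)
    have "(\<integral>\<^sup>+e. f (X e) \<partial>grid) = (\<integral>\<^sup>+e0. \<integral>\<^sup>+w. f (?R (case_nat e0 w)) \<partial>grid \<partial>clock)"
      unfolding X_eq by (rule nn_integral_iid_peel[OF prob_space_clock measurable_compose[OF R f]])
    also have "\<dots> = (\<integral>\<^sup>+e0. h (\<lambda>i. e0 (Suc i) / ?a) \<partial>clock)" by (simp add: h_def)
    also have "\<dots> = (\<integral>\<^sup>+e0. h (\<lambda>i. e0 i / ?a) \<partial>clock)"
    proof (rule nn_integral_iid_tl)
      have "(\<lambda>\<omega> i. \<omega> i / ?a) \<in> measurable seqs seqs"
        by (rule measurable_seqI) simp
      from measurable_compose[OF this h] show "(\<lambda>\<omega>. h (\<lambda>i. \<omega> i / ?a)) \<in> borel_measurable clock" by simp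
    qed (simp add: prob_space_expm)
    also have "\<dots> = (\<integral>\<^sup>+u. h u \<partial>iid (expm ?a))"
      by (rule nn_integral_iid_map[OF _ sc distr_expm_scale]) (use \<rho> h in \<open>auto simp: prob_space_expm\<close>)
    also have "\<dots> = (\<integral>\<^sup>+u. f u \<partial>iid (expm ?a))"
      unfolding h_def by (rule nn_integral_rows_increments[OF \<rho> f])
    finally show "(\<integral>\<^sup>+e. f (X e) \<partial>grid) = (\<integral>\<^sup>+u. f u \<partial>iid (expm ?a))" .
  qed
qed

lemma
  assumes \<rho>: "0 < \<rho>"
  defines "Y \<equiv> \<lambda>(e :: nat \<Rightarrow> nat \<Rightarrow> real) r. e (Suc r) 0 / \<rho>"
  shows measurable_lpp_left: "Y \<in> measurable grid (iid (expm \<rho>))"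
    and distr_lpp_left: "distr grid (iid (expm \<rho>)) Y = iid (expm \<rho>)"
proof -
  have E: "prob_space (expm 1)" by (rule prob_space_expm) simp
  let ?f = "\<lambda>\<omega> :: nat \<Rightarrow> real. \<omega> 0 / \<rho>"
  have "(\<lambda>\<omega>. \<omega> 0) \<in> borel_measurable seqs" by (rule measurable_component_singleton) simp
  then have "?f \<in> borel_measurable seqs" by simp
  then have f: "?f \<in> measurable clock (expm \<rho>)" by (simp cong: measurable_cong_sets)
  have law: "distr clock (expm \<rho>) ?f = expm \<rho>"
  proof (rule distr_eqI_nn_integral[OF f])
    fix g :: "real \<Rightarrow> ennreal" assume "g \<in> borel_measurable (expm \<rho>)"
    then have g[measurable]: "g \<in> borel_measurable borel" by (simp cong: measurable_cong_sets)
    have "(\<integral>\<^sup>+\<omega>. g (\<omega> 0 / \<rho>) \<partial>clock) = (\<integral>\<^sup>+x. g (x / \<rho>) \<partial>expm 1)"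
      by (rule nn_integral_iid_hd[OF E]) simp
    also have "\<dots> = (\<integral>\<^sup>+x. g x \<partial>distr (expm 1) (expm \<rho>) (\<lambda>x. x / \<rho>))"
      by (rule nn_integral_distr[symmetric]) simp_all
    finally show "(\<integral>\<^sup>+\<omega>. g (\<omega> 0 / \<rho>) \<partial>clock) = (\<integral>\<^sup>+x. g x \<partial>expm \<rho>)" by (simp only: distr_expm_scale[OF \<rho>])
  qed
  have col: "(\<lambda>e r. ?f (e r)) \<in> measurable grid (iid (expm \<rho>))"
  proof (rule measurable_seqI)
    fix r
    have "(\<lambda>e. e r) \<in> measurable grid clock" by (rule measurable_component_singleton) simp
    from measurable_compose[OF this f] show "(\<lambda>e. ?f (e r)) \<in> measurable grid (expm \<rho>)" .
  qed
  have tl: "(\<lambda>e r. e (Suc r)) \<in> measurable grid grid" by (rule measurable_seq_reindex) simp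
  show Y: "Y \<in> measurable grid (iid (expm \<rho>))"
    using measurable_compose[OF tl col] by (simp add: Y_def)
  show "distr grid (iid (expm \<rho>)) Y = iid (expm \<rho>)"
  proof (rule distr_eqI_nn_integral[OF Y])
    fix g :: "(nat \<Rightarrow> real) \<Rightarrow> ennreal" assume g: "g \<in> borel_measurable (iid (expm \<rho>))"
    have "(\<integral>\<^sup>+e. g (Y e) \<partial>grid) = (\<integral>\<^sup>+e. g (\<lambda>r. ?f (e r)) \<partial>grid)"
      using nn_integral_iid_tl[OF prob_space_clock measurable_compose[OF col g]] by (simp add: Y_def)
    also have "\<dots> = (\<integral>\<^sup>+u. g u \<partial>iid (expm \<rho>))"
      by (rule nn_integral_iid_map[OF prob_space_clock f law g])
    finally show "(\<integral>\<^sup>+e. g (Y e) \<partial>grid) = (\<integral>\<^sup>+u. g u \<partial>iid (expm \<rho>))" .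
  qed
qed

lemma distr_iid_shift:
  assumes N: "prob_space N" shows "distr (iid N) (iid N) (\<lambda>\<omega> i. \<omega> (i + p)) = iid N"
proof (rule distr_eqI_nn_integral)
  show m: "(\<lambda>\<omega> i. \<omega> (i + p)) \<in> measurable (iid N) (iid N)" for p by (rule measurable_seq_reindex) simp
  fix f :: "(nat \<Rightarrow> 'a) \<Rightarrow> ennreal" assume f: "f \<in> borel_measurable (iid N)"
  show "(\<integral>\<^sup>+\<omega>. f (\<lambda>i. \<omega> (i + p)) \<partial>iid N) = (\<integral>\<^sup>+\<omega>. f \<omega> \<partial>iid N)"
  proof (induction p)
    case (Suc p)
    then show ?case using nn_integral_iid_tl[OF N measurable_compose[OF m f], of p] by simp
  qed simp
qed

lemma
  shows measurable_grid_shift: "(\<lambda>e r j. e (r + p) (j + q)) \<in> measurable grid grid"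
    and distr_grid_shift: "distr grid grid (\<lambda>e r j. e (r + p) (j + q)) = grid"
proof -
  let ?s = "\<lambda>(\<omega> :: nat \<Rightarrow> real) j. \<omega> (j + q)"
  have E: "prob_space (expm 1)" by (rule prob_space_expm) simp
  have s: "?s \<in> measurable clock clock" by (rule measurable_seq_reindex) (simp del: measurable_clock)
  have a: "(\<lambda>e r. e (r + p)) \<in> measurable grid grid" by (rule measurable_seq_reindex) simp
  have b: "(\<lambda>e r. ?s (e r)) \<in> measurable grid grid"
  proof (rule measurable_seqI)
    fix r
    have "(\<lambda>e. e r) \<in> measurable grid clock" by (rule measurable_component_singleton) simp
    from measurable_compose[OF this s] show "(\<lambda>e. ?s (e r)) \<in> measurable grid clock" .
  qed
  show "(\<lambda>e r j. e (r + p) (j + q)) \<in> measurable grid grid"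
    using measurable_compose[OF a b] .
  have "distr grid grid (\<lambda>e r j. e (r + p) (j + q)) = distr (distr grid grid (\<lambda>e r. e (r + p))) grid (\<lambda>e r. ?s (e r))"
    by (subst distr_distr[OF b a]) (simp add: comp_def)
  then show "distr grid grid (\<lambda>e r j. e (r + p) (j + q)) = grid"
    by (simp only: distr_iid_shift[OF prob_space_clock] distr_iid_map[OF prob_space_clock s distr_iid_shift[OF E]])
qed

section \<open>The limit shape\<close>

text \<open>The exceptional events need only be covered by measurable sets, so that no measurability of \<open>P\<close>
  has to be tracked.\<close>

definition whp :: "(real \<Rightarrow> (nat \<Rightarrow> nat \<Rightarrow> real) \<Rightarrow> bool) \<Rightarrow> bool" where
  "whp P \<longleftrightarrow> (\<exists>B. (\<forall>t. B t \<in> sets grid) \<and> (\<forall>\<^sub>F t in at_top. {e\<in>space grid. \<not> P t e} \<subseteq> B t) \<and>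
    ((\<lambda>t. measure grid (B t)) \<longlongrightarrow> 0) at_top)"

lemma whp_mono:
  assumes "whp P" "\<forall>\<^sub>F t in at_top. \<forall>e. P t e \<longrightarrow> Q t e" shows "whp Q"
proof -
  obtain B where B: "\<forall>t. B t \<in> sets grid" "\<forall>\<^sub>F t in at_top. {e\<in>space grid. \<not> P t e} \<subseteq> B t"
    "((\<lambda>t. measure grid (B t)) \<longlongrightarrow> 0) at_top"
    using assms(1) by (auto simp: whp_def)
  have "\<forall>\<^sub>F t in at_top. {e\<in>space grid. \<not> Q t e} \<subseteq> B t"
    using B(2) assms(2) by eventually_elim auto
  then show ?thesis using B by (auto simp: whp_def)
qed

lemma whp_conj:
  assumes "whp P" "whp Q" shows "whp (\<lambda>t e. P t e \<and> Q t e)"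
proof -
  interpret G: prob_space grid by (rule prob_space_grid)
  obtain B where B: "\<forall>t. B t \<in> sets grid" "\<forall>\<^sub>F t in at_top. {e\<in>space grid. \<not> P t e} \<subseteq> B t"
    "((\<lambda>t. measure grid (B t)) \<longlongrightarrow> 0) at_top"
    using assms(1) by (auto simp: whp_def)
  obtain C where C: "\<forall>t. C t \<in> sets grid" "\<forall>\<^sub>F t in at_top. {e\<in>space grid. \<not> Q t e} \<subseteq> C t"
    "((\<lambda>t. measure grid (C t)) \<longlongrightarrow> 0) at_top"
    using assms(2) by (auto simp: whp_def)
  have "((\<lambda>t. measure grid (B t \<union> C t)) \<longlongrightarrow> 0) at_top"
  proof (rule tendsto_sandwich[OF _ _ tendsto_const])
    show "((\<lambda>t. measure grid (B t) + measure grid (C t)) \<longlongrightarrow> 0) at_top"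
      using tendsto_add[OF B(3) C(3)] by simp
  qed (use B C in \<open>auto intro!: always_eventually measure_Un_le\<close>)
  moreover have "\<forall>\<^sub>F t in at_top. {e\<in>space grid. \<not> (P t e \<and> Q t e)} \<subseteq> B t \<union> C t"
    using B(2) C(2) by eventually_elim auto
  ultimately show ?thesis using B C unfolding whp_def by (intro exI[of _ "\<lambda>t. B t \<union> C t"]) auto
qed

lemma whp_AE:
  assumes "AE e in grid. P e" shows "whp (\<lambda>t. P)"
proof -
  obtain N where N: "{e\<in>space grid. \<not> P e} \<subseteq> N" "emeasure grid N = 0" "N \<in> sets grid"
    using assms by (rule AE_E)
  then show ?thesis unfolding whp_def by (intro exI[of _ "\<lambda>_. N"]) (auto simp: measure_def)
qed

lemma whp_shift:
  assumes "whp P" shows "whp (\<lambda>t e. P t (\<lambda>r j. e (r + p t) (j + q t)))"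
proof -
  let ?s = "\<lambda>t (e :: nat \<Rightarrow> nat \<Rightarrow> real) r j. e (r + p t) (j + q t)"
  obtain B where B: "\<And>t. B t \<in> sets grid" "\<forall>\<^sub>F t in at_top. {e\<in>space grid. \<not> P t e} \<subseteq> B t"
    "((\<lambda>t. measure grid (B t)) \<longlongrightarrow> 0) at_top"
    using assms by (auto simp: whp_def)
  have s: "?s t \<in> measurable grid grid" for t by (rule measurable_grid_shift)
  have "measure grid (?s t -` B t \<inter> space grid) = measure grid (B t)" for t
    using measure_distr[OF s B(1), of t] by (simp add: distr_grid_shift)
  moreover have "\<forall>\<^sub>F t in at_top. {e\<in>space grid. \<not> P t (?s t e)} \<subseteq> ?s t -` B t \<inter> space grid"
    using B(2) by eventually_elim (use measurable_space[OF s] in blast)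
  ultimately show ?thesis using B s
    unfolding whp_def by (intro exI[of _ "\<lambda>t. ?s t -` B t \<inter> space grid"]) (auto intro: measurable_sets)
qed

lemma whp_lim:
  assumes "whp P" and m: "\<And>t. {e\<in>space grid. P t e} \<in> sets grid"
  shows "((\<lambda>t. measure grid {e\<in>space grid. P t e}) \<longlongrightarrow> 1) at_top"
proof -
  interpret G: prob_space grid by (rule prob_space_grid)
  obtain B where B: "\<And>t. B t \<in> sets grid" "\<forall>\<^sub>F t in at_top. {e\<in>space grid. \<not> P t e} \<subseteq> B t"
    "((\<lambda>t. measure grid (B t)) \<longlongrightarrow> 0) at_top"
    using assms by (auto simp: whp_def)
  show ?thesis
  proof (rule tendsto_sandwich[OF _ _ _ tendsto_const])
    show "((\<lambda>t. 1 - measure grid (B t)) \<longlongrightarrow> 1) at_top" using tendsto_diff[OF tendsto_const B(3), of 1] by simp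
    show "\<forall>\<^sub>F t in at_top. 1 - measure grid (B t) \<le> measure grid {e\<in>space grid. P t e}"
      using B(2)
    proof eventually_elim
      case (elim t)
      have "1 - measure grid (B t) = measure grid (space grid - B t)" by (rule G.prob_compl[OF B(1), symmetric])
      also have "\<dots> \<le> measure grid {e\<in>space grid. P t e}"
        using elim by (intro G.finite_measure_mono m) auto
      finally show ?case .
    qed
  qed (auto intro!: always_eventually)
qed

lemma whp_not_lim:
  assumes "whp (\<lambda>t e. \<not> P t e)" and m: "\<And>t. {e\<in>space grid. P t e} \<in> sets grid"
  shows "((\<lambda>t. measure grid {e\<in>space grid. P t e}) \<longlongrightarrow> 0) at_top"
proof -
  interpret G: prob_space grid by (rule prob_space_grid)
  have eq: "{e\<in>space grid. \<not> P t e} = space grid - {e\<in>space grid. P t e}" for t by auto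
  have "((\<lambda>t. measure grid {e\<in>space grid. \<not> P t e}) \<longlongrightarrow> 1) at_top"
    by (rule whp_lim[OF assms(1)]) (use m in \<open>simp add: eq sets.compl_sets\<close>)
  then have "((\<lambda>t. 1 - measure grid {e\<in>space grid. P t e}) \<longlongrightarrow> 1) at_top"
    unfolding eq using G.prob_compl[OF m] by simp
  from tendsto_diff[OF tendsto_const this, of 1] show ?thesis by simp
qed

text \<open>Weak law by Chebyshev's inequality. Only the law of \<open>X t\<close> enters, so the
  row along which the sum is taken may change with \<open>t\<close>.\<close>

lemma whp_iid_sum:
  assumes a: "0 < a" and X: "\<And>t. X t \<in> measurable grid (iid (expm a))" "\<And>t. distr grid (iid (expm a)) (X t) = iid (expm a)"
    and m: "((\<lambda>t. real (m t) / t) \<longlongrightarrow> y) at_top" and \<epsilon>: "0 < \<epsilon>"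
  shows "whp (\<lambda>t e. \<bar>(\<Sum>i<m t. X t e i) - t * (y / a)\<bar> \<le> \<epsilon> * t)"
proof -
  interpret G: prob_space grid by (rule prob_space_grid)
  interpret A: prob_space "iid (expm a)" by (intro prob_space_iid prob_space_expm a)
  \<comment> \<open>Half of the error is for the fluctuation, the other half for replacing
    \<open>m t\<close> by \<open>t * y\<close>. The \<open>max\<close> keeps the Chebyshev threshold
    positive for every \<open>t\<close>.\<close>
  let ?C = "\<lambda>t. {\<omega>\<in>space (iid (expm a)). max (\<epsilon> / 2 * t) 1 < \<bar>(\<Sum>i<m t. \<omega> i) - m t / a\<bar>}"
  let ?B = "\<lambda>t. X t -` ?C t \<inter> space grid"
  have C: "?C t \<in> sets (iid (expm a))" for t
  proof -
    have "(\<lambda>\<omega>. \<Sum>i<m t. \<omega> i) \<in> borel_measurable seqs"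
      by (intro borel_measurable_sum measurable_component_singleton) simp
    then have "(\<lambda>\<omega>. \<Sum>i<m t. \<omega> i) \<in> borel_measurable (iid (expm a))" by simp
    then show ?thesis by (intro borel_measurable_less) auto
  qed
  have meas: "measure grid (?B t) = measure (iid (expm a)) (?C t)" for t
    using measure_distr[OF X(1) C, of t] by (simp add: X(2))
  have le: "measure (iid (expm a)) (?C t) \<le> m t / a\<^sup>2 / (max (\<epsilon> / 2 * t) 1)\<^sup>2" for t
    using chebyshev_iid[OF a, of "max (\<epsilon> / 2 * t) 1" "m t"]
    by (simp add: A.emeasure_eq_measure ennreal_le_iff)
  have "((\<lambda>t. real (m t) / t * (4 / a\<^sup>2 / \<epsilon>\<^sup>2) * (1 / t)) \<longlongrightarrow> y * (4 / a\<^sup>2 / \<epsilon>\<^sup>2) * 0) at_top"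
    by (intro tendsto_mult m tendsto_const tendsto_divide_0[OF tendsto_const] filterlim_at_top_imp_at_infinity filterlim_ident)
  then have lim: "((\<lambda>t. real (m t) / t * (4 / a\<^sup>2 / \<epsilon>\<^sup>2) * (1 / t)) \<longlongrightarrow> 0) at_top" by simp
  have big: "\<forall>\<^sub>F t in at_top. 1 \<le> \<epsilon> / 2 * t \<and> 0 < t"
    using eventually_ge_at_top[of "2 / \<epsilon>"] eventually_gt_at_top[of 0]
    by eventually_elim (use \<epsilon> in \<open>simp add: field_simps\<close>)
  have "((\<lambda>t. measure grid (?B t)) \<longlongrightarrow> 0) at_top"
  proof (rule tendsto_sandwich[OF _ _ tendsto_const lim])
    show "\<forall>\<^sub>F t in at_top. measure grid (?B t) \<le> real (m t) / t * (4 / a\<^sup>2 / \<epsilon>\<^sup>2) * (1 / t)"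
      using big
    proof eventually_elim
      case (elim t)
      have "measure grid (?B t) \<le> m t / a\<^sup>2 / (\<epsilon> / 2 * t)\<^sup>2" unfolding meas using le[of t] elim by (simp add: max_absorb1)
      also have "\<dots> = real (m t) / t * (4 / a\<^sup>2 / \<epsilon>\<^sup>2) * (1 / t)"
        using elim \<epsilon> a by (simp add: field_simps power2_eq_square)
      finally show ?case .
    qed
  qed (auto intro!: always_eventually)
  moreover have "\<forall>\<^sub>F t in at_top. {e\<in>space grid. \<not> \<bar>(\<Sum>i<m t. X t e i) - t * (y / a)\<bar> \<le> \<epsilon> * t} \<subseteq> ?B t"
  proof -
    have "((\<lambda>t. real (m t) / t / a) \<longlongrightarrow> y / a) at_top" using a by (intro tendsto_divide m tendsto_const) auto
    then have "\<forall>\<^sub>F t in at_top. \<bar>real (m t) / t / a - y / a\<bar> < \<epsilon> / 2"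
      using \<epsilon> unfolding dist_real_def[symmetric] by (intro tendstoD) auto
    then show ?thesis using big
    proof eventually_elim
      case (elim t)
      have "m t / a - t * (y / a) = t * (real (m t) / t / a - y / a)"
        using elim by (simp add: right_diff_distrib)
      then have "\<bar>m t / a - t * (y / a)\<bar> = t * \<bar>real (m t) / t / a - y / a\<bar>"
        using elim by (simp add: abs_mult)
      also have "\<dots> \<le> t * (\<epsilon> / 2)" using elim by (intro mult_left_mono) auto
      finally have 1: "\<bar>m t / a - t * (y / a)\<bar> \<le> \<epsilon> / 2 * t" by (simp add: mult.commute)
      show ?case
      proof safe
        fix e assume e: "e \<in> space grid" "\<not> \<bar>(\<Sum>i<m t. X t e i) - t * (y / a)\<bar> \<le> \<epsilon> * t"
        then have "\<epsilon> / 2 * t < \<bar>(\<Sum>i<m t. X t e i) - m t / a\<bar>" using 1 by linarith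
        then show "e \<in> X t -` ?C t" using e elim measurable_space[OF X(1) e(1)] by (auto simp: max_absorb1)
      qed
    qed
  qed
  moreover have "?B t \<in> sets grid" for t using X(1) C by (rule measurable_sets)
  ultimately show ?thesis unfolding whp_def by (intro exI[of _ ?B]) auto
qed

lemma lpp_eq_sum_increments:
  "lpp w n m = (\<Sum>r<n. w (Suc r) 0) + (\<Sum>i<m. lpp w n (Suc i) - lpp w n i)"
proof -
  have "lpp w n 0 = (\<Sum>r<n. w (Suc r) 0)" by (induction n) auto
  then show ?thesis by (simp add: sum_lessThan_telescope)
qed

text \<open>Up the left column and then along row \<open>n t\<close>: each of the two sums has
  independent exponential terms, the second by the Burke property, and each is controlled
  separately.\<close>

theorem whp_lpp_stat:
  assumes \<rho>: "0 < \<rho>" "\<rho> < 1" and n: "((\<lambda>t. real (n t) / t) \<longlongrightarrow> x) at_top" and m: "((\<lambda>t. real (m t) / t) \<longlongrightarrow> y) at_top"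
    and \<epsilon>: "0 < \<epsilon>"
  shows "whp (\<lambda>t e. \<bar>lpp (stat \<rho> e) (n t) (m t) - t * (x / \<rho> + y / (1 - \<rho>))\<bar> \<le> \<epsilon> * t)"
proof -
  have \<epsilon>2: "0 < \<epsilon> / 2" using \<epsilon> by simp
  have a: "0 < 1 - \<rho>" using \<rho> by simp
  have 1: "whp (\<lambda>t e. \<bar>(\<Sum>i<n t. e (Suc i) 0 / \<rho>) - t * (x / \<rho>)\<bar> \<le> \<epsilon> / 2 * t)"
    by (rule whp_iid_sum[OF \<rho>(1) measurable_lpp_left[OF \<rho>(1)] distr_lpp_left[OF \<rho>(1)] n \<epsilon>2])
  have 2: "whp (\<lambda>t e. \<bar>(\<Sum>i<m t. lpp (stat \<rho> e) (n t) (Suc i) - lpp (stat \<rho> e) (n t) i) - t * (y / (1 - \<rho>))\<bar> \<le> \<epsilon> / 2 * t)"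
    by (rule whp_iid_sum[OF a measurable_lpp_increments[OF \<rho>] distr_lpp_increments[OF \<rho>] m \<epsilon>2])
  show ?thesis
  proof (rule whp_mono[OF whp_conj[OF 1 2]], intro always_eventually allI impI)
    fix t e
    let ?p = "\<Sum>i<n t. e (Suc i) 0 / \<rho>" and ?q = "\<Sum>i<m t. lpp (stat \<rho> e) (n t) (Suc i) - lpp (stat \<rho> e) (n t) i"
    assume "\<bar>?p - t * (x / \<rho>)\<bar> \<le> \<epsilon> / 2 * t \<and> \<bar>?q - t * (y / (1 - \<rho>))\<bar> \<le> \<epsilon> / 2 * t"
    moreover have "lpp (stat \<rho> e) (n t) (m t) = ?p + ?q" by (subst lpp_eq_sum_increments) simp
    moreover have "t * (x / \<rho> + y / (1 - \<rho>)) = t * (x / \<rho>) + t * (y / (1 - \<rho>))" by (rule distrib_left)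
    moreover have "\<epsilon> * t = \<epsilon> / 2 * t + \<epsilon> / 2 * t" by simp
    ultimately show "\<bar>lpp (stat \<rho> e) (n t) (m t) - t * (x / \<rho> + y / (1 - \<rho>))\<bar> \<le> \<epsilon> * t"
      by linarith
  qed
qed

text \<open>A maximal path of the stationary model leaves the boundary near the origin, or it passes through
  \<open>(0, k)\<close> or \<open>(k, 0)\<close>; in the latter cases the remainder is bounded by a stationary model
  started there, whose parameter may be changed in the favourable direction.\<close>

lemma exit_point:
  fixes k :: nat
  assumes e: "\<And>r j. 0 \<le> e r j" and \<rho>: "0 < \<rho>" "\<rho> < 1"
    and \<kappa>: "\<rho> \<le> \<kappa>" "\<kappa> < 1" and \<mu>: "0 < \<mu>" "\<mu> \<le> \<rho>"
  defines "L \<equiv> lpp (stat \<rho> e)" and "G \<equiv> lpp (bulk e)"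
    and "B \<equiv> lpp (stat \<kappa> (\<lambda>r j. e r (j + k)))" and "C \<equiv> lpp (stat \<mu> (\<lambda>r j. e (r + k) j))"
  shows "L n m \<le> L 0 k + L k 0 + G n m \<or> (k \<le> m \<and> L n m \<le> L 0 k + B n (m - k)) \<or>
    (k \<le> n \<and> L n m \<le> L k 0 + C (n - k) m)"
proof -
  have s: "0 \<le> stat \<rho> e r j" for r j using e \<rho> by (simp add: stat_def)
  have L0: "0 \<le> L n m" for n m unfolding L_def by (rule lpp_nonneg[OF s])
  have Lr: "L 0 m \<le> L 0 k" if "m \<le> k" for m k
    using that by (induction k rule: dec_induct) (use e \<rho> in \<open>auto simp: L_def intro: order_trans\<close>)
  have Lc: "L n 0 \<le> L k 0" if "n \<le> k" for n k
    using that by (induction k rule: dec_induct) (use e \<rho> in \<open>auto simp: L_def intro: order_trans\<close>)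
  have div: "z / (1 - \<rho>) \<le> z / (1 - \<kappa>)" "z / \<rho> \<le> z / \<mu>" "z \<le> z / \<kappa>" "z \<le> z / (1 - \<mu>)" if "0 \<le> z" for z
  proof -
    show "z / (1 - \<rho>) \<le> z / (1 - \<kappa>)" "z / \<rho> \<le> z / \<mu>"
      using that \<rho> \<kappa> \<mu> by (auto intro!: divide_left_mono mult_pos_pos simp del: divide_le_cancel)
    show "z \<le> z / \<kappa>" "z \<le> z / (1 - \<mu>)"
      using that \<rho> \<kappa> \<mu> mult_left_le[of _ z] by (auto simp: pos_le_divide_eq)
  qed
  have B0: "L 0 (k + j) \<le> L 0 k + B 0 j" for j
  proof (induction j)
    case (Suc j)
    have "L 0 (k + Suc j) = L 0 (k + j) + e 0 (Suc j + k) / (1 - \<rho>)" by (simp add: L_def add.commute)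
    moreover have "B 0 (Suc j) = B 0 j + e 0 (Suc j + k) / (1 - \<kappa>)" by (simp add: B_def)
    ultimately show ?case using Suc div(1)[OF e, of 0 "Suc j + k"] by linarith
  qed (simp add: B_def)
  have C0: "L (k + r) 0 \<le> L k 0 + C r 0" for r
  proof (induction r)
    case (Suc r)
    have "L (k + Suc r) 0 = L (k + r) 0 + e (Suc r + k) 0 / \<rho>" by (simp add: L_def add.commute)
    moreover have "C (Suc r) 0 = C r 0 + e (Suc r + k) 0 / \<mu>" by (simp add: C_def)
    ultimately show ?case using Suc div(2)[OF e, of "Suc r + k" 0] by linarith
  qed (simp add: C_def)
  \<comment> \<open>If \<open>k = Suc j\<close>, the cell lies on the boundary column of the shifted
    model, where its weight is divided by \<open>\<kappa> < 1\<close> and hence not smaller.\<close>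
  have Bstep: "B r (Suc j - k) + e (Suc r) (Suc j) \<le> B (Suc r) (Suc j - k)" if "k \<le> Suc j" for r j
  proof (cases "Suc j - k")
    case 0
    then have "k = Suc j" using that by simp
    then show ?thesis using div(3)[OF e, of "Suc r" "Suc j"] by (simp add: B_def)
  next
    case (Suc i)
    then have "Suc j = Suc i + k" using that by simp
    then show ?thesis by (simp add: B_def)
  qed
  have Bstep': "B (Suc r) (j - k) + e (Suc r) (Suc j) \<le> B (Suc r) (Suc j - k)" if "k \<le> j" for r j
    using that by (simp add: B_def Suc_diff_le)
  have Cstep: "C (Suc r - k) j + e (Suc r) (Suc j) \<le> C (Suc r - k) (Suc j)" if "k \<le> Suc r" for r j
  proof (cases "Suc r - k")
    case 0
    then have "k = Suc r" using that by simp
    then show ?thesis using div(4)[OF e, of "Suc r" "Suc j"] by (simp add: C_def)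
  next
    case (Suc i)
    then have "Suc r = Suc i + k" using that by simp
    then show ?thesis by (simp add: C_def)
  qed
  have Cstep': "C (r - k) (Suc j) + e (Suc r) (Suc j) \<le> C (Suc r - k) (Suc j)" if "k \<le> r" for r j
    using that by (simp add: C_def Suc_diff_le)
  have Gstep: "G r (Suc j) + e (Suc r) (Suc j) \<le> G (Suc r) (Suc j)" "G (Suc r) j + e (Suc r) (Suc j) \<le> G (Suc r) (Suc j)"
    for r j by (simp_all add: G_def)
  let ?Q = "\<lambda>n m. L n m \<le> L 0 k + L k 0 + G n m \<or> (k \<le> m \<and> L n m \<le> L 0 k + B n (m - k)) \<or>
    (k \<le> n \<and> L n m \<le> L k 0 + C (n - k) m)"
  have row0: "?Q 0 m" for m
  proof (cases "k \<le> m")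
    case True
    then show ?thesis using B0[of "m - k"] by auto
  next
    case False
    then show ?thesis using Lr[of m k] L0[of k 0] by (auto simp: G_def)
  qed
  have col0: "?Q n 0" for n
  proof (cases "k \<le> n")
    case True
    then show ?thesis using C0[of "n - k"] by auto
  next
    case False
    then show ?thesis using Lc[of n k] L0[of 0 k] by (auto simp: G_def)
  qed
  \<comment> \<open>The maximum in the recursion is attained at one predecessor, and whichever
    alternative holds there survives adding the weight of the new cell.\<close>
  have "?Q n m"
  proof (induction n arbitrary: m)
    case 0
    show ?case by (rule row0)
  next
    case (Suc r)
    note IHr = Suc
    show ?case
    proof (induction m)
      case 0
      show ?case by (rule col0)
    next
      case (Suc j)
      let ?w = "e (Suc r) (Suc j)"
      have L: "L (Suc r) (Suc j) = max (L r (Suc j)) (L (Suc r) j) + ?w" by (simp add: L_def)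
      show ?case
      proof (cases "L (Suc r) j \<le> L r (Suc j)")
        case True
        then have "L (Suc r) (Suc j) = L r (Suc j) + ?w" using L by simp
        with IHr[of "Suc j"] Gstep(1)[of r j] Bstep[of j r] Cstep'[of r j] show ?thesis
          by (smt (verit) le_SucI)
      next
        case False
        then have "L (Suc r) (Suc j) = L (Suc r) j + ?w" using L by simp
        with Suc Gstep(2)[of r j] Bstep'[of j r] Cstep[of r j] show ?thesis
          by (smt (verit) le_SucI)
      qed
    qed
  qed
  then show ?thesis .
qed

lemma AE_grid_nonneg: "AE e in grid. \<forall>r j. 0 \<le> e r j"
proof -
  have "AE \<omega> in clock. \<forall>j. 0 \<le> \<omega> j"
    by (rule AE_iid_nth[OF prob_space_expm], simp, rule AE_mp[OF AE_expm_pos]) auto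
  then show ?thesis by (rule AE_iid_nth[OF prob_space_clock])
qed

text \<open>The stationary model dominates \<open>bulk\<close> for every parameter. The choice of
  \<open>\<rho>\<close> minimises its growth \<open>x / \<rho> + y / (1 - \<rho>)\<close>, and the
  minimum is \<open>s\<^sup>2\<close>.\<close>

lemma whp_lpp_le:
  assumes xy: "0 < x" "0 < y" "sqrt x + sqrt y < 1"
    and n: "((\<lambda>t. real (n t) / t) \<longlongrightarrow> x) at_top" and m: "((\<lambda>t. real (m t) / t) \<longlongrightarrow> y) at_top"
  shows "whp (\<lambda>t e. lpp (bulk e) (n t) (m t) \<le> t)"
proof -
  define s \<rho> where "s = sqrt x + sqrt y" and "\<rho> = sqrt x / s"
  have s: "0 < s" "s < 1" using xy by (auto simp: s_def add_pos_pos)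
  have \<rho>: "0 < \<rho>" "\<rho> < 1" using xy s by (auto simp: \<rho>_def s_def)
  have \<rho>': "1 - \<rho> = sqrt y / s" using s by (simp add: \<rho>_def s_def field_simps)
  have f: "x / \<rho> + y / (1 - \<rho>) = s\<^sup>2"
    unfolding \<rho>' using xy s by (simp add: \<rho>_def s_def power2_eq_square real_div_sqrt field_simps)
  have s2: "s\<^sup>2 < 1" using s by (simp add: power_less_one_iff abs_square_less_1)
  define \<epsilon> where "\<epsilon> = 1 - s\<^sup>2"
  have \<epsilon>: "0 < \<epsilon>" using s2 by (simp add: \<epsilon>_def)
  show ?thesis
  proof (rule whp_mono[OF whp_conj[OF whp_lpp_stat[OF \<rho> n m \<epsilon>] whp_AE[OF AE_grid_nonneg]]], intro always_eventually allI impI)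
    fix t e
    assume *: "\<bar>lpp (stat \<rho> e) (n t) (m t) - t * (x / \<rho> + y / (1 - \<rho>))\<bar> \<le> \<epsilon> * t \<and> (\<forall>r j. 0 \<le> e r j)"
    have "lpp (bulk e) (n t) (m t) \<le> lpp (stat \<rho> e) (n t) (m t)"
      using * \<rho> by (intro lpp_mono) (auto simp: bulk_def stat_def)
    moreover have "lpp (stat \<rho> e) (n t) (m t) \<le> t * s\<^sup>2 + \<epsilon> * t" using * unfolding f by linarith
    moreover have "t * s\<^sup>2 + \<epsilon> * t = t" by (simp add: \<epsilon>_def algebra_simps)
    ultimately show "lpp (bulk e) (n t) (m t) \<le> t" by linarith
  qed
qed

lemma tendsto_nat_floor_div:
  assumes "0 \<le> x" shows "((\<lambda>t. real (nat \<lfloor>x * t\<rfloor>) / t) \<longlongrightarrow> x) at_top"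
proof (rule tendsto_sandwich[OF _ _ _ tendsto_const])
  have "((\<lambda>t::real. x - 1 / t) \<longlongrightarrow> x - 0) at_top"
    by (intro tendsto_diff tendsto_const tendsto_divide_0[OF tendsto_const] filterlim_at_top_imp_at_infinity filterlim_ident)
  then show "((\<lambda>t::real. x - 1 / t) \<longlongrightarrow> x) at_top" by simp
  have fl: "real (nat \<lfloor>x * t\<rfloor>) \<le> x * t \<and> x * t - 1 \<le> real (nat \<lfloor>x * t\<rfloor>)" if "0 < t" for t
    using that assms by (auto simp: of_nat_nat)
  show "\<forall>\<^sub>F t in at_top. x - 1 / t \<le> real (nat \<lfloor>x * t\<rfloor>) / t"
    using eventually_gt_at_top[of 0]
  proof eventually_elim
    case (elim t)
    then have "x - 1 / t = (x * t - 1) / t" by (simp add: field_simps)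
    also have "\<dots> \<le> real (nat \<lfloor>x * t\<rfloor>) / t" using fl[OF elim] elim by (intro divide_right_mono) auto
    finally show ?case .
  qed
  show "\<forall>\<^sub>F t in at_top. real (nat \<lfloor>x * t\<rfloor>) / t \<le> x"
    using eventually_gt_at_top[of 0]
  proof eventually_elim
    case (elim t)
    then show ?case using fl[of t] by (simp add: pos_divide_le_eq)
  qed
qed

text \<open>\<open>crit\<close> says that \<open>x / l + y / (1 - l)\<close> has derivative zero at
  \<open>\<rho>\<close>. With \<open>\<delta>\<close> taken from \<open>y\<close> the derivative
  becomes \<open>- \<delta> / (1 - \<rho>)\<^sup>2\<close>, so a slightly larger parameter gives a
  strictly smaller value.\<close>

lemma exit_parameter:
  fixes x y \<rho> \<delta> :: real
  assumes xy: "0 < x" "0 < y" and \<rho>: "0 < \<rho>" "\<rho> < 1" and crit: "x / \<rho>\<^sup>2 = y / (1 - \<rho>)\<^sup>2" and \<delta>: "0 < \<delta>"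
  obtains \<kappa> where "\<rho> < \<kappa>" "\<kappa> < 1"
    "\<delta> / (1 - \<rho>) + (x / \<kappa> + (y - \<delta>) / (1 - \<kappa>)) < x / \<rho> + y / (1 - \<rho>)"
proof -
  let ?f = "\<lambda>l. x / l + (y - \<delta>) / (1 - l)"
  have "(?f has_real_derivative - (x / \<rho>\<^sup>2) + (y - \<delta>) / (1 - \<rho>)\<^sup>2) (at \<rho>)"
    using \<rho> by (auto intro!: derivative_eq_intros simp: power2_eq_square)
  moreover have "- (x / \<rho>\<^sup>2) + (y - \<delta>) / (1 - \<rho>)\<^sup>2 < 0"
    using \<delta> \<rho> by (simp add: crit diff_divide_distrib)
  ultimately obtain d where d: "0 < d" "\<And>h. 0 < h \<Longrightarrow> h < d \<Longrightarrow> ?f (\<rho> + h) < ?f \<rho>"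
    using DERIV_neg_dec_right by blast
  define h where "h = min (d / 2) ((1 - \<rho>) / 2)"
  have h: "0 < h" "h < d" "\<rho> + h < 1" using d \<rho> by (auto simp: h_def min_def field_simps)
  have "?f \<rho> = x / \<rho> + y / (1 - \<rho>) - \<delta> / (1 - \<rho>)" by (simp add: diff_divide_distrib)
  with d(2)[OF h(1,2)] show ?thesis by (intro that[of "\<rho> + h"]) (use h in auto)
qed

text \<open>At the minimiser the stationary passage time is close to \<open>s\<^sup>2 * t\<close>,
  with \<open>s > 1\<close>. By \<open>exit_parameter\<close> the two alternatives of
  \<open>exit_point\<close> that leave the boundary beyond \<open>\<delta> * t\<close> fall short of
  this with high probability. In the remaining one \<open>bulk\<close> receives all but two short
  boundary pieces.\<close>

lemma whp_lpp_gt: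
  assumes xy: "0 < x" "0 < y" "1 < sqrt x + sqrt y"
    and n: "((\<lambda>t. real (n t) / t) \<longlongrightarrow> x) at_top" and m: "((\<lambda>t. real (m t) / t) \<longlongrightarrow> y) at_top"
  shows "whp (\<lambda>t e. t < lpp (bulk e) (n t) (m t))"
proof -
  define s \<rho> where "s = sqrt x + sqrt y" and "\<rho> = sqrt x / s"
  have s: "1 < s" using xy by (auto simp: s_def)
  have \<rho>: "0 < \<rho>" "\<rho> < 1" using xy s by (auto simp: \<rho>_def s_def)
  have \<rho>': "1 - \<rho> = sqrt y / s" using s by (simp add: \<rho>_def s_def field_simps)
  have f: "x / \<rho> + y / (1 - \<rho>) = s\<^sup>2"
    unfolding \<rho>' using xy s by (simp add: \<rho>_def s_def power2_eq_square real_div_sqrt field_simps)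
  have crit: "x / \<rho>\<^sup>2 = y / (1 - \<rho>)\<^sup>2"
    unfolding \<rho>' using xy s by (simp add: \<rho>_def power_divide)
  have s2: "1 < s\<^sup>2" using s by (simp add: one_less_power)
  define c where "c = 1 / \<rho> + 1 / (1 - \<rho>)"
  have c: "0 < c" using \<rho> by (simp add: c_def add_pos_pos)
  \<comment> \<open>The two boundary pieces together cost \<open>\<delta> * c\<close> per unit of
    \<open>t\<close>, at most half of the margin \<open>s\<^sup>2 - 1\<close>. The bound by
    \<open>x\<close> and \<open>y\<close> keeps the shifted end points inside the quadrant.\<close>
  define \<delta> where "\<delta> = min (min x y / 2) ((s\<^sup>2 - 1) / (2 * c))"
  have "\<delta> \<le> min x y / 2" unfolding \<delta>_def by (rule min.cobounded1)
  moreover have "0 < \<delta>" using xy s2 c by (simp add: \<delta>_def)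
  moreover have "min x y \<le> x" "min x y \<le> y" by simp_all
  ultimately have \<delta>: "0 < \<delta>" "\<delta> < x" "\<delta> < y" by linarith+
  have "\<delta> \<le> (s\<^sup>2 - 1) / (2 * c)" by (simp add: \<delta>_def)
  then have \<delta>c: "\<delta> * c \<le> (s\<^sup>2 - 1) / 2" using c by (simp add: field_simps)
  obtain \<kappa> where \<kappa>: "\<rho> < \<kappa>" "\<kappa> < 1" and f\<kappa>: "\<delta> / (1 - \<rho>) + (x / \<kappa> + (y - \<delta>) / (1 - \<kappa>)) < x / \<rho> + y / (1 - \<rho>)"
    using exit_parameter[OF xy(1,2) \<rho> crit \<delta>(1)] by blast
  \<comment> \<open>Exchanging the two axes turns \<open>\<rho>\<close> into
    \<open>1 - \<rho>\<close>, so the exit from the column is the exit from the row for the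
    transposed data.\<close>
  have \<rho>2: "0 < 1 - \<rho>" "1 - \<rho> < 1" "y / (1 - \<rho>)\<^sup>2 = x / (1 - (1 - \<rho>))\<^sup>2" using \<rho> crit by auto
  obtain \<nu> where \<nu>: "1 - \<rho> < \<nu>" "\<nu> < 1" and f\<nu>: "\<delta> / (1 - (1 - \<rho>)) + (y / \<nu> + (x - \<delta>) / (1 - \<nu>)) < y / (1 - \<rho>) + x / (1 - (1 - \<rho>))"
    using exit_parameter[OF xy(2,1) \<rho>2 \<delta>(1)] by blast
  define \<mu> where "\<mu> = 1 - \<nu>"
  have \<mu>: "0 < \<mu>" "\<mu> < \<rho>" "\<mu> < 1" using \<nu> \<rho> by (auto simp: \<mu>_def)
  have f\<mu>: "\<delta> / \<rho> + ((x - \<delta>) / \<mu> + y / (1 - \<mu>)) < s\<^sup>2" using f\<nu> f by (simp add: \<mu>_def)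
  note f\<kappa>' = f\<kappa>[unfolded f]
  \<comment> \<open>Each alternative of \<open>exit_point\<close> accumulates at most three errors
    \<open>\<epsilon> * t\<close>; room for a fourth makes the conclusions strict.\<close>
  define \<epsilon> where "\<epsilon> = min ((s\<^sup>2 - 1) / 8) (min ((s\<^sup>2 - (\<delta> / (1 - \<rho>) + (x / \<kappa> + (y - \<delta>) / (1 - \<kappa>)))) / 4)
     ((s\<^sup>2 - (\<delta> / \<rho> + ((x - \<delta>) / \<mu> + y / (1 - \<mu>)))) / 4))"
  have \<epsilon>: "0 < \<epsilon>" using s2 f\<kappa>' f\<mu> by (simp add: \<epsilon>_def)
  have \<epsilon>1: "4 * \<epsilon> \<le> (s\<^sup>2 - 1) / 2" by (simp add: \<epsilon>_def min_def)
  have \<epsilon>2: "\<delta> / (1 - \<rho>) + (x / \<kappa> + (y - \<delta>) / (1 - \<kappa>)) + 4 * \<epsilon> \<le> s\<^sup>2"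
    and \<epsilon>3: "\<delta> / \<rho> + ((x - \<delta>) / \<mu> + y / (1 - \<mu>)) + 4 * \<epsilon> \<le> s\<^sup>2"
  proof -
    have "\<epsilon> \<le> (s\<^sup>2 - (\<delta> / (1 - \<rho>) + (x / \<kappa> + (y - \<delta>) / (1 - \<kappa>)))) / 4"
      "\<epsilon> \<le> (s\<^sup>2 - (\<delta> / \<rho> + ((x - \<delta>) / \<mu> + y / (1 - \<mu>)))) / 4"
      unfolding \<epsilon>_def by (meson min.cobounded1 min.cobounded2 order_trans)+
    moreover have "X + 4 * e \<le> S" if "e \<le> (S - X) / 4" for e X S :: real using that by simp
    ultimately show "\<delta> / (1 - \<rho>) + (x / \<kappa> + (y - \<delta>) / (1 - \<kappa>)) + 4 * \<epsilon> \<le> s\<^sup>2"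
      "\<delta> / \<rho> + ((x - \<delta>) / \<mu> + y / (1 - \<mu>)) + 4 * \<epsilon> \<le> s\<^sup>2" by blast+
  qed
  define k where "k t = nat \<lfloor>\<delta> * t\<rfloor>" for t
  have k: "((\<lambda>t. real (k t) / t) \<longlongrightarrow> \<delta>) at_top"
    unfolding k_def by (rule tendsto_nat_floor_div) (use \<delta> in simp)
  have z: "((\<lambda>t. real 0 / t) \<longlongrightarrow> 0) at_top" by simp
  have sub: "((\<lambda>t. real (p t - k t) / t) \<longlongrightarrow> u - \<delta>) at_top" if p: "((\<lambda>t. real (p t) / t) \<longlongrightarrow> u) at_top" and u: "\<delta> < u" for p u
  proof -
    have "\<forall>\<^sub>F t in at_top. real (k t) / t < real (p t) / t"
    proof -
      have "\<forall>\<^sub>F t in at_top. real (k t) / t < (\<delta> + u) / 2" using k u by (intro order_tendstoD) auto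
      moreover have "\<forall>\<^sub>F t in at_top. (\<delta> + u) / 2 < real (p t) / t" using p u by (intro order_tendstoD) auto
      ultimately show ?thesis by eventually_elim (rule less_trans)
    qed
    then have "\<forall>\<^sub>F t in at_top. real (p t) / t - real (k t) / t = real (p t - k t) / t"
      using eventually_gt_at_top[of 0]
      by eventually_elim (simp add: of_nat_diff divide_less_cancel diff_divide_distrib)
    with tendsto_diff[OF p k] show ?thesis by (rule Lim_transform_eventually)
  qed
  have W1: "whp (\<lambda>t e. \<bar>lpp (stat \<rho> e) (n t) (m t) - t * (x / \<rho> + y / (1 - \<rho>))\<bar> \<le> \<epsilon> * t)"
    by (rule whp_lpp_stat[OF \<rho> n m \<epsilon>])
  have W2: "whp (\<lambda>t e. \<bar>lpp (stat \<rho> e) 0 (k t) - t * (0 / \<rho> + \<delta> / (1 - \<rho>))\<bar> \<le> \<epsilon> * t)"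
    by (rule whp_lpp_stat[OF \<rho> z k \<epsilon>])
  have W3: "whp (\<lambda>t e. \<bar>lpp (stat \<rho> e) (k t) 0 - t * (\<delta> / \<rho> + 0 / (1 - \<rho>))\<bar> \<le> \<epsilon> * t)"
    by (rule whp_lpp_stat[OF \<rho> k z \<epsilon>])
  have W4: "whp (\<lambda>t e. \<bar>lpp (stat \<kappa> (\<lambda>r j. e (r + 0) (j + k t))) (n t) (m t - k t) - t * (x / \<kappa> + (y - \<delta>) / (1 - \<kappa>))\<bar> \<le> \<epsilon> * t)"
    by (rule whp_shift[OF whp_lpp_stat[OF _ \<kappa>(2) n sub[OF m \<delta>(3)] \<epsilon>]]) (use \<kappa> \<rho> in simp)
  have W5: "whp (\<lambda>t e. \<bar>lpp (stat \<mu> (\<lambda>r j. e (r + k t) (j + 0))) (n t - k t) (m t) - t * ((x - \<delta>) / \<mu> + y / (1 - \<mu>))\<bar> \<le> \<epsilon> * t)"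
    by (rule whp_shift[OF whp_lpp_stat[OF \<mu>(1,3) sub[OF n \<delta>(2)] m \<epsilon>]])
  show ?thesis
  proof (rule whp_mono[OF whp_conj[OF whp_conj[OF W1 whp_conj[OF W2 W3]] whp_conj[OF W4 whp_conj[OF W5 whp_AE[OF AE_grid_nonneg]]]]])
    show "\<forall>\<^sub>F t in at_top. \<forall>e.
       (\<bar>lpp (stat \<rho> e) (n t) (m t) - t * (x / \<rho> + y / (1 - \<rho>))\<bar> \<le> \<epsilon> * t \<and>
        \<bar>lpp (stat \<rho> e) 0 (k t) - t * (0 / \<rho> + \<delta> / (1 - \<rho>))\<bar> \<le> \<epsilon> * t \<and>
        \<bar>lpp (stat \<rho> e) (k t) 0 - t * (\<delta> / \<rho> + 0 / (1 - \<rho>))\<bar> \<le> \<epsilon> * t) \<and>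
       \<bar>lpp (stat \<kappa> (\<lambda>r j. e (r + 0) (j + k t))) (n t) (m t - k t) - t * (x / \<kappa> + (y - \<delta>) / (1 - \<kappa>))\<bar> \<le> \<epsilon> * t \<and>
       \<bar>lpp (stat \<mu> (\<lambda>r j. e (r + k t) (j + 0))) (n t - k t) (m t) - t * ((x - \<delta>) / \<mu> + y / (1 - \<mu>))\<bar> \<le> \<epsilon> * t \<and>
       (\<forall>r j. 0 \<le> e r j) \<longrightarrow> t < lpp (bulk e) (n t) (m t)"
      using eventually_gt_at_top[of 0]
    proof (eventually_elim, intro allI impI, elim conjE)
      fix t :: real and e :: "nat \<Rightarrow> nat \<Rightarrow> real" assume t: "0 < t" and e: "\<forall>r j. 0 \<le> e r j"
      let ?L = "lpp (stat \<rho> e)"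
      let ?B = "lpp (stat \<kappa> (\<lambda>r j. e (r + 0) (j + k t))) (n t) (m t - k t)"
      let ?C = "lpp (stat \<mu> (\<lambda>r j. e (r + k t) (j + 0))) (n t - k t) (m t)"
      assume "\<bar>?L (n t) (m t) - t * (x / \<rho> + y / (1 - \<rho>))\<bar> \<le> \<epsilon> * t"
      then have 1: "t * s\<^sup>2 - \<epsilon> * t \<le> ?L (n t) (m t)" unfolding f by linarith
      assume "\<bar>?L 0 (k t) - t * (0 / \<rho> + \<delta> / (1 - \<rho>))\<bar> \<le> \<epsilon> * t"
      then have 2: "?L 0 (k t) \<le> t * (\<delta> / (1 - \<rho>)) + \<epsilon> * t" by simp
      assume "\<bar>?L (k t) 0 - t * (\<delta> / \<rho> + 0 / (1 - \<rho>))\<bar> \<le> \<epsilon> * t"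
      then have 3: "?L (k t) 0 \<le> t * (\<delta> / \<rho>) + \<epsilon> * t" by simp
      assume "\<bar>?B - t * (x / \<kappa> + (y - \<delta>) / (1 - \<kappa>))\<bar> \<le> \<epsilon> * t"
      then have 4: "?B \<le> t * (x / \<kappa> + (y - \<delta>) / (1 - \<kappa>)) + \<epsilon> * t" by linarith
      assume "\<bar>?C - t * ((x - \<delta>) / \<mu> + y / (1 - \<mu>))\<bar> \<le> \<epsilon> * t"
      then have 5: "?C \<le> t * ((x - \<delta>) / \<mu> + y / (1 - \<mu>)) + \<epsilon> * t" by linarith
      have t\<epsilon>: "0 < \<epsilon> * t" using \<epsilon> t by simp
      have m2: "t * (\<delta> / (1 - \<rho>)) + t * (x / \<kappa> + (y - \<delta>) / (1 - \<kappa>)) + 4 * (\<epsilon> * t) \<le> t * s\<^sup>2"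
        using mult_left_mono[OF \<epsilon>2, of t] t by (simp add: distrib_left mult.commute mult.left_commute)
      have m3: "t * (\<delta> / \<rho>) + t * ((x - \<delta>) / \<mu> + y / (1 - \<mu>)) + 4 * (\<epsilon> * t) \<le> t * s\<^sup>2"
        using mult_left_mono[OF \<epsilon>3, of t] t by (simp add: distrib_left mult.commute mult.left_commute)
      have \<delta>c': "\<delta> * c = \<delta> / \<rho> + \<delta> / (1 - \<rho>)" by (simp add: c_def distrib_left)
      have "\<delta> * c + 4 * \<epsilon> + 1 \<le> s\<^sup>2" using \<delta>c \<epsilon>1 by simp
      then have "\<delta> / \<rho> + \<delta> / (1 - \<rho>) + 4 * \<epsilon> + 1 \<le> s\<^sup>2" unfolding \<delta>c' .
      from mult_left_mono[OF this, of t]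
      have m1: "t * (\<delta> / \<rho>) + t * (\<delta> / (1 - \<rho>)) + 4 * (\<epsilon> * t) + t \<le> t * s\<^sup>2"
        using t by (simp add: distrib_left mult.commute mult.left_commute)
      have "?L (n t) (m t) \<le> ?L 0 (k t) + ?L (k t) 0 + lpp (bulk e) (n t) (m t) \<or>
        (k t \<le> m t \<and> ?L (n t) (m t) \<le> ?L 0 (k t) + ?B) \<or> (k t \<le> n t \<and> ?L (n t) (m t) \<le> ?L (k t) 0 + ?C)"
        using exit_point[of e \<rho> \<kappa> \<mu> "n t" "m t" "k t"] e \<rho> \<kappa> \<mu> by simp
      then show "t < lpp (bulk e) (n t) (m t)"
        using 1 2 3 4 5 m1 m2 m3 t\<epsilon> by linarith
    qed
  qed
qed

section \<open>The growing area\<close>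

lemma measurable_lpp_bulk: "(\<lambda>e. lpp (bulk e) (Suc r) (Suc j)) \<in> borel_measurable grid"
proof -
  have "(\<lambda>e r j. e (r + 1) (j + 1)) \<in> measurable grid grid" by (rule measurable_grid_shift)
  then have "(\<lambda>e r j. e (r + 1) (j + 1)) \<in> measurable grid (iid seqs)"
    by (simp cong: measurable_cong_sets sets_PiM_cong)
  then have "(\<lambda>e. lpp_rows (\<lambda>r j. e (r + 1) (j + 1)) (Suc r)) \<in> measurable grid seqs"
    by (rule measurable_lpp_rows)
  from measurable_seq_nth[OF this, of j] show ?thesis
    using lpp_rows_eq_lpp[of _ "Suc r" j] by simp
qed

definition filled :: "nat \<Rightarrow> nat \<Rightarrow> real \<Rightarrow> real" where
  "filled r j t = measure grid {e\<in>space grid. lpp (bulk e) (Suc r) (Suc j) \<le> t}"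

lemma emeasure_lpp_rows:
  "emeasure grid {e\<in>space grid. lpp_rows e (Suc r) j \<le> t} = ennreal (filled r j t)"
proof -
  interpret G: prob_space grid by (rule prob_space_grid)
  let ?s = "\<lambda>(e :: nat \<Rightarrow> nat \<Rightarrow> real) r j. e (r + 1) (j + 1)"
  have s: "?s \<in> measurable grid grid" by (rule measurable_grid_shift)
  have "(\<lambda>e. lpp_rows e (Suc r)) \<in> measurable grid seqs" by measurable
  from measurable_seq_nth[OF this, of j]
  have A: "{e\<in>space grid. lpp_rows e (Suc r) j \<le> t} \<in> sets grid" by (rule borel_measurable_le) simp
  have "emeasure grid {e\<in>space grid. lpp_rows e (Suc r) j \<le> t} =
    emeasure (distr grid grid ?s) {e\<in>space grid. lpp_rows e (Suc r) j \<le> t}"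
    by (simp only: distr_grid_shift)
  also have "\<dots> = emeasure grid (?s -` {e\<in>space grid. lpp_rows e (Suc r) j \<le> t} \<inter> space grid)"
    by (rule emeasure_distr[OF s A])
  also have "?s -` {e\<in>space grid. lpp_rows e (Suc r) j \<le> t} \<inter> space grid =
    {e\<in>space grid. lpp (bulk e) (Suc r) (Suc j) \<le> t}"
    using measurable_space[OF s] lpp_rows_eq_lpp[of _ "Suc r" j] by (auto simp del: rows.simps lpp.simps)
  finally show ?thesis by (simp add: filled_def G.emeasure_eq_measure)
qed

text \<open>A path that starts along the first row, or along the first column, collects at least the
  weights found there. These sums are rings of a clock, so \<open>emeasure_ring_le\<close> applies
  to them.\<close>

lemma lpp_bulk_ge:
  assumes e: "\<And>r j. 0 \<le> e r j"
  shows "ring (\<lambda>i. e 1 (Suc i)) j \<le> lpp (bulk e) (Suc r) (Suc j)"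
    and "ring (\<lambda>i. e (Suc i) 1) r \<le> lpp (bulk e) (Suc r) (Suc j)"
proof -
  have b: "0 \<le> bulk e r j" for r j using e by (simp add: bulk_def)
  have n: "0 \<le> lpp (bulk e) r j" for r j by (rule lpp_nonneg[OF b])
  have 1: "ring (\<lambda>i. e 1 (Suc i)) j \<le> lpp (bulk e) 1 (Suc j)"
    by (induction j) (auto simp: ring_Suc le_max_iff_disj)
  have "lpp (bulk e) 1 (Suc j) \<le> lpp (bulk e) (Suc r) (Suc j)"
  proof (induction r)
    case (Suc r)
    have "lpp (bulk e) (Suc r) (Suc j) \<le> max (lpp (bulk e) (Suc r) (Suc j)) (lpp (bulk e) (Suc (Suc r)) j) + e (Suc (Suc r)) (Suc j)"
      using e[of "Suc (Suc r)" "Suc j"] by linarith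
    with Suc show ?case by (simp only: lpp.simps(4)[of _ "Suc r"] bulk_simps)
  qed simp
  with 1 show "ring (\<lambda>i. e 1 (Suc i)) j \<le> lpp (bulk e) (Suc r) (Suc j)" by linarith
  have 2: "ring (\<lambda>i. e (Suc i) 1) r \<le> lpp (bulk e) (Suc r) 1"
    by (induction r) (auto simp: ring_Suc le_max_iff_disj)
  have "lpp (bulk e) (Suc r) 1 \<le> lpp (bulk e) (Suc r) (Suc j)"
  proof (induction j)
    case (Suc j)
    have "lpp (bulk e) (Suc r) (Suc j) \<le> max (lpp (bulk e) r (Suc (Suc j))) (lpp (bulk e) (Suc r) (Suc j)) + e (Suc r) (Suc (Suc j))"
      using e[of "Suc r" "Suc (Suc j)"] by linarith
    with Suc show ?case by (simp only: lpp.simps(4)[of _ r] bulk_simps)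
  qed simp
  with 2 show "ring (\<lambda>i. e (Suc i) 1) r \<le> lpp (bulk e) (Suc r) (Suc j)" by linarith
qed

lemma filled_le:
  shows "filled r j t \<le> exp t * (1/2) ^ Suc j" "filled r j t \<le> exp t * (1/2) ^ Suc r"
proof -
  interpret G: prob_space grid by (rule prob_space_grid)
  let ?A = "{e\<in>space grid. lpp (bulk e) (Suc r) (Suc j) \<le> t}"
  have bound: "filled r j t \<le> exp t * (1/2) ^ Suc k"
    if X: "X \<in> measurable grid clock" "distr grid clock X = clock"
      and le: "\<And>e. (\<forall>r j. 0 \<le> e r j) \<Longrightarrow> ring (X e) k \<le> lpp (bulk e) (Suc r) (Suc j)" for X k
  proof -
    let ?R = "{\<omega>\<in>space clock. ring \<omega> k \<le> t}"
    have R: "?R \<in> sets clock" by measurable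
    have "emeasure grid ?A \<le> emeasure grid (X -` ?R \<inter> space grid)"
    proof (rule emeasure_mono_AE)
      show "AE e in grid. e \<in> ?A \<longrightarrow> e \<in> X -` ?R \<inter> space grid"
        using AE_grid_nonneg
      proof eventually_elim
        case (elim e)
        show ?case using le[of e] elim measurable_space[OF X(1), of e] by auto
      qed
    qed (rule measurable_sets[OF X(1) R])
    also have "\<dots> = emeasure clock ?R" using emeasure_distr[OF X(1) R] by (simp only: X(2))
    also have "\<dots> \<le> ennreal (exp t * (1/2) ^ Suc k)" by (rule emeasure_ring_le)
    finally show ?thesis unfolding filled_def by (simp add: G.emeasure_eq_measure)
  qed
  have row: "(\<lambda>e i. e (0 + 1) (i + 1)) \<in> measurable grid clock"
    "distr grid clock (\<lambda>e i. e (0 + 1) (i + 1)) = clock"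
  proof -
    have h: "(\<lambda>e. e 0) \<in> measurable grid clock" by (rule measurable_component_singleton) simp
    have s: "(\<lambda>e r j. e (r + 1) (j + 1)) \<in> measurable grid grid" by (rule measurable_grid_shift)
    show m: "(\<lambda>e i. e (0 + 1) (i + 1)) \<in> measurable grid clock" using measurable_compose[OF s h] .
    show "distr grid clock (\<lambda>e i. e (0 + 1) (i + 1)) = clock"
    proof (rule distr_eqI_nn_integral[OF m])
      fix f :: "(nat \<Rightarrow> real) \<Rightarrow> ennreal" assume f: "f \<in> borel_measurable clock"
      have "(\<integral>\<^sup>+e. f (\<lambda>i. e (0 + 1) (i + 1)) \<partial>grid) = (\<integral>\<^sup>+e. f (e 0) \<partial>distr grid grid (\<lambda>e r j. e (r + 1) (j + 1)))"
        by (rule nn_integral_distr[OF s, symmetric]) (use measurable_compose[OF h f] in simp)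
      also have "\<dots> = (\<integral>\<^sup>+\<omega>. f \<omega> \<partial>clock)"
        by (simp only: distr_grid_shift) (rule nn_integral_iid_hd[OF prob_space_clock f])
      finally show "(\<integral>\<^sup>+e. f (\<lambda>i. e (0 + 1) (i + 1)) \<partial>grid) = (\<integral>\<^sup>+\<omega>. f \<omega> \<partial>clock)" .
    qed
  qed
  show "filled r j t \<le> exp t * (1/2) ^ Suc j"
    by (rule bound[OF row]) (use lpp_bulk_ge(1) in auto)
  have col: "(\<lambda>e i. e (Suc i) (0 + 1)) \<in> measurable grid clock"
    "distr grid clock (\<lambda>e i. e (Suc i) (0 + 1)) = clock"
  proof -
    have s: "(\<lambda>e r j. e (r + 0) (j + 1)) \<in> measurable grid grid" by (rule measurable_grid_shift)
    have l1: "(\<lambda>e r. e (Suc r) 0) \<in> measurable grid clock" using measurable_lpp_left[of 1] by simp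
    have l2: "distr grid clock (\<lambda>e r. e (Suc r) 0) = clock" using distr_lpp_left[of 1] by simp
    show m: "(\<lambda>e i. e (Suc i) (0 + 1)) \<in> measurable grid clock" using measurable_compose[OF s l1] by simp
    have "distr grid clock (\<lambda>e i. e (Suc i) (0 + 1)) = distr (distr grid grid (\<lambda>e r j. e (r + 0) (j + 1))) clock (\<lambda>e r. e (Suc r) 0)"
      by (subst distr_distr[OF l1 s]) (simp add: comp_def)
    then show "distr grid clock (\<lambda>e i. e (Suc i) (0 + 1)) = clock" by (simp only: distr_grid_shift l2)
  qed
  show "filled r j t \<le> exp t * (1/2) ^ Suc r"
    by (rule bound[OF col]) (use lpp_bulk_ge(2) in auto)
qed

section \<open>The expected area as an integral over the quadrant, and its scaling limit\<close>

lemma suminf_eq_nn_integral_floor: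
  fixes f :: "nat \<Rightarrow> ennreal"
  shows "(\<Sum>j. f j) = (\<integral>\<^sup>+(y :: real). indicator {0..} y * f (nat \<lfloor>y\<rfloor>) \<partial>lborel)"
proof -
  have "(\<integral>\<^sup>+(y :: real). indicator {0..} y * f (nat \<lfloor>y\<rfloor>) \<partial>lborel) =
    (\<integral>\<^sup>+y. (\<Sum>j. f j * indicator {real j..<real j + 1} y) \<partial>lborel)"
  proof (rule nn_integral_cong)
    fix y :: real
    show "indicator {0..} y * f (nat \<lfloor>y\<rfloor>) = (\<Sum>j. f j * indicator {real j..<real j + 1} y)"
    proof (cases "0 \<le> y")
      case True
      have iff: "y \<in> {real j..<real j + 1} \<longleftrightarrow> j = nat \<lfloor>y\<rfloor>" for j
        using True by (auto simp: nat_eq_iff) linarith+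
      have "(\<Sum>j. f j * indicator {real j..<real j + 1} y) = (\<Sum>j\<in>{nat \<lfloor>y\<rfloor>}. f j * indicator {real j..<real j + 1} y)"
        by (rule suminf_finite) (auto simp del: atLeastLessThan_iff simp: iff)
      also have "\<dots> = f (nat \<lfloor>y\<rfloor>)" using iff[of "nat \<lfloor>y\<rfloor>"] by (simp del: atLeastLessThan_iff)
      finally show ?thesis using True by simp
    next
      case False
      then have "indicator {real j..<real j + 1} y = (0 :: ennreal)" for j by (auto simp: indicator_def)
      then show ?thesis using False by simp
    qed
  qed
  also have "\<dots> = (\<Sum>j. \<integral>\<^sup>+y. f j * indicator {real j..<real j + 1} y \<partial>lborel)"
    by (rule nn_integral_suminf) simp
  also have "\<dots> = (\<Sum>j. f j)" by (simp add: nn_integral_cmult_indicator)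
  finally show ?thesis ..
qed

definition area :: "real \<Rightarrow> ennreal" where
  "area t = (\<Sum>r. \<Sum>j. ennreal (filled r j t))"

definition scaled_filled :: "real \<Rightarrow> real \<times> real \<Rightarrow> real" where
  "scaled_filled t z = indicator ({0..} \<times> {0..}) z * filled (nat \<lfloor>fst z * t\<rfloor>) (nat \<lfloor>snd z * t\<rfloor>) t"

lemma filled_nonneg: "0 \<le> filled r j t"
  by (simp add: filled_def)

lemma measurable_scaled_filled[measurable]: "scaled_filled t \<in> borel_measurable (lborel \<Otimes>\<^sub>M lborel)"
proof -
  have [measurable]: "(\<lambda>z :: real \<times> real. nat \<lfloor>fst z * t\<rfloor>) \<in> measurable (lborel \<Otimes>\<^sub>M lborel) (count_space UNIV)"
    "(\<lambda>z :: real \<times> real. nat \<lfloor>snd z * t\<rfloor>) \<in> measurable (lborel \<Otimes>\<^sub>M lborel) (count_space UNIV)"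
    by measurable
  have "(\<lambda>z :: real \<times> real. filled i (nat \<lfloor>snd z * t\<rfloor>) t) \<in> borel_measurable (lborel \<Otimes>\<^sub>M lborel)" for i
    by (rule measurable_compose_countable[where f="\<lambda>j z. filled i j t"]) simp_all
  then have [measurable]: "(\<lambda>z. filled (nat \<lfloor>fst z * t\<rfloor>) (nat \<lfloor>snd z * t\<rfloor>) t) \<in> borel_measurable (lborel \<Otimes>\<^sub>M lborel)"
    by (rule measurable_compose_countable[where f="\<lambda>i z. filled i (nat \<lfloor>snd z * t\<rfloor>) t"]) simp
  show ?thesis unfolding scaled_filled_def[abs_def] by measurable
qed

lemma area_eq_nn_integral:
  assumes t: "0 < t"
  shows "area t = ennreal (t\<^sup>2) * (\<integral>\<^sup>+z. ennreal (scaled_filled t z) \<partial>(lborel \<Otimes>\<^sub>M lborel))"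
proof -
  have scale: "(\<Sum>j. f j) = ennreal t * (\<integral>\<^sup>+y. indicator {0..} y * f (nat \<lfloor>y * t\<rfloor>) \<partial>lborel)" for f :: "nat \<Rightarrow> ennreal"
  proof -
    have m: "(\<lambda>y::real. f (nat \<lfloor>y\<rfloor>)) \<in> borel_measurable borel"
      by (rule measurable_compose_countable[where f="\<lambda>j y. f j"]) simp_all
    have "(\<Sum>j. f j) = (\<integral>\<^sup>+(y :: real). indicator {0..} y * f (nat \<lfloor>y\<rfloor>) \<partial>lborel)" by (rule suminf_eq_nn_integral_floor)
    also have "\<dots> = ennreal \<bar>t\<bar> * (\<integral>\<^sup>+y. indicator {0..} (0 + t * y) * f (nat \<lfloor>0 + t * y\<rfloor>) \<partial>lborel)"
      by (rule nn_integral_real_affine) (use t m in auto)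
    also have "\<dots> = ennreal t * (\<integral>\<^sup>+y. indicator {0..} y * f (nat \<lfloor>y * t\<rfloor>) \<partial>lborel)"
      using t by (auto intro!: arg_cong2[where f="(*)"] nn_integral_cong simp: indicator_def zero_le_mult_iff mult.commute)
    finally show ?thesis .
  qed
  have sf: "ennreal (scaled_filled t (x, y)) =
      indicator {0..} x * (indicator {0..} y * ennreal (filled (nat \<lfloor>x * t\<rfloor>) (nat \<lfloor>y * t\<rfloor>) t))" for x y
    by (auto simp: scaled_filled_def indicator_def)
  have m: "(\<lambda>y::real. indicator {0..} y * ennreal (filled i (nat \<lfloor>y * t\<rfloor>) t)) \<in> borel_measurable borel" for i
  proof -
    have "(\<lambda>y::real. ennreal (filled i (nat \<lfloor>y * t\<rfloor>) t)) \<in> borel_measurable borel"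
      by (rule measurable_compose_countable[where f="\<lambda>j y. ennreal (filled i j t)"]) simp_all
    then show ?thesis by simp
  qed
  have "area t = ennreal t * (\<integral>\<^sup>+x. indicator {0..} x * (ennreal t *
      (\<integral>\<^sup>+y. indicator {0..} y * ennreal (filled (nat \<lfloor>x * t\<rfloor>) (nat \<lfloor>y * t\<rfloor>) t) \<partial>lborel)) \<partial>lborel)"
    unfolding area_def by (subst (1 2) scale) (rule refl)
  also have "\<dots> = ennreal t * (\<integral>\<^sup>+x. ennreal t * (\<integral>\<^sup>+y. ennreal (scaled_filled t (x, y)) \<partial>lborel) \<partial>lborel)"
    unfolding sf using m by (simp add: nn_integral_cmult mult.left_commute)
  also have "\<dots> = ennreal t * (ennreal t * (\<integral>\<^sup>+x. \<integral>\<^sup>+y. ennreal (scaled_filled t (x, y)) \<partial>lborel \<partial>lborel))"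
    by (subst nn_integral_cmult) simp_all
  also have "(\<integral>\<^sup>+x. \<integral>\<^sup>+y. ennreal (scaled_filled t (x, y)) \<partial>lborel \<partial>lborel) =
      (\<integral>\<^sup>+z. ennreal (scaled_filled t z) \<partial>(lborel \<Otimes>\<^sub>M lborel))"
    by (rule lborel.nn_integral_fst) simp
  finally show ?thesis using t by (simp add: power2_eq_square ennreal_mult mult.assoc)
qed

definition shape :: "(real \<times> real) set" where
  "shape = {z. 0 \<le> fst z \<and> 0 \<le> snd z \<and> sqrt (fst z) + sqrt (snd z) < 1}"

lemma sets_shape[measurable]: "shape \<in> sets (lborel \<Otimes>\<^sub>M lborel)"
proof -
  let ?Q = "{z \<in> space (lborel \<Otimes>\<^sub>M lborel). 0 \<le> fst z \<and> 0 \<le> snd z \<and> sqrt (fst z) + sqrt (snd z) < (1::real)}"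
  have Q: "?Q \<in> sets (lborel \<Otimes>\<^sub>M lborel)" by measurable
  have eq: "?Q = shape" by (auto simp: shape_def space_pair_measure)
  show ?thesis using Q unfolding eq .
qed

lemma emeasure_shape: "emeasure (lborel \<Otimes>\<^sub>M lborel) shape = ennreal (1 / 6)"
proof -
  have "emeasure (lborel \<Otimes>\<^sub>M lborel) shape = (\<integral>\<^sup>+x. emeasure lborel (Pair x -` shape) \<partial>lborel)"
    by (rule lborel.emeasure_pair_measure_alt) (rule sets_shape)
  also have "\<dots> = (\<integral>\<^sup>+x. ennreal ((1 - sqrt x)\<^sup>2) * indicator {0..1} x \<partial>lborel)"
  proof (rule nn_integral_cong)
    fix x :: real
    show "emeasure lborel (Pair x -` shape) = ennreal ((1 - sqrt x)\<^sup>2) * indicator {0..1} x"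
    proof (cases "0 \<le> x \<and> x \<le> 1")
      case True
      then have r: "0 \<le> 1 - sqrt x" by simp
      have "sqrt x + sqrt y < 1 \<longleftrightarrow> y < (1 - sqrt x)\<^sup>2" if "0 \<le> y" for y
      proof -
        have "y < (1 - sqrt x)\<^sup>2 \<longleftrightarrow> sqrt y < sqrt ((1 - sqrt x)\<^sup>2)"
          by (rule real_sqrt_less_iff[symmetric])
        also have "\<dots> \<longleftrightarrow> sqrt y < 1 - sqrt x" using r by simp
        finally show ?thesis by auto
      qed
      then have "Pair x -` shape = {0..<(1 - sqrt x)\<^sup>2}" using True by (auto simp: shape_def)
      then show ?thesis using True by simp
    next
      case False
      have "Pair x -` shape = {}"
      proof (cases "x < 0")
        case False
        then have "1 < x" using \<open>\<not> (0 \<le> x \<and> x \<le> 1)\<close> by simp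
        then have "1 < sqrt x" by simp
        then have "\<not> sqrt x + sqrt y < 1" if "0 \<le> y" for y using real_sqrt_ge_zero[OF that] by linarith
        then show ?thesis by (auto simp: shape_def)
      qed (auto simp: shape_def)
      then show ?thesis using False by auto
    qed
  qed
  also have "\<dots> = ennreal ((1 - 4/3 * (1 * sqrt 1) + 1\<^sup>2 / 2) - (0 - 4/3 * (0 * sqrt 0) + 0\<^sup>2 / 2))"
  proof (rule nn_integral_FTC_Icc[where F="\<lambda>x. x - 4/3 * (x * sqrt x) + x\<^sup>2 / 2"])
    show "(\<lambda>x::real. (1 - sqrt x)\<^sup>2) \<in> borel_measurable borel" by measurable
    show "((\<lambda>x. x - 4/3 * (x * sqrt x) + x\<^sup>2 / 2) has_real_derivative (1 - sqrt x)\<^sup>2) (at x)"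
      if "x \<in> {0..1}" for x :: real
    proof -
      have x: "0 \<le> x" "x \<le> 1" using that by auto
      \<comment> \<open>The product is differentiable at \<open>0\<close> although
        \<open>sqrt\<close> is not: its difference quotient there is \<open>sqrt h\<close>.\<close>
      have d: "((\<lambda>x. x * sqrt x) has_real_derivative 3/2 * sqrt x) (at x)"
      proof (cases "x = 0")
        case True
        have "(\<lambda>h. sqrt h) \<midarrow>0\<rightarrow> sqrt 0" by (intro tendsto_intros)
        then have "(\<lambda>h. ((0 + h) * sqrt (0 + h) - 0 * sqrt 0) / h) \<midarrow>0\<rightarrow> sqrt 0"
          by (rule Lim_transform_eventually) (auto simp: eventually_at_filter)
        then show ?thesis using True by (simp add: DERIV_def)
      next
        case False
        then have "0 < x" using x by simp
        from DERIV_mult'[OF DERIV_ident DERIV_real_sqrt[OF this]]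
        have "((\<lambda>x. x * sqrt x) has_real_derivative x * (inverse (sqrt x) / 2) + 1 * sqrt x) (at x)" .
        moreover have "x * (inverse (sqrt x) / 2) + 1 * sqrt x = 3/2 * sqrt x"
        proof -
          have "x * (inverse (sqrt x) / 2) + 1 * sqrt x = (x / sqrt x) / 2 + sqrt x"
            by (simp only: divide_inverse mult.assoc mult_1)
          then show ?thesis unfolding real_div_sqrt[OF x(1)] by simp
        qed
        ultimately show ?thesis by (simp only:)
      qed
      have "((\<lambda>x. x\<^sup>2 / 2) has_real_derivative x) (at x)" by (auto intro!: derivative_eq_intros)
      from DERIV_add[OF DERIV_diff[OF DERIV_ident DERIV_cmult[OF d, of "4/3"]] this]
      have "((\<lambda>x. x - 4/3 * (x * sqrt x) + x\<^sup>2 / 2) has_real_derivative 1 - 4/3 * (3/2 * sqrt x) + x) (at x)" .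
      moreover have "1 - 4/3 * (3/2 * sqrt x) + x = (1 - sqrt x)\<^sup>2" using x by (simp add: power2_diff)
      ultimately show ?thesis by (simp only:)
    qed
  qed simp_all
  finally show ?thesis by simp
qed

lemma tendsto_filled:
  assumes xy: "0 < x" "0 < y" "sqrt x + sqrt y \<noteq> 1"
  shows "((\<lambda>t. filled (nat \<lfloor>x * t\<rfloor>) (nat \<lfloor>y * t\<rfloor>) t) \<longlongrightarrow> (if sqrt x + sqrt y < 1 then 1 else 0)) at_top"
proof -
  have lim: "((\<lambda>t. real (Suc (nat \<lfloor>x * t\<rfloor>)) / t) \<longlongrightarrow> x) at_top" if "0 < x" for x
  proof -
    have "((\<lambda>t. real (nat \<lfloor>x * t\<rfloor>) / t + 1 / t) \<longlongrightarrow> x + 0) at_top"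
      using that by (intro tendsto_add tendsto_nat_floor_div tendsto_divide_0[OF tendsto_const]
        filterlim_at_top_imp_at_infinity filterlim_ident) simp
    then show ?thesis by (simp add: add_divide_distrib add.commute)
  qed
  have m: "{e\<in>space grid. lpp (bulk e) (Suc r) (Suc j) \<le> t} \<in> sets grid" for r j t
    by (rule borel_measurable_le[OF measurable_lpp_bulk]) simp
  show ?thesis
  proof (cases "sqrt x + sqrt y < 1")
    case True
    then show ?thesis unfolding filled_def
      using whp_lim[OF whp_lpp_le[OF xy(1,2) True lim[OF xy(1)] lim[OF xy(2)]] m] by simp
  next
    case False
    then have "1 < sqrt x + sqrt y" using xy by simp
    from whp_lpp_gt[OF xy(1,2) this lim[OF xy(1)] lim[OF xy(2)]]
    have "whp (\<lambda>t e. \<not> lpp (bulk e) (Suc (nat \<lfloor>x * t\<rfloor>)) (Suc (nat \<lfloor>y * t\<rfloor>)) \<le> t)" by (simp add: not_le)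
    from whp_not_lim[OF this m] show ?thesis using False by (simp add: filled_def)
  qed
qed

text \<open>A majorant free of \<open>t\<close>, for dominated convergence. Where
  \<open>1 - ln 2 * u\<close> is negative, \<open>t \<ge> 1\<close> can be replaced by
  \<open>1\<close> in the exponent; elsewhere the trivial bound by one suffices. Then
  \<open>max x y \<ge> (x + y) / 2\<close> yields an integrable product.\<close>

lemma filled_scaled_le:
  assumes t: "1 \<le> t" and xy: "0 \<le> x" "0 \<le> y"
  shows "filled (nat \<lfloor>x * t\<rfloor>) (nat \<lfloor>y * t\<rfloor>) t \<le> exp 1 * (exp (- (ln 2 / 2) * x) * exp (- (ln 2 / 2) * y))"
proof -
  interpret G: prob_space grid by (rule prob_space_grid)
  let ?p = "filled (nat \<lfloor>x * t\<rfloor>) (nat \<lfloor>y * t\<rfloor>) t"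
  have pow: "exp t * (1/2) ^ Suc (nat \<lfloor>u * t\<rfloor>) \<le> exp (t * (1 - ln 2 * u))" if "0 \<le> u" for u
  proof -
    have "u * t \<le> real (Suc (nat \<lfloor>u * t\<rfloor>))" by linarith
    then have "- (ln 2 * real (Suc (nat \<lfloor>u * t\<rfloor>))) \<le> - (ln 2 * (u * t))" by simp
    moreover have "(1/2 :: real) ^ n = exp (- (ln 2 * real n))" for n
      by (simp add: exp_minus exp_of_nat2_mult power_one_over inverse_eq_divide)
    ultimately have "exp t * (1/2) ^ Suc (nat \<lfloor>u * t\<rfloor>) \<le> exp t * exp (- (ln 2 * (u * t)))"
      by (simp del: power_Suc of_nat_Suc)
    also have "\<dots> = exp (t * (1 - ln 2 * u))" by (simp add: mult_exp_exp algebra_simps)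
    finally show ?thesis .
  qed
  have "?p \<le> exp (t * (1 - ln 2 * u))" if "u = x \<or> u = y" for u
    using that filled_le[of "nat \<lfloor>x * t\<rfloor>" "nat \<lfloor>y * t\<rfloor>" t] pow[of x] pow[of y] xy by (auto intro: order_trans)
  moreover have "?p \<le> 1" by (simp add: filled_def)
  ultimately have bound: "?p \<le> exp (1 - ln 2 * u)" if "u = x \<or> u = y" for u
  proof (cases "0 \<le> 1 - ln 2 * u")
    case True
    then have "1 \<le> exp (1 - ln 2 * u)" by simp
    with \<open>?p \<le> 1\<close> show ?thesis by linarith
  next
    case False
    then have "t * (1 - ln 2 * u) \<le> 1 - ln 2 * u" using t mult_right_mono_neg[of 1 t "1 - ln 2 * u"] by simp
    then have "exp (t * (1 - ln 2 * u)) \<le> exp (1 - ln 2 * u)" by simp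
    with \<open>\<And>u. u = x \<or> u = y \<Longrightarrow> ?p \<le> exp (t * (1 - ln 2 * u))\<close>[OF that] show ?thesis by linarith
  qed
  have "?p \<le> exp (1 - ln 2 * max x y)" using bound[of "max x y"] by (auto simp: max_def)
  also have "1 - ln 2 * max x y \<le> 1 - (ln 2 / 2 * x + ln 2 / 2 * y)"
  proof -
    have "(x + y) / 2 \<le> max x y" by (simp add: max_def)
    then have "ln 2 * ((x + y) / 2) \<le> ln 2 * max x y" by (intro mult_left_mono) simp_all
    then show ?thesis by (simp add: algebra_simps)
  qed
  finally have "?p \<le> exp (1 - (ln 2 / 2 * x + ln 2 / 2 * y))" by simp
  also have "\<dots> = exp 1 * (exp (- (ln 2 / 2) * x) * exp (- (ln 2 / 2) * y))"
    by (simp only: mult_exp_exp) (simp add: algebra_simps)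
  finally show ?thesis .
qed

lemma
  shows tendsto_scaled_filled: "((\<lambda>t. \<integral>z. scaled_filled t z \<partial>(lborel \<Otimes>\<^sub>M lborel)) \<longlongrightarrow> 1 / 6) at_top"
    and integrable_scaled_filled: "1 \<le> t \<Longrightarrow> integrable (lborel \<Otimes>\<^sub>M lborel) (scaled_filled t)"
proof -
  let ?M = "lborel \<Otimes>\<^sub>M lborel :: (real \<times> real) measure"
  define c where "c = ln 2 / (2::real)"
  have c: "0 < c" by (simp add: c_def)
  define g where "g x = indicator {0..} x * exp (- c * x)" for x :: real
  have [measurable]: "g \<in> borel_measurable borel" unfolding g_def[abs_def] by measurable
  have gi: "integrable lborel g"
  proof (rule integrableI_nonneg)
    have "(\<integral>\<^sup>+x. ennreal (g x) \<partial>lborel) = (\<integral>\<^sup>+x. ennreal (1 / c) * (ennreal (exponential_density c x) * 1) \<partial>lborel)"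
      using c by (intro nn_integral_cong) (auto simp: g_def exponential_density_def indicator_def mult.commute simp flip: ennreal_mult)
    also have "\<dots> = ennreal (1 / c) * (\<integral>\<^sup>+x. 1 \<partial>expm c)"
      by (subst nn_integral_expm) (auto simp: nn_integral_cmult)
    also have "\<dots> < \<infinity>"
      using prob_space.emeasure_space_1[OF prob_space_expm[OF c]] by simp
    finally show "(\<integral>\<^sup>+x. ennreal (g x) \<partial>lborel) < \<infinity>" .
  qed (auto simp: g_def)
  define w where "w z = exp 1 * (g (fst z) * g (snd z))" for z :: "real \<times> real"
  have wi: "integrable ?M w"
  proof -
    have "integrable ?M (\<lambda>z. g (fst z) * g (snd z))"
      by (rule lborel_pair.Fubini_integrable) (use gi in \<open>auto simp: abs_mult\<close>)
    then show ?thesis unfolding w_def by simp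
  qed
  have bound: "norm (scaled_filled t z) \<le> w z" if t: "1 \<le> t" for t z
  proof (cases "0 \<le> fst z \<and> 0 \<le> snd z")
    case True
    then have "indicator ({0..} \<times> {0..}) z = (1 :: real)" by (cases z) auto
    then show ?thesis using filled_scaled_le[OF t, of "fst z" "snd z"] True
      by (simp add: scaled_filled_def w_def g_def c_def filled_nonneg)
  next
    case False
    then have "indicator ({0..} \<times> {0..}) z = (0 :: real)" by (cases z) auto
    then show ?thesis by (simp add: scaled_filled_def w_def g_def)
  qed
  show "integrable ?M (scaled_filled t)" if "1 \<le> t"
  proof (rule Bochner_Integration.integrable_bound[OF wi])
    show "AE z in ?M. norm (scaled_filled t z) \<le> norm (w z)"
    proof (rule AE_I2)
      fix z
      have "w z \<le> norm (w z)" by simp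
      then show "norm (scaled_filled t z) \<le> norm (w z)" by (rule order_trans[OF bound[OF that]])
    qed
  qed (rule measurable_scaled_filled)
  have "((\<lambda>t. \<integral>z. scaled_filled t z \<partial>?M) \<longlongrightarrow> (\<integral>z. indicator shape z \<partial>?M)) at_top"
  proof (rule integral_dominated_convergence_at_top[where w=w])
    show "\<forall>\<^sub>F t in at_top. AE z in ?M. norm (scaled_filled t z) \<le> w z"
      using eventually_ge_at_top[of 1] by eventually_elim (use bound in auto)
    show "AE z in ?M. ((\<lambda>t. scaled_filled t z) \<longlongrightarrow> indicator shape z) at_top"
    proof -
      let ?P = "\<lambda>z :: real \<times> real. fst z \<noteq> 0 \<and> snd z \<noteq> 0 \<and> sqrt (fst z) + sqrt (snd z) \<noteq> 1"
      have "AE z in ?M. ?P z"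
      proof (rule lborel_pair.AE_pair_measure)
        show "{z \<in> space ?M. ?P z} \<in> sets ?M" by measurable
        have "AE x in lborel. x \<noteq> (0::real)" by (rule AE_lborel_singleton)
        then show "AE x in lborel. AE y in lborel. ?P (x, y)"
        proof eventually_elim
          case (elim x)
          show ?case
            using AE_lborel_singleton[of 0] AE_lborel_singleton[of "(1 - sqrt x)\<^sup>2"]
              AE_lborel_singleton[of "- ((1 - sqrt x)\<^sup>2)"]
          proof eventually_elim
            case (elim y)
            \<comment> \<open>\<open>sqrt\<close> is an odd function, so a negative \<open>y\<close>
              may solve the equation too; this is the third excluded value.\<close>
            have "sqrt x + sqrt y \<noteq> 1"
            proof
              assume "sqrt x + sqrt y = 1"
              then have "1 - sqrt x = sqrt y" by linarith
              then have eq: "(1 - sqrt x)\<^sup>2 = (sqrt y)\<^sup>2" by (rule arg_cong)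
              show False
              proof (cases "0 \<le> y")
                case True then show False using eq elim by simp
              next
                case False
                then have "(sqrt y)\<^sup>2 = (sqrt (- y))\<^sup>2" by (simp add: real_sqrt_minus)
                also have "\<dots> = - y" using False by simp
                finally show False using eq elim by simp
              qed
            qed
            then show ?case using elim \<open>x \<noteq> 0\<close> by simp
          qed
        qed
      qed
      then show ?thesis
      proof eventually_elim
        case (elim z)
        show ?case
        proof (cases "0 \<le> fst z \<and> 0 \<le> snd z")
          case True
          then have "indicator ({0..} \<times> {0..}) z = (1 :: real)" by (cases z) auto
          moreover have "((\<lambda>t. filled (nat \<lfloor>fst z * t\<rfloor>) (nat \<lfloor>snd z * t\<rfloor>) t) \<longlongrightarrow>
              (if sqrt (fst z) + sqrt (snd z) < 1 then 1 else 0)) at_top"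
            by (rule tendsto_filled) (use True elim in auto)
          ultimately show ?thesis using True by (auto simp: scaled_filled_def shape_def indicator_def)
        next
          case False
          then have "indicator ({0..} \<times> {0..}) z = (0 :: real)" "z \<notin> shape" by (cases z; auto simp: shape_def)+
          then show ?thesis by (simp add: scaled_filled_def)
        qed
      qed
    qed
  qed (use wi in simp_all)
  moreover have "(\<integral>z. indicator shape z \<partial>?M) = (1 / 6 :: real)"
    using emeasure_shape by (simp add: measure_def space_pair_measure)
  ultimately show "((\<lambda>t. \<integral>z. scaled_filled t z \<partial>?M) \<longlongrightarrow> 1 / 6) at_top" by (simp only:)
qed

lemma area_eq:
  assumes "1 \<le> t" shows "area t = ennreal (t\<^sup>2 * (\<integral>z. scaled_filled t z \<partial>(lborel \<Otimes>\<^sub>M lborel)))"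
proof -
  have nn: "0 \<le> scaled_filled t z" for z by (simp add: scaled_filled_def filled_nonneg)
  have "area t = ennreal (t\<^sup>2) * ennreal (\<integral>z. scaled_filled t z \<partial>(lborel \<Otimes>\<^sub>M lborel))"
    using assms nn by (subst area_eq_nn_integral) (auto simp: nn_integral_eq_integral integrable_scaled_filled)
  then show ?thesis by (simp add: ennreal_mult')
qed

text \<open>\<open>b t\<close> lies between the difference quotients of \<open>\<phi>\<close> over
  the intervals from \<open>(1 - \<epsilon>) * t\<close> to \<open>t\<close> and from
  \<open>t\<close> to \<open>(1 + \<epsilon>) * t\<close>. Divided by \<open>t\<close>, these tend
  to \<open>(2 - \<epsilon>) * c\<close> and \<open>(2 + \<epsilon>) * c\<close>.\<close>

lemma tauberian_mono:
  fixes b \<phi> :: "real \<Rightarrow> real"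
  assumes lower: "\<And>s t. 1 \<le> s \<Longrightarrow> s < t \<Longrightarrow> (t - s) * b s \<le> \<phi> t - \<phi> s"
    and upper: "\<And>s t. 1 \<le> s \<Longrightarrow> s < t \<Longrightarrow> \<phi> t - \<phi> s \<le> (t - s) * b t"
    and lim: "((\<lambda>t. \<phi> t / t\<^sup>2) \<longlongrightarrow> c) at_top"
  shows "((\<lambda>t. b t / t) \<longlongrightarrow> 2 * c) at_top"
proof (rule tendstoI)
  fix \<eta> :: real assume \<eta>: "0 < \<eta>"
  \<comment> \<open>Small enough that the error \<open>\<epsilon> * c\<close> stays below
    \<open>\<eta>\<close>, and below one so that \<open>(1 - \<epsilon>) * t\<close> tends to
    infinity.\<close>
  define \<epsilon> where "\<epsilon> = min (1/2) (\<eta> / (2 * (\<bar>c\<bar> + 1)))"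
  have \<epsilon>: "0 < \<epsilon>" "\<epsilon> < 1" using \<eta> by (auto simp: \<epsilon>_def min_def)
  have "\<epsilon> \<le> \<eta> / (2 * (\<bar>c\<bar> + 1))" by (simp add: \<epsilon>_def)
  then have "\<epsilon> * (\<bar>c\<bar> + 1) \<le> \<eta> / 2" by (simp add: field_simps)
  moreover have "\<bar>\<epsilon> * c\<bar> \<le> \<epsilon> * (\<bar>c\<bar> + 1)" using \<epsilon> by (simp add: abs_mult)
  ultimately have \<epsilon>c: "\<bar>\<epsilon> * c\<bar> < \<eta>" using \<eta> by linarith
  have scaled: "((\<lambda>t. \<phi> (a * t) / t\<^sup>2) \<longlongrightarrow> a\<^sup>2 * c) at_top" if a: "0 < a" for a
  proof -
    have "filterlim (\<lambda>t. a * t) at_top at_top"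
      by (rule filterlim_tendsto_pos_mult_at_top[OF tendsto_const a filterlim_ident])
    from filterlim_compose[OF lim this] have "((\<lambda>t. a\<^sup>2 * (\<phi> (a * t) / (a * t)\<^sup>2)) \<longlongrightarrow> a\<^sup>2 * c) at_top"
      by (intro tendsto_mult tendsto_const)
    then show ?thesis using a by (simp add: power_mult_distrib)
  qed
  have "((\<lambda>t. (\<phi> ((1 + \<epsilon>) * t) / t\<^sup>2 - \<phi> t / t\<^sup>2) / \<epsilon>) \<longlongrightarrow> ((1 + \<epsilon>)\<^sup>2 * c - c) / \<epsilon>) at_top"
    using \<epsilon> by (intro tendsto_divide tendsto_diff scaled lim tendsto_const) auto
  moreover have "((1 + \<epsilon>)\<^sup>2 * c - c) / \<epsilon> = 2 * c + \<epsilon> * c" using \<epsilon> by (simp add: power2_eq_square field_simps)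
  ultimately have "\<forall>\<^sub>F t in at_top. (\<phi> ((1 + \<epsilon>) * t) / t\<^sup>2 - \<phi> t / t\<^sup>2) / \<epsilon> < 2 * c + \<eta>"
    using \<epsilon>c by (intro order_tendstoD(2)) auto
  moreover have "((\<lambda>t. (\<phi> t / t\<^sup>2 - \<phi> ((1 - \<epsilon>) * t) / t\<^sup>2) / \<epsilon>) \<longlongrightarrow> (c - (1 - \<epsilon>)\<^sup>2 * c) / \<epsilon>) at_top"
    using \<epsilon> by (intro tendsto_divide tendsto_diff scaled lim tendsto_const) auto
  moreover have "(c - (1 - \<epsilon>)\<^sup>2 * c) / \<epsilon> = 2 * c - \<epsilon> * c" using \<epsilon> by (simp add: power2_eq_square field_simps)
  ultimately have ev: "\<forall>\<^sub>F t in at_top. (\<phi> ((1 + \<epsilon>) * t) / t\<^sup>2 - \<phi> t / t\<^sup>2) / \<epsilon> < 2 * c + \<eta>"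
    "\<forall>\<^sub>F t in at_top. 2 * c - \<eta> < (\<phi> t / t\<^sup>2 - \<phi> ((1 - \<epsilon>) * t) / t\<^sup>2) / \<epsilon>"
    using \<epsilon>c by (auto intro!: order_tendstoD(1))
  show "\<forall>\<^sub>F t in at_top. dist (b t / t) (2 * c) < \<eta>"
    using ev eventually_ge_at_top[of "1 / (1 - \<epsilon>)"] eventually_ge_at_top[of 1]
  proof eventually_elim
    case (elim t)
    have t: "0 < t" "1 \<le> (1 - \<epsilon>) * t" using elim \<epsilon> by (auto simp: field_simps)
    have t\<epsilon>: "0 < t\<^sup>2 * \<epsilon>" using t \<epsilon> by simp
    have b: "b t / t = \<epsilon> * t * b t / (t\<^sup>2 * \<epsilon>)" using t \<epsilon> by (simp add: power2_eq_square)
    have "\<epsilon> * t * b t \<le> \<phi> ((1 + \<epsilon>) * t) - \<phi> t"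
      using lower[of t "(1 + \<epsilon>) * t"] elim t \<epsilon> by (simp add: algebra_simps)
    then have "b t / t \<le> (\<phi> ((1 + \<epsilon>) * t) - \<phi> t) / (t\<^sup>2 * \<epsilon>)"
      unfolding b using t\<epsilon> by (intro divide_right_mono) auto
    moreover have "\<phi> t - \<phi> ((1 - \<epsilon>) * t) \<le> \<epsilon> * t * b t"
      using upper[of "(1 - \<epsilon>) * t" t] elim t \<epsilon> by (simp add: algebra_simps)
    then have "(\<phi> t - \<phi> ((1 - \<epsilon>) * t)) / (t\<^sup>2 * \<epsilon>) \<le> b t / t"
      unfolding b using t\<epsilon> by (intro divide_right_mono) auto
    moreover have "(p / t\<^sup>2 - q / t\<^sup>2) / \<epsilon> = (p - q) / (t\<^sup>2 * \<epsilon>)" for p q by (simp add: diff_divide_distrib)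
    ultimately show ?case using elim by (simp add: dist_real_def abs_less_iff)
  qed
qed

text \<open>Summing the compensator identity over the rows makes \<open>area\<close> the primitive
  of the total rate, and monotonicity of the rate gives the two inequalities required by
  \<open>tauberian_mono\<close>.\<close>

theorem tendsto_corner_rate:
  "((\<lambda>t. enn2real (\<Sum>r. corner_rate r t) / t) \<longlongrightarrow> 1 / 3) at_top"
proof -
  let ?B = "\<lambda>t. \<Sum>r. corner_rate r t"
  have mono: "?B s \<le> ?B t" if "0 \<le> s" "s \<le> t" for s t
    by (intro suminf_le corner_rate_mono that) auto
  have int: "(\<integral>\<^sup>+u. indicator {..t} u * ?B u \<partial>lborel) = area t" for t
  proof -
    have "(\<integral>\<^sup>+u. indicator {..t} u * ?B u \<partial>lborel) = (\<integral>\<^sup>+u. (\<Sum>r. indicator {..t} u * corner_rate r u) \<partial>lborel)"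
      by simp
    also have "\<dots> = (\<Sum>r. \<integral>\<^sup>+u. indicator {..t} u * corner_rate r u \<partial>lborel)"
      by (rule nn_integral_suminf) measurable
    finally show ?thesis by (simp only: nn_integral_corner_rate emeasure_lpp_rows area_def)
  qed
  have split: "area t = area s + (\<integral>\<^sup>+u. indicator {s<..t} u * ?B u \<partial>lborel)" if "s < t" for s t
  proof -
    have "area t = (\<integral>\<^sup>+u. indicator {..s} u * ?B u + indicator {s<..t} u * ?B u \<partial>lborel)"
      unfolding int[symmetric] using that by (intro nn_integral_cong) (auto simp: indicator_def)
    also have "\<dots> = area s + (\<integral>\<^sup>+u. indicator {s<..t} u * ?B u \<partial>lborel)"
      unfolding int[symmetric] by (rule nn_integral_add) measurable
    finally show ?thesis .
  qed
  have const: "(\<integral>\<^sup>+u. indicator {s<..t} u * K \<partial>lborel) = ennreal (t - s) * K" if "s < t" for s t :: real and K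
    using that by (simp add: nn_integral_multc)
  have low: "area s + ennreal (t - s) * ?B s \<le> area t" if "0 \<le> s" "s < t" for s t
  proof -
    have "ennreal (t - s) * ?B s \<le> (\<integral>\<^sup>+u. indicator {s<..t} u * ?B u \<partial>lborel)"
      unfolding const[OF that(2), symmetric]
      by (intro nn_integral_mono) (use that in \<open>auto simp: indicator_def intro!: mono\<close>)
    then show ?thesis unfolding split[OF that(2)] by (rule add_left_mono)
  qed
  have up: "area t \<le> area s + ennreal (t - s) * ?B t" if "0 \<le> s" "s < t" for s t
  proof -
    have "(\<integral>\<^sup>+u. indicator {s<..t} u * ?B u \<partial>lborel) \<le> ennreal (t - s) * ?B t"
      unfolding const[OF that(2), symmetric]
      by (intro nn_integral_mono) (use that in \<open>auto simp: indicator_def intro!: mono\<close>)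
    then show ?thesis unfolding split[OF that(2)] by (rule add_left_mono)
  qed
  define \<phi> where "\<phi> t = t\<^sup>2 * (\<integral>z. scaled_filled t z \<partial>(lborel \<Otimes>\<^sub>M lborel))" for t
  have \<phi>0: "0 \<le> \<phi> t" for t
    by (auto simp: \<phi>_def scaled_filled_def filled_nonneg intro!: mult_nonneg_nonneg integral_nonneg)
  have area: "area t = ennreal (\<phi> t)" if "1 \<le> t" for t using area_eq[OF that] by (simp add: \<phi>_def)
  \<comment> \<open>Monotonicity over a unit interval bounds \<open>?B t\<close> by
    \<open>area (t + 1)\<close>, which is finite by the integrable majorant.\<close>
  have fin: "?B t < \<infinity>" if "1 \<le> t" for t
  proof -
    have "?B t \<le> area t + ennreal (t + 1 - t) * ?B t" by (simp add: add_increasing)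
    also have "\<dots> \<le> area (t + 1)" using that by (intro low) auto
    also have "\<dots> < \<infinity>" using that by (simp add: area)
    finally show ?thesis .
  qed
  define b where "b t = enn2real (?B t)" for t
  have B: "?B t = ennreal (b t)" if "1 \<le> t" for t using fin[OF that] by (simp add: b_def)
  have b0: "0 \<le> b t" for t by (simp add: b_def)
  have "((\<lambda>t. b t / t) \<longlongrightarrow> 2 * (1 / 6)) at_top"
  proof (rule tauberian_mono)
    fix s t :: real assume st: "1 \<le> s" "s < t"
    have "ennreal (\<phi> s + (t - s) * b s) \<le> ennreal (\<phi> t)"
      using low[of s t] st b0 \<phi>0 by (simp add: area B ennreal_plus ennreal_mult)
    then show "(t - s) * b s \<le> \<phi> t - \<phi> s" using \<phi>0[of t] by (simp add: ennreal_le_iff)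
    have "ennreal (\<phi> t) \<le> ennreal (\<phi> s + (t - s) * b t)"
      using up[of s t] st b0 \<phi>0 by (simp add: area B ennreal_plus ennreal_mult)
    moreover have "0 \<le> \<phi> s + (t - s) * b t" using st b0 \<phi>0 by (intro add_nonneg_nonneg mult_nonneg_nonneg) auto
    ultimately show "\<phi> t - \<phi> s \<le> (t - s) * b t" by (simp add: ennreal_le_iff)
  next
    have "\<forall>\<^sub>F t in at_top. (\<integral>z. scaled_filled t z \<partial>(lborel \<Otimes>\<^sub>M lborel)) = \<phi> t / t\<^sup>2"
      using eventually_gt_at_top[of 0] by eventually_elim (simp add: \<phi>_def)
    with tendsto_scaled_filled show "((\<lambda>t. \<phi> t / t\<^sup>2) \<longlongrightarrow> 1 / 6) at_top"
      by (rule Lim_transform_eventually)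
  qed
  then show ?thesis by (simp add: b_def)
qed

theorem theorem4p1:
  fixes M :: "'a measure" and W :: "nat \<Rightarrow> nat \<Rightarrow> 'a \<Rightarrow> real"
  assumes "prob_space M"
    and "prob_space.indep_vars M (\<lambda>_. borel) (\<lambda>(r, n). W r n) ({1..} \<times> UNIV)"
    and "\<And>r n. r \<ge> 1 \<Longrightarrow> distributed M lborel (W r n) (exponential_density 1)"
  shows "((\<lambda>t. (\<integral>\<omega>. active_count (\<lambda>r n. W r n \<omega>) t \<partial>M) / t) \<longlongrightarrow> 1 / 3) at_top"
proof (rule Lim_transform_eventually[OF tendsto_corner_rate])
  show "\<forall>\<^sub>F t in at_top. enn2real (\<Sum>r. corner_rate r t) / t =
      (\<integral>\<omega>. active_count (\<lambda>r n. W r n \<omega>) t \<partial>M) / t"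
    using eventually_ge_at_top[of 0]
  proof eventually_elim
    case (elim t)
    show ?case by (subst integral_active_count[OF assms(1,2) _ elim]) (use assms(3) in auto)
  qed
qed

end
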